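(* Suppose that $\mathcal X$ is a semi-abelian category. Consider an object $X$ and a cokernel $$K\xrightarrow{k}B\xrightarrow{f}A\to0$$ in $\mathcal X$ (that is, $f$ is a cokernel of $k$). Then $$X\otimes K\xrightarrow{1_X\otimes k}X\otimes B\xrightarrow{1_X\otimes f}X\otimes A\to0$$ is a right exact sequence of abelian objects, where $\otimes$ is the bilinear product on $\mathcal X$.
   Context: A semi-abelian category is a pointed, Barr-exact, Bourn-protomodular category with finite coproducts. An object is abelian if it admits an internal abelian group structure. A sequence $K\xrightarrow{k}B\xrightarrow{f}A\to0$ is right exact if $k$ is proper (its image is a normal subobject of its codomain) and $f$ is a cokernel of $k$. The cosmash product $X\diamond Y$ is the kernel of the canonical morphism $X+Y\to X\times Y$; the ternary cosmash product $X\diamond Y\diamond Z$ is the kernel of the canonical morphism $X+Y+Z\to(X+Y)\times(X+Z)\times(Y+Z)$ whose components kill $Z$, $Y$, $X$ respectively. The commutator $[X,X,X]$ is the image of $X\diamond X\diamond X\to X+X+X\to X$ (the last arrow being the codiagonal). $X$ is two-nilpotent if $[X,X,X]=0$; the two-nilpotent objects form a full reflective subcategory $\mathsf{Nil}_2(\mathcal X)$, itself semi-abelian, with reflector $\mathrm{nil}_2(X)=X/[X,X,X]$. The bilinear product $X\otimes Y$ is the cosmash product of $\mathrm{nil}_2(X)$ and $\mathrm{nil}_2(Y)$ computed in $\mathsf{Nil}_2(\mathcal X)$; it is a bifunctor. *)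

theory Defs
  imports Main
begin

section \<open>Categories\<close>

text \<open>
  Composition is only meaningful on composable arrows and is written in the usual order:
  \<open>g \<cdot>\<^bsub>C\<^esub> f\<close> is ``\<open>g\<close> after \<open>f\<close>''.
\<close>

record ('o, 'm) precategory =
  Obj :: "'o set"
  Arr :: "'m set"
  Dom :: "'m \<Rightarrow> 'o"
  Cod :: "'m \<Rightarrow> 'o"
  Ident :: "'o \<Rightarrow> 'm"
  Comp :: "'m \<Rightarrow> 'm \<Rightarrow> 'm" (infixl "\<cdot>\<index>" 70)

definition hom :: "('o, 'm, 'x) precategory_scheme \<Rightarrow> 'o \<Rightarrow> 'o \<Rightarrow> 'm set" where
  "hom C X Y = {f \<in> Arr C. Dom C f = X \<and> Cod C f = Y}"

locale category =
  fixes C :: "('o, 'm, 'x) precategory_scheme" (structure)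
  assumes dom_in_Obj: "f \<in> Arr C \<Longrightarrow> Dom C f \<in> Obj C"
    and cod_in_Obj: "f \<in> Arr C \<Longrightarrow> Cod C f \<in> Obj C"
    and ident_in_hom: "X \<in> Obj C \<Longrightarrow> Ident C X \<in> hom C X X"
    and comp_in_hom: "\<lbrakk>f \<in> hom C X Y; g \<in> hom C Y Z\<rbrakk> \<Longrightarrow> g \<cdot> f \<in> hom C X Z"
    and comp_ident_left: "f \<in> hom C X Y \<Longrightarrow> Ident C Y \<cdot> f = f"
    and comp_ident_right: "f \<in> hom C X Y \<Longrightarrow> f \<cdot> Ident C X = f"
    and comp_assoc: "\<lbrakk>f \<in> hom C W X; g \<in> hom C X Y; h \<in> hom C Y Z\<rbrakk>
                       \<Longrightarrow> (h \<cdot> g) \<cdot> f = h \<cdot> (g \<cdot> f)"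

definition full_subcategory ::
    "('o, 'm, 'x) precategory_scheme \<Rightarrow> 'o set \<Rightarrow> ('o, 'm, 'x) precategory_scheme" where
  "full_subcategory C S =
     C\<lparr>Obj := Obj C \<inter> S, Arr := {f \<in> Arr C. Dom C f \<in> S \<and> Cod C f \<in> S}\<rparr>"

definition is_iso :: "('o, 'm, 'x) precategory_scheme \<Rightarrow> 'm \<Rightarrow> bool" where
  "is_iso C f \<longleftrightarrow> f \<in> Arr C \<and>
     (\<exists>g \<in> hom C (Cod C f) (Dom C f).
        g \<cdot>\<^bsub>C\<^esub> f = Ident C (Dom C f) \<and> f \<cdot>\<^bsub>C\<^esub> g = Ident C (Cod C f))"

definition is_mono :: "('o, 'm, 'x) precategory_scheme \<Rightarrow> 'm \<Rightarrow> bool" where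
  "is_mono C m \<longleftrightarrow> m \<in> Arr C \<and>
     (\<forall>W. \<forall>f \<in> hom C W (Dom C m). \<forall>g \<in> hom C W (Dom C m). m \<cdot>\<^bsub>C\<^esub> f = m \<cdot>\<^bsub>C\<^esub> g \<longrightarrow> f = g)"


section \<open>Limits and colimits\<close>

definition is_initial :: "('o, 'm, 'x) precategory_scheme \<Rightarrow> 'o \<Rightarrow> bool" where
  "is_initial C I \<longleftrightarrow> I \<in> Obj C \<and> (\<forall>X \<in> Obj C. \<exists>!f. f \<in> hom C I X)"

definition is_terminal :: "('o, 'm, 'x) precategory_scheme \<Rightarrow> 'o \<Rightarrow> bool" where
  "is_terminal C T \<longleftrightarrow> T \<in> Obj C \<and> (\<forall>X \<in> Obj C. \<exists>!f. f \<in> hom C X T)"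

definition is_zero_obj :: "('o, 'm, 'x) precategory_scheme \<Rightarrow> 'o \<Rightarrow> bool" where
  "is_zero_obj C Z \<longleftrightarrow> is_initial C Z \<and> is_terminal C Z"

definition is_product ::
    "('o, 'm, 'x) precategory_scheme \<Rightarrow> 'o \<Rightarrow> 'o \<Rightarrow> 'm \<Rightarrow> 'm \<Rightarrow> bool" where
  "is_product C X Y p q \<longleftrightarrow>
     p \<in> hom C (Dom C p) X \<and> q \<in> hom C (Dom C p) Y \<and>
     (\<forall>W. \<forall>f \<in> hom C W X. \<forall>g \<in> hom C W Y.
        \<exists>!h. h \<in> hom C W (Dom C p) \<and> p \<cdot>\<^bsub>C\<^esub> h = f \<and> q \<cdot>\<^bsub>C\<^esub> h = g)"

definition is_coproduct ::
    "('o, 'm, 'x) precategory_scheme \<Rightarrow> 'o \<Rightarrow> 'o \<Rightarrow> 'm \<Rightarrow> 'm \<Rightarrow> bool" where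
  "is_coproduct C X Y i j \<longleftrightarrow>
     i \<in> hom C X (Cod C i) \<and> j \<in> hom C Y (Cod C i) \<and>
     (\<forall>W. \<forall>f \<in> hom C X W. \<forall>g \<in> hom C Y W.
        \<exists>!h. h \<in> hom C (Cod C i) W \<and> h \<cdot>\<^bsub>C\<^esub> i = f \<and> h \<cdot>\<^bsub>C\<^esub> j = g)"

text \<open>The square \<open>f \<cdot> p = g \<cdot> q\<close> is a pullback; here \<open>p\<close> is the pullback of \<open>g\<close> along \<open>f\<close>.\<close>

definition is_pullback ::
    "('o, 'm, 'x) precategory_scheme \<Rightarrow> 'm \<Rightarrow> 'm \<Rightarrow> 'm \<Rightarrow> 'm \<Rightarrow> bool" where
  "is_pullback C f g p q \<longleftrightarrow>
     f \<in> Arr C \<and> g \<in> Arr C \<and> Cod C f = Cod C g \<and>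
     p \<in> hom C (Dom C p) (Dom C f) \<and> q \<in> hom C (Dom C p) (Dom C g) \<and>
     f \<cdot>\<^bsub>C\<^esub> p = g \<cdot>\<^bsub>C\<^esub> q \<and>
     (\<forall>W. \<forall>u \<in> hom C W (Dom C f). \<forall>v \<in> hom C W (Dom C g). f \<cdot>\<^bsub>C\<^esub> u = g \<cdot>\<^bsub>C\<^esub> v \<longrightarrow>
        (\<exists>!h. h \<in> hom C W (Dom C p) \<and> p \<cdot>\<^bsub>C\<^esub> h = u \<and> q \<cdot>\<^bsub>C\<^esub> h = v))"

definition is_coequaliser ::
    "('o, 'm, 'x) precategory_scheme \<Rightarrow> 'm \<Rightarrow> 'm \<Rightarrow> 'm \<Rightarrow> bool" where
  "is_coequaliser C r s e \<longleftrightarrow>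
     r \<in> Arr C \<and> s \<in> hom C (Dom C r) (Cod C r) \<and> e \<in> hom C (Cod C r) (Cod C e) \<and>
     e \<cdot>\<^bsub>C\<^esub> r = e \<cdot>\<^bsub>C\<^esub> s \<and>
     (\<forall>W. \<forall>g \<in> hom C (Cod C r) W. g \<cdot>\<^bsub>C\<^esub> r = g \<cdot>\<^bsub>C\<^esub> s \<longrightarrow>
        (\<exists>!h. h \<in> hom C (Cod C e) W \<and> h \<cdot>\<^bsub>C\<^esub> e = g))"

definition is_kernel_pair :: "('o, 'm, 'x) precategory_scheme \<Rightarrow> 'm \<Rightarrow> 'm \<Rightarrow> 'm \<Rightarrow> bool" where
  "is_kernel_pair C f r s \<longleftrightarrow> is_pullback C f f r s"

definition is_regular_epi :: "('o, 'm, 'x) precategory_scheme \<Rightarrow> 'm \<Rightarrow> bool" where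
  "is_regular_epi C e \<longleftrightarrow> (\<exists>r s. is_coequaliser C r s e)"


section \<open>Semi-abelian categories\<close>

locale pointed_category = category +
  assumes has_zero_obj: "\<exists>Z. is_zero_obj C Z"

text \<open>Finite limits are given by a terminal object and pullbacks.\<close>

locale finitely_complete_category = category +
  assumes has_terminal: "\<exists>T. is_terminal C T"
    and has_pullbacks: "\<lbrakk>f \<in> Arr C; g \<in> Arr C; Cod C f = Cod C g\<rbrakk> \<Longrightarrow> \<exists>p q. is_pullback C f g p q"

locale finitely_cocartesian_category = category +
  assumes has_initial: "\<exists>I. is_initial C I"
    and has_coproducts: "\<lbrakk>X \<in> Obj C; Y \<in> Obj C\<rbrakk> \<Longrightarrow> \<exists>i j. is_coproduct C X Y i j"

locale regular_category = finitely_complete_category +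
  assumes kernel_pairs_have_coequalisers: "is_kernel_pair C f r s \<Longrightarrow> \<exists>e. is_coequaliser C r s e"
    and regular_epi_pullback_stable:
      "\<lbrakk>is_pullback C f e p q; is_regular_epi C e\<rbrakk> \<Longrightarrow> is_regular_epi C p"

text \<open>
  An internal equivalence relation on \<open>X\<close>: a jointly monic pair of arrows from \<open>R\<close> to \<open>X\<close>,
  reflexive, symmetric and transitive, where transitivity is a lifting of the two outer legs of the
  pullback \<open>R \<times>\<^sub>X R\<close>.
\<close>

definition is_internal_equiv ::
    "('o, 'm, 'x) precategory_scheme \<Rightarrow> 'o \<Rightarrow> 'm \<Rightarrow> 'm \<Rightarrow> bool" where
  "is_internal_equiv C X r s \<longleftrightarrow>
     r \<in> hom C (Dom C r) X \<and> s \<in> hom C (Dom C r) X \<and>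
     (\<forall>W. \<forall>u \<in> hom C W (Dom C r). \<forall>v \<in> hom C W (Dom C r).
        r \<cdot>\<^bsub>C\<^esub> u = r \<cdot>\<^bsub>C\<^esub> v \<and> s \<cdot>\<^bsub>C\<^esub> u = s \<cdot>\<^bsub>C\<^esub> v \<longrightarrow> u = v) \<and>
     (\<exists>d \<in> hom C X (Dom C r). r \<cdot>\<^bsub>C\<^esub> d = Ident C X \<and> s \<cdot>\<^bsub>C\<^esub> d = Ident C X) \<and>
     (\<exists>t \<in> hom C (Dom C r) (Dom C r). r \<cdot>\<^bsub>C\<^esub> t = s \<and> s \<cdot>\<^bsub>C\<^esub> t = r) \<and>
     (\<forall>p q. is_pullback C s r p q \<longrightarrow>
        (\<exists>c \<in> hom C (Dom C p) (Dom C r). r \<cdot>\<^bsub>C\<^esub> c = r \<cdot>\<^bsub>C\<^esub> p \<and> s \<cdot>\<^bsub>C\<^esub> c = s \<cdot>\<^bsub>C\<^esub> q))"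

locale barr_exact_category = regular_category +
  assumes equiv_effective: "is_internal_equiv C X r s \<Longrightarrow> \<exists>f. is_kernel_pair C f r s"

text \<open>
  A point over \<open>Y\<close> is a split epimorphism \<open>p\<close> with codomain \<open>Y\<close> together with a chosen section;
  arrows of points over \<open>Y\<close> commute with both.
\<close>

definition is_point :: "('o, 'm, 'x) precategory_scheme \<Rightarrow> 'o \<Rightarrow> 'm \<Rightarrow> 'm \<Rightarrow> bool" where
  "is_point C Y p s \<longleftrightarrow>
     p \<in> hom C (Dom C p) Y \<and> s \<in> hom C Y (Dom C p) \<and> p \<cdot>\<^bsub>C\<^esub> s = Ident C Y"

definition is_point_arrow ::
    "('o, 'm, 'x) precategory_scheme \<Rightarrow> 'm \<Rightarrow> 'm \<Rightarrow> 'm \<Rightarrow> 'm \<Rightarrow> 'm \<Rightarrow> bool" where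
  "is_point_arrow C p s p' s' h \<longleftrightarrow>
     h \<in> hom C (Dom C p) (Dom C p') \<and> p' \<cdot>\<^bsub>C\<^esub> h = p \<and> h \<cdot>\<^bsub>C\<^esub> s = s'"

text \<open>
  Bourn protomodularity: for every \<open>f : X \<rightarrow> Y\<close>, the change-of-base functor along \<open>f\<close> from points
  over \<open>Y\<close> to points over \<open>X\<close> reflects isomorphisms. The functor sends an arrow \<open>h\<close> of points over
  \<open>Y\<close> to the induced arrow \<open>u\<close> between the pullbacks; the sections of the pulled-back points
  are determined by the pullbacks, and \<open>u\<close> automatically commutes with them.
\<close>

locale protomodular_category = category +
  assumes change_of_base_reflects_iso:
    "\<lbrakk>f \<in> hom C X Y; is_point C Y p s; is_point C Y p' s'; is_point_arrow C p s p' s' h;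
      is_pullback C f p a b; is_pullback C f p' a' b';
      u \<in> hom C (Dom C a) (Dom C a'); a' \<cdot> u = a; b' \<cdot> u = h \<cdot> b;
      is_iso C u\<rbrakk> \<Longrightarrow> is_iso C h"

locale semi_abelian_category =
  pointed_category + barr_exact_category + protomodular_category + finitely_cocartesian_category


section \<open>Zero arrows, kernels, cokernels, images\<close>

definition is_zero_arrow :: "('o, 'm, 'x) precategory_scheme \<Rightarrow> 'm \<Rightarrow> bool" where
  "is_zero_arrow C f \<longleftrightarrow> f \<in> Arr C \<and>
     (\<exists>Z. is_zero_obj C Z \<and>
        (\<exists>g \<in> hom C (Dom C f) Z. \<exists>h \<in> hom C Z (Cod C f). f = h \<cdot>\<^bsub>C\<^esub> g))"

definition zero_arrow :: "('o, 'm, 'x) precategory_scheme \<Rightarrow> 'o \<Rightarrow> 'o \<Rightarrow> 'm" where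
  "zero_arrow C X Y = (THE f. f \<in> hom C X Y \<and> is_zero_arrow C f)"

definition is_kernel :: "('o, 'm, 'x) precategory_scheme \<Rightarrow> 'm \<Rightarrow> 'm \<Rightarrow> bool" where
  "is_kernel C k f \<longleftrightarrow>
     f \<in> Arr C \<and> k \<in> hom C (Dom C k) (Dom C f) \<and> is_zero_arrow C (f \<cdot>\<^bsub>C\<^esub> k) \<and>
     (\<forall>W. \<forall>g \<in> hom C W (Dom C f). is_zero_arrow C (f \<cdot>\<^bsub>C\<^esub> g) \<longrightarrow>
        (\<exists>!h. h \<in> hom C W (Dom C k) \<and> k \<cdot>\<^bsub>C\<^esub> h = g))"

definition is_cokernel :: "('o, 'm, 'x) precategory_scheme \<Rightarrow> 'm \<Rightarrow> 'm \<Rightarrow> bool" where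
  "is_cokernel C f k \<longleftrightarrow>
     k \<in> Arr C \<and> f \<in> hom C (Cod C k) (Cod C f) \<and> is_zero_arrow C (f \<cdot>\<^bsub>C\<^esub> k) \<and>
     (\<forall>W. \<forall>g \<in> hom C (Cod C k) W. is_zero_arrow C (g \<cdot>\<^bsub>C\<^esub> k) \<longrightarrow>
        (\<exists>!h. h \<in> hom C (Cod C f) W \<and> h \<cdot>\<^bsub>C\<^esub> f = g))"

definition is_image :: "('o, 'm, 'x) precategory_scheme \<Rightarrow> 'm \<Rightarrow> 'm \<Rightarrow> bool" where
  "is_image C m f \<longleftrightarrow> f \<in> Arr C \<and> is_mono C m \<and> Cod C m = Cod C f \<and>
     (\<exists>e \<in> hom C (Dom C f) (Dom C m). is_regular_epi C e \<and> f = m \<cdot>\<^bsub>C\<^esub> e)"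

text \<open>
  Kernels, cokernels, images, products and coproducts are fixed once and for all by choice; a
  subobject is represented by a monomorphism.
\<close>

definition kernel :: "('o, 'm, 'x) precategory_scheme \<Rightarrow> 'm \<Rightarrow> 'm" where
  "kernel C f = (SOME k. is_kernel C k f)"

definition cokernel :: "('o, 'm, 'x) precategory_scheme \<Rightarrow> 'm \<Rightarrow> 'm" where
  "cokernel C k = (SOME f. is_cokernel C f k)"

definition image :: "('o, 'm, 'x) precategory_scheme \<Rightarrow> 'm \<Rightarrow> 'm" where
  "image C f = (SOME m. is_image C m f)"

definition is_normal_mono :: "('o, 'm, 'x) precategory_scheme \<Rightarrow> 'm \<Rightarrow> bool" where
  "is_normal_mono C m \<longleftrightarrow> (\<exists>f. is_kernel C m f)"

definition is_proper :: "('o, 'm, 'x) precategory_scheme \<Rightarrow> 'm \<Rightarrow> bool" where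
  "is_proper C k \<longleftrightarrow> k \<in> Arr C \<and> is_normal_mono C (image C k)"

definition right_exact :: "('o, 'm, 'x) precategory_scheme \<Rightarrow> 'm \<Rightarrow> 'm \<Rightarrow> bool" where
  "right_exact C k f \<longleftrightarrow> is_proper C k \<and> is_cokernel C f k"


section \<open>Chosen products and coproducts\<close>

definition projections :: "('o, 'm, 'x) precategory_scheme \<Rightarrow> 'o \<Rightarrow> 'o \<Rightarrow> 'm \<times> 'm" where
  "projections C X Y = (SOME pq. is_product C X Y (fst pq) (snd pq))"

definition proj1 :: "('o, 'm, 'x) precategory_scheme \<Rightarrow> 'o \<Rightarrow> 'o \<Rightarrow> 'm" where
  "proj1 C X Y = fst (projections C X Y)"

definition proj2 :: "('o, 'm, 'x) precategory_scheme \<Rightarrow> 'o \<Rightarrow> 'o \<Rightarrow> 'm" where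
  "proj2 C X Y = snd (projections C X Y)"

definition prod_obj :: "('o, 'm, 'x) precategory_scheme \<Rightarrow> 'o \<Rightarrow> 'o \<Rightarrow> 'o" where
  "prod_obj C X Y = Dom C (proj1 C X Y)"

definition pairing :: "('o, 'm, 'x) precategory_scheme \<Rightarrow> 'm \<Rightarrow> 'm \<Rightarrow> 'm" where
  "pairing C f g =
     (THE h. h \<in> hom C (Dom C f) (prod_obj C (Cod C f) (Cod C g)) \<and>
        proj1 C (Cod C f) (Cod C g) \<cdot>\<^bsub>C\<^esub> h = f \<and> proj2 C (Cod C f) (Cod C g) \<cdot>\<^bsub>C\<^esub> h = g)"

definition injections :: "('o, 'm, 'x) precategory_scheme \<Rightarrow> 'o \<Rightarrow> 'o \<Rightarrow> 'm \<times> 'm" where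
  "injections C X Y = (SOME ij. is_coproduct C X Y (fst ij) (snd ij))"

definition inj1 :: "('o, 'm, 'x) precategory_scheme \<Rightarrow> 'o \<Rightarrow> 'o \<Rightarrow> 'm" where
  "inj1 C X Y = fst (injections C X Y)"

definition inj2 :: "('o, 'm, 'x) precategory_scheme \<Rightarrow> 'o \<Rightarrow> 'o \<Rightarrow> 'm" where
  "inj2 C X Y = snd (injections C X Y)"

definition coprod_obj :: "('o, 'm, 'x) precategory_scheme \<Rightarrow> 'o \<Rightarrow> 'o \<Rightarrow> 'o" where
  "coprod_obj C X Y = Cod C (inj1 C X Y)"

definition copairing :: "('o, 'm, 'x) precategory_scheme \<Rightarrow> 'm \<Rightarrow> 'm \<Rightarrow> 'm" where
  "copairing C f g =
     (THE h. h \<in> hom C (coprod_obj C (Dom C f) (Dom C g)) (Cod C f) \<and>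
        h \<cdot>\<^bsub>C\<^esub> inj1 C (Dom C f) (Dom C g) = f \<and> h \<cdot>\<^bsub>C\<^esub> inj2 C (Dom C f) (Dom C g) = g)"

definition coprod_map :: "('o, 'm, 'x) precategory_scheme \<Rightarrow> 'm \<Rightarrow> 'm \<Rightarrow> 'm" where
  "coprod_map C f g =
     copairing C (inj1 C (Cod C f) (Cod C g) \<cdot>\<^bsub>C\<^esub> f) (inj2 C (Cod C f) (Cod C g) \<cdot>\<^bsub>C\<^esub> g)"


section \<open>Abelian objects\<close>

text \<open>
  Associativity is stated on \<open>(A \<times> A) \<times> A\<close>, whose three projections to \<open>A\<close> are \<open>x\<close>, \<open>y\<close>, \<open>z\<close>
  below. The domain of the unit \<open>e\<close> is an arbitrary terminal object.
\<close>

definition is_internal_abelian_group ::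
    "('o, 'm, 'x) precategory_scheme \<Rightarrow> 'o \<Rightarrow> 'm \<Rightarrow> 'm \<Rightarrow> 'm \<Rightarrow> bool" where
  "is_internal_abelian_group C A m e i \<longleftrightarrow>
     A \<in> Obj C \<and> m \<in> hom C (prod_obj C A A) A \<and>
     is_terminal C (Dom C e) \<and> e \<in> hom C (Dom C e) A \<and> i \<in> hom C A A \<and>
     (let AA = prod_obj C A A;
          x = proj1 C A A \<cdot>\<^bsub>C\<^esub> proj1 C AA A;
          y = proj2 C A A \<cdot>\<^bsub>C\<^esub> proj1 C AA A;
          z = proj2 C AA A
      in m \<cdot>\<^bsub>C\<^esub> pairing C (m \<cdot>\<^bsub>C\<^esub> pairing C x y) z = m \<cdot>\<^bsub>C\<^esub> pairing C x (m \<cdot>\<^bsub>C\<^esub> pairing C y z)) \<and>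
     (\<forall>t \<in> hom C A (Dom C e).
        m \<cdot>\<^bsub>C\<^esub> pairing C (e \<cdot>\<^bsub>C\<^esub> t) (Ident C A) = Ident C A \<and>
        m \<cdot>\<^bsub>C\<^esub> pairing C (Ident C A) (e \<cdot>\<^bsub>C\<^esub> t) = Ident C A \<and>
        m \<cdot>\<^bsub>C\<^esub> pairing C i (Ident C A) = e \<cdot>\<^bsub>C\<^esub> t \<and>
        m \<cdot>\<^bsub>C\<^esub> pairing C (Ident C A) i = e \<cdot>\<^bsub>C\<^esub> t) \<and>
     m \<cdot>\<^bsub>C\<^esub> pairing C (proj2 C A A) (proj1 C A A) = m"

definition is_abelian_obj :: "('o, 'm, 'x) precategory_scheme \<Rightarrow> 'o \<Rightarrow> bool" where
  "is_abelian_obj C A \<longleftrightarrow> (\<exists>m e i. is_internal_abelian_group C A m e i)"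


section \<open>Cosmash products\<close>

definition cosmash_comparison :: "('o, 'm, 'x) precategory_scheme \<Rightarrow> 'o \<Rightarrow> 'o \<Rightarrow> 'm" where
  "cosmash_comparison C X Y =
     pairing C (copairing C (Ident C X) (zero_arrow C Y X))
               (copairing C (zero_arrow C X Y) (Ident C Y))"

text \<open>The inclusion of the cosmash product of \<open>X\<close> and \<open>Y\<close> into \<open>X + Y\<close>.\<close>

definition cosmash_incl :: "('o, 'm, 'x) precategory_scheme \<Rightarrow> 'o \<Rightarrow> 'o \<Rightarrow> 'm" where
  "cosmash_incl C X Y = kernel C (cosmash_comparison C X Y)"

definition cosmash :: "('o, 'm, 'x) precategory_scheme \<Rightarrow> 'o \<Rightarrow> 'o \<Rightarrow> 'o" where
  "cosmash C X Y = Dom C (cosmash_incl C X Y)"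

definition cosmash_map :: "('o, 'm, 'x) precategory_scheme \<Rightarrow> 'm \<Rightarrow> 'm \<Rightarrow> 'm" where
  "cosmash_map C f g =
     (THE h. h \<in> hom C (cosmash C (Dom C f) (Dom C g)) (cosmash C (Cod C f) (Cod C g)) \<and>
        cosmash_incl C (Cod C f) (Cod C g) \<cdot>\<^bsub>C\<^esub> h =
        coprod_map C f g \<cdot>\<^bsub>C\<^esub> cosmash_incl C (Dom C f) (Dom C g))"

text \<open>
  Ternary sums and products associate to the left: \<open>X + Y + Z\<close> is \<open>(X + Y) + Z\<close>, and the three
  components of the comparison arrow, killing \<open>Z\<close>, \<open>Y\<close> and \<open>X\<close> in turn, are copairings of
  copairings.
\<close>

definition cosmash3_comparison :: "('o, 'm, 'x) precategory_scheme \<Rightarrow> 'o \<Rightarrow> 'o \<Rightarrow> 'o \<Rightarrow> 'm" where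
  "cosmash3_comparison C X Y Z =
     pairing C
       (pairing C
         (copairing C (copairing C (inj1 C X Y) (inj2 C X Y)) (zero_arrow C Z (coprod_obj C X Y)))
         (copairing C (copairing C (inj1 C X Z) (zero_arrow C Y (coprod_obj C X Z))) (inj2 C X Z)))
       (copairing C (copairing C (zero_arrow C X (coprod_obj C Y Z)) (inj1 C Y Z)) (inj2 C Y Z))"

definition cosmash3_incl :: "('o, 'm, 'x) precategory_scheme \<Rightarrow> 'o \<Rightarrow> 'o \<Rightarrow> 'o \<Rightarrow> 'm" where
  "cosmash3_incl C X Y Z = kernel C (cosmash3_comparison C X Y Z)"


section \<open>Two-nilpotent objects and the bilinear product\<close>

definition codiagonal3 :: "('o, 'm, 'x) precategory_scheme \<Rightarrow> 'o \<Rightarrow> 'm" where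
  "codiagonal3 C X = copairing C (copairing C (Ident C X) (Ident C X)) (Ident C X)"

text \<open>The subobject \<open>[X, X, X]\<close> of \<open>X\<close>, as a monomorphism.\<close>

definition commutator3 :: "('o, 'm, 'x) precategory_scheme \<Rightarrow> 'o \<Rightarrow> 'm" where
  "commutator3 C X = image C (codiagonal3 C X \<cdot>\<^bsub>C\<^esub> cosmash3_incl C X X X)"

definition two_nilpotent :: "('o, 'm, 'x) precategory_scheme \<Rightarrow> 'o \<Rightarrow> bool" where
  "two_nilpotent C X \<longleftrightarrow> X \<in> Obj C \<and> is_zero_obj C (Dom C (commutator3 C X))"

definition Nil2 :: "('o, 'm, 'x) precategory_scheme \<Rightarrow> ('o, 'm, 'x) precategory_scheme" where
  "Nil2 C = full_subcategory C {X. two_nilpotent C X}"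

text \<open>The quotient arrow from \<open>X\<close> to \<open>nil\<^sub>2(X) = X/[X, X, X]\<close>.\<close>

definition nil2_unit :: "('o, 'm, 'x) precategory_scheme \<Rightarrow> 'o \<Rightarrow> 'm" where
  "nil2_unit C X = cokernel C (commutator3 C X)"

definition nil2_obj :: "('o, 'm, 'x) precategory_scheme \<Rightarrow> 'o \<Rightarrow> 'o" where
  "nil2_obj C X = Cod C (nil2_unit C X)"

definition nil2_map :: "('o, 'm, 'x) precategory_scheme \<Rightarrow> 'm \<Rightarrow> 'm" where
  "nil2_map C f =
     (THE g. g \<in> hom C (nil2_obj C (Dom C f)) (nil2_obj C (Cod C f)) \<and>
        g \<cdot>\<^bsub>C\<^esub> nil2_unit C (Dom C f) = nil2_unit C (Cod C f) \<cdot>\<^bsub>C\<^esub> f)"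

definition bilinear_prod :: "('o, 'm, 'x) precategory_scheme \<Rightarrow> 'o \<Rightarrow> 'o \<Rightarrow> 'o" where
  "bilinear_prod C X Y = cosmash (Nil2 C) (nil2_obj C X) (nil2_obj C Y)"

definition bilinear_map :: "('o, 'm, 'x) precategory_scheme \<Rightarrow> 'm \<Rightarrow> 'm \<Rightarrow> 'm" where
  "bilinear_map C f g = cosmash_map (Nil2 C) (nil2_map C f) (nil2_map C g)"

end

theory Submission
  imports Defs
begin

text \<open>
  Generalised elements stand for all diagram chases: an arrow \<open>g : V \<rightarrow> B\<close> is lifted along a regular
  epimorphism after passing to a regular epic cover of \<open>V\<close>.

  Let \<open>X\<close>, \<open>Y\<close>, \<open>Z\<close> be two-nilpotent and \<open>Y \<oplus> Z\<close> their sum among two-nilpotent objects. The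
  canonical arrow from \<open>X + Y + Z\<close> to \<open>X \<oplus> (Y \<oplus> Z)\<close> is regular epic and respects the three idempotents
  that kill one summand each, so it maps the ternary cosmash product onto the corresponding cross-effect
  of the target. As the target is two-nilpotent, this cross-effect vanishes: \<open>X \<otimes> -\<close> is additive. The
  codiagonal of \<open>Y\<close> then induces a unital multiplication on \<open>X \<otimes> Y\<close>, which in a protomodular category
  is an abelian group structure.

  If \<open>f : B \<rightarrow> A\<close> is the cokernel of \<open>k : K \<rightarrow> B\<close>, it is the coequaliser of the reflexive pair
  \<open>[1, 0], [1, k] : B \<oplus> K \<rightarrow> B\<close>. The image of a reflexive pair is an effective equivalence relation,
  whence the kernel of \<open>X \<otimes> f\<close> is covered by the kernel of \<open>X \<otimes> [1, 0]\<close>. By additivity the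
  latter is \<open>X \<otimes> K\<close>, embedded so that \<open>X \<otimes> [1, k]\<close> restricts to \<open>X \<otimes> k\<close>.
\<close>

section \<open>Arrows and zero arrows\<close>

text \<open>All arguments take place in the ambient category. Of the two-nilpotent objects only
  closure under subobjects, products and regular quotients is used, together with the reflector;
  their category is never shown to be exact or protomodular and only supplies the chosen sums and
  cosmash products. The main obstacle is that a regular epimorphism need not restrict to a regular
  epimorphism between kernels. It does so for kernels of compatible idempotents and, by induction,
  for joint kernels of commuting families of them. This is why cosmash products are described by
  idempotents that kill a summand of a sum rather than by the comparison arrow to a product. As
  \<open>k\<close> is an arbitrary arrow with cokernel \<open>f\<close>, the kernel of
  \<open>f\<close> cannot be read off from \<open>k\<close>. The reflexive pair on
  \<open>B \<oplus> K\<close> avoids this: its image is an effective relation in any case.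
  Properness of \<open>X \<otimes> k\<close> then comes out as a result, its image being the kernel
  of \<open>X \<otimes> f\<close>.\<close>

context category
begin

abbreviation ident (\<open>\<one>\<close>) where "\<one> X \<equiv> Ident C X"
abbreviation zero (\<open>\<zero>\<close>) where "\<zero> X Y \<equiv> zero_arrow C X Y"

lemma hom_iff: "f \<in> hom C X Y \<longleftrightarrow> f \<in> Arr C \<and> Dom C f = X \<and> Cod C f = Y \<and> X \<in> Obj C \<and> Y \<in> Obj C"
  using dom_in_Obj cod_in_Obj by (auto simp: hom_def)

lemma arr_hom: "f \<in> Arr C \<Longrightarrow> f \<in> hom C (Dom C f) (Cod C f)"
  by (simp add: hom_def)

lemma dom_obj [simp]: "f \<in> Arr C \<Longrightarrow> Dom C f \<in> Obj C"
  and cod_obj [simp]: "f \<in> Arr C \<Longrightarrow> Cod C f \<in> Obj C"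
  by (auto intro: dom_in_Obj cod_in_Obj)

lemma
  assumes "f \<in> Arr C" "g \<in> Arr C" "Dom C g = Cod C f"
  shows comp_arr [simp]: "g \<cdot> f \<in> Arr C"
    and dom_comp [simp]: "Dom C (g \<cdot> f) = Dom C f"
    and cod_comp [simp]: "Cod C (g \<cdot> f) = Cod C g"
  using comp_in_hom[of f "Dom C f" "Cod C f" g "Cod C g"] assms by (auto simp: hom_def)

lemma
  assumes "X \<in> Obj C"
  shows ident_arr [simp]: "\<one> X \<in> Arr C"
    and dom_ident [simp]: "Dom C (\<one> X) = X"
    and cod_ident [simp]: "Cod C (\<one> X) = X"
  using ident_in_hom[OF assms] by (auto simp: hom_def)

lemma ident_left [simp]: "f \<in> Arr C \<Longrightarrow> Cod C f = Y \<Longrightarrow> \<one> Y \<cdot> f = f"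
  and ident_right [simp]: "f \<in> Arr C \<Longrightarrow> Dom C f = X \<Longrightarrow> f \<cdot> \<one> X = f"
  using comp_ident_left comp_ident_right by (auto simp: hom_def)

lemma assoc [simp]:
  assumes "f \<in> Arr C" "g \<in> Arr C" "h \<in> Arr C" "Dom C g = Cod C f" "Dom C h = Cod C g"
  shows "(h \<cdot> g) \<cdot> f = h \<cdot> (g \<cdot> f)"
  using assms comp_assoc[of f "Dom C f" "Cod C f" g "Cod C g" h "Cod C h"] by (auto simp: hom_def)

text \<open>Composites are normalised to the right, so an equation for \<open>a \<cdot> b\<close> no
  longer matches once something is precomposed. This rule and the next restore the match, for a
  right side that is a single arrow or a composite.\<close>

lemma reassoc:
  assumes "a \<cdot> b = c" "a \<in> Arr C" "b \<in> Arr C" "Dom C a = Cod C b" "x \<in> Arr C" "Cod C x = Dom C b"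
  shows "a \<cdot> (b \<cdot> x) = c \<cdot> x"
  using assms assoc[of x b a] by simp

lemma reassoc2:
  assumes "a \<cdot> b = c \<cdot> d" "a \<in> Arr C" "b \<in> Arr C" "Dom C a = Cod C b"
    "c \<in> Arr C" "d \<in> Arr C" "Dom C c = Cod C d" "Dom C b = Dom C d" "x \<in> Arr C" "Cod C x = Dom C b"
  shows "a \<cdot> (b \<cdot> x) = c \<cdot> (d \<cdot> x)"
  using assms assoc[of x b a] by simp

section \<open>Monomorphisms and regular epimorphisms\<close>

lemma is_monoI:
  assumes "m \<in> hom C A B"
    and "\<And>W u v. \<lbrakk>u \<in> hom C W A; v \<in> hom C W A; m \<cdot> u = m \<cdot> v\<rbrakk> \<Longrightarrow> u = v"
  shows "is_mono C m"
  using assms unfolding is_mono_def hom_def by blast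

lemma is_monoD:
  assumes "is_mono C m" "m \<in> hom C A B" "u \<in> hom C W A" "v \<in> hom C W A" "m \<cdot> u = m \<cdot> v"
  shows "u = v"
  using assms unfolding is_mono_def hom_def by blast

lemma iso_if_split_mono:
  assumes "is_mono C m" "m \<in> hom C A B" "n \<in> hom C B A" "m \<cdot> n = \<one> B"
  shows "n \<cdot> m = \<one> A"
proof -
  have "m \<cdot> (n \<cdot> m) = m \<cdot> \<one> A"
    using assms(2-3) assms(4)[THEN reassoc] by (simp add: hom_iff)
  then show ?thesis
    by (rule is_monoD[OF assms(1,2), of _ A, rotated 2]) (use assms in \<open>simp_all add: hom_iff\<close>)
qed

lemma regular_epi_cancel:
  assumes "is_regular_epi C e" "e \<in> hom C A B" "u \<in> hom C B W" "v \<in> hom C B W" "u \<cdot> e = v \<cdot> e"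
  shows "u = v"
proof -
  obtain r s where c: "is_coequaliser C r s e" using assms(1) unfolding is_regular_epi_def by blast
  then have t: "r \<in> Arr C" "s \<in> hom C (Dom C r) (Cod C r)" "e \<in> hom C (Cod C r) (Cod C e)"
    "e \<cdot> r = e \<cdot> s"
    unfolding is_coequaliser_def by auto
  have "(u \<cdot> e) \<cdot> r = (u \<cdot> e) \<cdot> s" using t assms(2-4) by (simp add: hom_iff)
  moreover have "u \<cdot> e \<in> hom C (Cod C r) W" using t assms(2-4) by (simp add: hom_iff)
  ultimately have "\<exists>!h. h \<in> hom C (Cod C e) W \<and> h \<cdot> e = u \<cdot> e"
    using c unfolding is_coequaliser_def by blast
  then show ?thesis using assms by (auto simp: hom_iff)
qed

text \<open>Because \<open>m\<close> is monic, \<open>g\<close> identifies the pair that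
  \<open>e\<close> coequalises, so it factors through \<open>e\<close>; the other triangle follows
  by cancelling \<open>e\<close>.\<close>

lemma regular_epi_strong:
  assumes e: "is_regular_epi C e" "e \<in> hom C A B" and m: "is_mono C m" "m \<in> hom C D E"
    and g: "g \<in> hom C A D" and h: "h \<in> hom C B E" and eq: "m \<cdot> g = h \<cdot> e"
  shows "\<exists>d \<in> hom C B D. d \<cdot> e = g \<and> m \<cdot> d = h"
proof -
  obtain r s where c: "is_coequaliser C r s e" using e(1) unfolding is_regular_epi_def by blast
  then have t: "r \<in> Arr C" "s \<in> hom C (Dom C r) (Cod C r)" "e \<in> hom C (Cod C r) (Cod C e)"
    "e \<cdot> r = e \<cdot> s"
    unfolding is_coequaliser_def by auto
  have "m \<cdot> (g \<cdot> r) = (m \<cdot> g) \<cdot> r" using t e m g h by (simp add: hom_iff)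
  also have "\<dots> = (m \<cdot> g) \<cdot> s" using t e m g h unfolding eq by (simp add: hom_iff)
  also have "\<dots> = m \<cdot> (g \<cdot> s)" using t e m g h by (simp add: hom_iff)
  finally have "g \<cdot> r = g \<cdot> s"
    by (rule is_monoD[OF m, of _ "Dom C r", rotated 2]) (use t e m g h in \<open>simp_all add: hom_iff\<close>)
  moreover have "g \<in> hom C (Cod C r) D" using t e g by (simp add: hom_iff)
  ultimately obtain d where d: "d \<in> hom C (Cod C e) D" "d \<cdot> e = g"
    using c unfolding is_coequaliser_def by blast
  have "m \<cdot> d = h"
    by (rule regular_epi_cancel[OF e, of _ E]) (use t d e m g h eq in \<open>simp_all add: hom_iff\<close>)
  then show ?thesis using d e by (intro bexI[of _ d]) (simp_all add: hom_iff)
qed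

section \<open>Zero objects, zero arrows and kernels\<close>

lemma terminal_eq: "is_terminal C T \<Longrightarrow> u \<in> hom C X T \<Longrightarrow> v \<in> hom C X T \<Longrightarrow> u = v"
  unfolding is_terminal_def hom_iff by blast

lemma initial_eq: "is_initial C T \<Longrightarrow> u \<in> hom C T X \<Longrightarrow> v \<in> hom C T X \<Longrightarrow> u = v"
  unfolding is_initial_def hom_iff by blast

lemma is_zero_arrow_hom_iff:
  assumes "f \<in> hom C X Y"
  shows "is_zero_arrow C f \<longleftrightarrow>
    (\<exists>Z. is_zero_obj C Z \<and> (\<exists>g \<in> hom C X Z. \<exists>h \<in> hom C Z Y. f = h \<cdot> g))"
  using assms by (simp add: is_zero_arrow_def hom_iff)

text \<open>Two zero objects are linked by an arrow \<open>t\<close>, which turns one factorisation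
  into the other; the choice of the zero object is therefore immaterial.\<close>

lemma zero_unique:
  assumes "is_zero_arrow C f" "is_zero_arrow C f'" "f \<in> hom C X Y" "f' \<in> hom C X Y"
  shows "f = f'"
proof -
  obtain Z g h where 1: "is_zero_obj C Z" "g \<in> hom C X Z" "h \<in> hom C Z Y" "f = h \<cdot> g"
    using assms is_zero_arrow_hom_iff by blast
  obtain Z' g' h' where 2: "is_zero_obj C Z'" "g' \<in> hom C X Z'" "h' \<in> hom C Z' Y" "f' = h' \<cdot> g'"
    using assms is_zero_arrow_hom_iff by blast
  have z: "is_initial C Z" "is_terminal C Z'" using 1 2 by (auto simp: is_zero_obj_def)
  then obtain t where t: "t \<in> hom C Z Z'"
    unfolding is_initial_def is_terminal_def by blast
  have "t \<cdot> g = g'"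
    by (rule terminal_eq[of Z' _ X]) (use z 1 2 t in \<open>simp_all add: hom_iff\<close>)
  moreover have "h' \<cdot> t = h"
    by (rule initial_eq[of Z _ Y]) (use z 1 2 t in \<open>simp_all add: hom_iff\<close>)
  ultimately show ?thesis using 1 2 t by (metis comp_assoc)
qed

end

context pointed_category
begin

lemma zero_arr_exists:
  assumes "X \<in> Obj C" "Y \<in> Obj C"
  shows "\<exists>f \<in> hom C X Y. is_zero_arrow C f"
proof -
  obtain Z where Z: "is_zero_obj C Z" using has_zero_obj by blast
  then obtain g h where gh: "g \<in> hom C X Z" "h \<in> hom C Z Y"
    using assms unfolding is_zero_obj_def is_initial_def is_terminal_def by blast
  then have "h \<cdot> g \<in> hom C X Y" by (rule comp_in_hom)
  then show ?thesis using Z gh is_zero_arrow_hom_iff by blast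
qed

lemma zero_arrow:
  assumes "X \<in> Obj C" "Y \<in> Obj C"
  shows "\<zero> X Y \<in> hom C X Y \<and> is_zero_arrow C (\<zero> X Y)"
  unfolding zero_arrow_def
proof (rule theI')
  show "\<exists>!f. f \<in> hom C X Y \<and> is_zero_arrow C f"
    using zero_arr_exists[OF assms] zero_unique by blast
qed

lemma
  assumes "X \<in> Obj C" "Y \<in> Obj C"
  shows zero_arr [simp]: "\<zero> X Y \<in> Arr C"
    and dom_zero [simp]: "Dom C (\<zero> X Y) = X"
    and cod_zero [simp]: "Cod C (\<zero> X Y) = Y"
    and is_zero_zero [simp]: "is_zero_arrow C (\<zero> X Y)"
  using zero_arrow[OF assms] by (auto simp: hom_def)

lemma is_zero_arrow_iff: "f \<in> hom C X Y \<Longrightarrow> is_zero_arrow C f \<longleftrightarrow> f = \<zero> X Y"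
  using zero_unique[of f "\<zero> X Y" X Y] zero_arrow[of X Y] hom_iff[of f X Y] by blast

lemma zero_comp_right [simp]:
  assumes "f \<in> Arr C" "Cod C f = Y" "Z \<in> Obj C"
  shows "\<zero> Y Z \<cdot> f = \<zero> (Dom C f) Z"
proof -
  have t: "Y \<in> Obj C" "f \<in> hom C (Dom C f) Y" using assms by (auto simp: hom_def)
  have "\<zero> Y Z \<in> hom C Y Z" "is_zero_arrow C (\<zero> Y Z)" using zero_arrow[OF t(1) assms(3)] by auto
  then obtain W g h where o: "is_zero_obj C W" "g \<in> hom C Y W" "h \<in> hom C W Z" "\<zero> Y Z = h \<cdot> g"
    using is_zero_arrow_hom_iff by blast
  have "\<zero> Y Z \<cdot> f = h \<cdot> (g \<cdot> f)" unfolding o using o(2,3) t by (simp add: hom_iff)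
  moreover have "g \<cdot> f \<in> hom C (Dom C f) W" using o(2) t by (simp add: hom_iff)
  moreover have "\<zero> Y Z \<cdot> f \<in> hom C (Dom C f) Z" using t assms by (simp add: hom_iff)
  ultimately have "is_zero_arrow C (\<zero> Y Z \<cdot> f)"
    using o is_zero_arrow_hom_iff by blast
  then show ?thesis
    using is_zero_arrow_iff \<open>\<zero> Y Z \<cdot> f \<in> hom C (Dom C f) Z\<close> by blast
qed

lemma zero_comp_left [simp]:
  assumes "f \<in> Arr C" "Dom C f = Y" "X \<in> Obj C"
  shows "f \<cdot> \<zero> X Y = \<zero> X (Cod C f)"
proof -
  have t: "Y \<in> Obj C" "f \<in> hom C Y (Cod C f)" using assms by (auto simp: hom_def)
  have "\<zero> X Y \<in> hom C X Y" "is_zero_arrow C (\<zero> X Y)" using zero_arrow[OF assms(3) t(1)] by auto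
  then obtain W g h where o: "is_zero_obj C W" "g \<in> hom C X W" "h \<in> hom C W Y" "\<zero> X Y = h \<cdot> g"
    using is_zero_arrow_hom_iff by blast
  have "f \<cdot> \<zero> X Y = (f \<cdot> h) \<cdot> g" unfolding o using o(2,3) t by (simp add: hom_iff)
  moreover have "f \<cdot> h \<in> hom C W (Cod C f)" using o(3) t by (simp add: hom_iff)
  moreover have "f \<cdot> \<zero> X Y \<in> hom C X (Cod C f)" using t assms by (simp add: hom_iff)
  ultimately have "is_zero_arrow C (f \<cdot> \<zero> X Y)"
    using o is_zero_arrow_hom_iff by blast
  then show ?thesis
    using is_zero_arrow_iff \<open>f \<cdot> \<zero> X Y \<in> hom C X (Cod C f)\<close> by blast
qed

text \<open>Splits the universal property into a lifting property of elements and monicity of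
  \<open>k\<close>, which accounts for uniqueness. Kernels are handled in this form below.\<close>

lemma kernel_iff:
  assumes "f \<in> hom C A B" "k \<in> hom C K A"
  shows "is_kernel C k f \<longleftrightarrow> f \<cdot> k = \<zero> K B \<and> is_mono C k \<and>
    (\<forall>W. \<forall>g \<in> hom C W A. f \<cdot> g = \<zero> W B \<longrightarrow> (\<exists>h \<in> hom C W K. k \<cdot> h = g))" (is "?L \<longleftrightarrow> ?R")
proof -
  have zk: "is_zero_arrow C (f \<cdot> g) \<longleftrightarrow> f \<cdot> g = \<zero> W B" if "g \<in> hom C W A" for g W
    using that assms by (intro is_zero_arrow_iff) (simp add: hom_iff)
  have tk: "Dom C k = K" "Dom C f = A" "f \<in> Arr C" using assms by (simp_all add: hom_iff)
  have L: "?L \<longleftrightarrow> f \<cdot> k = \<zero> K B \<and> (\<forall>W. \<forall>g \<in> hom C W A. f \<cdot> g = \<zero> W B \<longrightarrow>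
        (\<exists>!h. h \<in> hom C W K \<and> k \<cdot> h = g))"
    unfolding is_kernel_def using assms(2) tk zk by auto
  show ?thesis
  proof
    assume l: ?L
    have "is_mono C k"
    proof (rule is_monoI[OF assms(2)])
      fix W u v assume u: "u \<in> hom C W K" "v \<in> hom C W K" "k \<cdot> u = k \<cdot> v"
      have 1: "k \<cdot> u \<in> hom C W A" using u assms by (simp add: hom_iff)
      have 2: "f \<cdot> (k \<cdot> u) = \<zero> W B"
        using u l[unfolded L, THEN conjunct1, THEN reassoc] assms by (simp add: hom_iff)
      show "u = v" using l[unfolded L, THEN conjunct2, rule_format, OF 1 2] u by auto
    qed
    then show ?R using l unfolding L by blast
  next
    assume r: ?R
    then show ?L unfolding L using is_monoD[of k K A] assms(2) by blast
  qed
qed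

lemma is_kernel_hom:
  assumes "is_kernel C k f" "f \<in> hom C A B"
  shows "k \<in> hom C (Dom C k) A"
  using assms unfolding is_kernel_def hom_def by auto

end

section \<open>Chosen limits and colimits\<close>

context category
begin

lemma is_pullbackI:
  assumes "f \<in> hom C A D" "g \<in> hom C B D" "p \<in> hom C P A" "q \<in> hom C P B" "f \<cdot> p = g \<cdot> q"
    and "\<And>W u v. \<lbrakk>u \<in> hom C W A; v \<in> hom C W B; f \<cdot> u = g \<cdot> v\<rbrakk>
      \<Longrightarrow> \<exists>h \<in> hom C W P. p \<cdot> h = u \<and> q \<cdot> h = v"
    and "\<And>W h h'. \<lbrakk>h \<in> hom C W P; h' \<in> hom C W P; p \<cdot> h = p \<cdot> h'; q \<cdot> h = q \<cdot> h'\<rbrakk> \<Longrightarrow> h = h'"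
  shows "is_pullback C f g p q"
proof -
  have t: "Dom C f = A" "Dom C g = B" "Dom C p = P" "Cod C f = D" "Cod C g = D" "f \<in> Arr C" "g \<in> Arr C"
    using assms(1-4) by (simp_all add: hom_iff)
  have "\<exists>!h. h \<in> hom C W P \<and> p \<cdot> h = u \<and> q \<cdot> h = v"
    if "u \<in> hom C W A" "v \<in> hom C W B" "f \<cdot> u = g \<cdot> v" for W u v
  proof -
    obtain h where "h \<in> hom C W P" "p \<cdot> h = u" "q \<cdot> h = v"
      using assms(6)[OF \<open>u \<in> _\<close> \<open>v \<in> _\<close> \<open>f \<cdot> u = _\<close>] by blast
    then show ?thesis using assms(7) by (intro ex1I[of _ h]) auto
  qed
  then show ?thesis unfolding is_pullback_def t using assms(3-5) t by auto
qed

lemma is_pullback_lift: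
  assumes "is_pullback C f g p q" "u \<in> hom C W (Dom C f)" "v \<in> hom C W (Dom C g)" "f \<cdot> u = g \<cdot> v"
  shows "\<exists>h \<in> hom C W (Dom C p). p \<cdot> h = u \<and> q \<cdot> h = v"
  using assms unfolding is_pullback_def by blast

lemma is_pullback_unique:
  assumes "is_pullback C f g p q" "h \<in> hom C W (Dom C p)" "h' \<in> hom C W (Dom C p)"
    "p \<cdot> h = p \<cdot> h'" "q \<cdot> h = q \<cdot> h'"
  shows "h = h'"
proof -
  have t: "p \<in> hom C (Dom C p) (Dom C f)" "q \<in> hom C (Dom C p) (Dom C g)" "f \<cdot> p = g \<cdot> q"
    "f \<in> Arr C" "g \<in> Arr C" "Cod C f = Cod C g"
    using assms(1) unfolding is_pullback_def by blast+
  have "p \<cdot> h' \<in> hom C W (Dom C f)" "q \<cdot> h' \<in> hom C W (Dom C g)" "f \<cdot> (p \<cdot> h') = g \<cdot> (q \<cdot> h')"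
    using t assms(3) t(3)[THEN reassoc2] by (simp_all add: hom_iff)
  then have "\<exists>!h. h \<in> hom C W (Dom C p) \<and> p \<cdot> h = p \<cdot> h' \<and> q \<cdot> h = q \<cdot> h'"
    using assms(1) unfolding is_pullback_def by blast
  then show ?thesis using assms by blast
qed

lemma is_productI:
  assumes "p \<in> hom C P X" "q \<in> hom C P Y"
    and "\<And>W u v. \<lbrakk>u \<in> hom C W X; v \<in> hom C W Y\<rbrakk> \<Longrightarrow> \<exists>h \<in> hom C W P. p \<cdot> h = u \<and> q \<cdot> h = v"
    and "\<And>W h h'. \<lbrakk>h \<in> hom C W P; h' \<in> hom C W P; p \<cdot> h = p \<cdot> h'; q \<cdot> h = q \<cdot> h'\<rbrakk> \<Longrightarrow> h = h'"
  shows "is_product C X Y p q"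
proof -
  have t: "Dom C p = P" using assms by (simp add: hom_iff)
  have "\<exists>!h. h \<in> hom C W P \<and> p \<cdot> h = u \<and> q \<cdot> h = v" if "u \<in> hom C W X" "v \<in> hom C W Y" for W u v
  proof -
    obtain h where "h \<in> hom C W P" "p \<cdot> h = u" "q \<cdot> h = v" using assms(3) \<open>u \<in> _\<close> \<open>v \<in> _\<close> by blast
    then show ?thesis using assms(4) by (intro ex1I[of _ h]) auto
  qed
  then show ?thesis unfolding is_product_def t using assms(1,2) by auto
qed

lemma is_coproductI:
  assumes "i \<in> hom C X S" "j \<in> hom C Y S"
    and "\<And>W u v. \<lbrakk>u \<in> hom C X W; v \<in> hom C Y W\<rbrakk> \<Longrightarrow> \<exists>h \<in> hom C S W. h \<cdot> i = u \<and> h \<cdot> j = v"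
    and "\<And>W h h'. \<lbrakk>h \<in> hom C S W; h' \<in> hom C S W; h \<cdot> i = h' \<cdot> i; h \<cdot> j = h' \<cdot> j\<rbrakk> \<Longrightarrow> h = h'"
  shows "is_coproduct C X Y i j"
proof -
  have t: "Cod C i = S" using assms by (simp add: hom_iff)
  have "\<exists>!h. h \<in> hom C S W \<and> h \<cdot> i = u \<and> h \<cdot> j = v" if "u \<in> hom C X W" "v \<in> hom C Y W" for W u v
  proof -
    obtain h where "h \<in> hom C S W" "h \<cdot> i = u" "h \<cdot> j = v" using assms(3) \<open>u \<in> _\<close> \<open>v \<in> _\<close> by blast
    then show ?thesis using assms(4) by (intro ex1I[of _ h]) auto
  qed
  then show ?thesis unfolding is_coproduct_def t using assms(1,2) by auto
qed

end

context finitely_complete_category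
begin

lemma pullbackE:
  assumes "f \<in> hom C A D" "g \<in> hom C B D"
  obtains P p q where "p \<in> hom C P A" "q \<in> hom C P B" "f \<cdot> p = g \<cdot> q" "is_pullback C f g p q"
    "\<And>W u v. \<lbrakk>u \<in> hom C W A; v \<in> hom C W B; f \<cdot> u = g \<cdot> v\<rbrakk>
      \<Longrightarrow> \<exists>h \<in> hom C W P. p \<cdot> h = u \<and> q \<cdot> h = v"
    "\<And>W h h'. \<lbrakk>h \<in> hom C W P; h' \<in> hom C W P; p \<cdot> h = p \<cdot> h'; q \<cdot> h = q \<cdot> h'\<rbrakk> \<Longrightarrow> h = h'"
proof -
  obtain p q where pq: "is_pullback C f g p q"
    using has_pullbacks[of f g] assms by (auto simp: hom_iff)
  have t: "Dom C f = A" "Dom C g = B" using assms by (simp_all add: hom_iff)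
  show ?thesis
    by (rule that[of p "Dom C p" q])
      (use pq[unfolded is_pullback_def] pq is_pullback_lift[OF pq] is_pullback_unique[OF pq] t in blast)+
qed

text \<open>A product is a pullback over a terminal object, where the compatibility condition on the
  two components is void.\<close>

lemma product_exists:
  assumes "X \<in> Obj C" "Y \<in> Obj C"
  shows "\<exists>p q. is_product C X Y p q"
proof -
  obtain T where T: "is_terminal C T" using has_terminal by blast
  obtain f g where fg: "f \<in> hom C X T" "g \<in> hom C Y T"
    using T assms unfolding is_terminal_def by blast
  obtain P p q where pq: "p \<in> hom C P X" "q \<in> hom C P Y"
    "\<And>W u v. \<lbrakk>u \<in> hom C W X; v \<in> hom C W Y; f \<cdot> u = g \<cdot> v\<rbrakk> \<Longrightarrow> \<exists>h \<in> hom C W P. p \<cdot> h = u \<and> q \<cdot> h = v"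
    "\<And>W h h'. \<lbrakk>h \<in> hom C W P; h' \<in> hom C W P; p \<cdot> h = p \<cdot> h'; q \<cdot> h = q \<cdot> h'\<rbrakk> \<Longrightarrow> h = h'"
    by (rule pullbackE[OF fg]) blast
  have "f \<cdot> u = g \<cdot> v" if "u \<in> hom C W X" "v \<in> hom C W Y" for W u v
    using fg that by (intro terminal_eq[OF T, of _ W]) (simp_all add: hom_iff)
  then have "is_product C X Y p q"
    using pq by (intro is_productI[of _ P]) blast+
  then show ?thesis by blast
qed

end

text \<open>
  Both a semi-abelian category and its subcategory of two-nilpotent objects are instances.
\<close>

locale cosmash_category = pointed_category +
  assumes products: "\<lbrakk>X \<in> Obj C; Y \<in> Obj C\<rbrakk> \<Longrightarrow> \<exists>p q. is_product C X Y p q"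
    and coproducts: "\<lbrakk>X \<in> Obj C; Y \<in> Obj C\<rbrakk> \<Longrightarrow> \<exists>i j. is_coproduct C X Y i j"
    and kernels: "f \<in> Arr C \<Longrightarrow> \<exists>k. is_kernel C k f"
begin

lemma is_product_proj:
  assumes "X \<in> Obj C" "Y \<in> Obj C"
  shows "is_product C X Y (proj1 C X Y) (proj2 C X Y)"
proof -
  have "\<exists>pq. is_product C X Y (fst pq) (snd pq)" using products[OF assms] by auto
  then show ?thesis unfolding proj1_def proj2_def projections_def by (rule someI_ex)
qed

lemma is_coproduct_inj:
  assumes "X \<in> Obj C" "Y \<in> Obj C"
  shows "is_coproduct C X Y (inj1 C X Y) (inj2 C X Y)"
proof -
  have "\<exists>ij. is_coproduct C X Y (fst ij) (snd ij)" using coproducts[OF assms] by auto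
  then show ?thesis unfolding inj1_def inj2_def injections_def by (rule someI_ex)
qed

lemma
  assumes "X \<in> Obj C" "Y \<in> Obj C"
  shows proj1_hom: "proj1 C X Y \<in> hom C (prod_obj C X Y) X"
    and proj2_hom: "proj2 C X Y \<in> hom C (prod_obj C X Y) Y"
    and inj1_hom: "inj1 C X Y \<in> hom C X (coprod_obj C X Y)"
    and inj2_hom: "inj2 C X Y \<in> hom C Y (coprod_obj C X Y)"
  using is_product_proj[OF assms] is_coproduct_inj[OF assms]
  unfolding is_product_def is_coproduct_def prod_obj_def coprod_obj_def by auto

lemma
  assumes "X \<in> Obj C" "Y \<in> Obj C"
  shows proj1_arr [simp]: "proj1 C X Y \<in> Arr C"
    and dom_proj1 [simp]: "Dom C (proj1 C X Y) = prod_obj C X Y"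
    and cod_proj1 [simp]: "Cod C (proj1 C X Y) = X"
    and proj2_arr [simp]: "proj2 C X Y \<in> Arr C"
    and dom_proj2 [simp]: "Dom C (proj2 C X Y) = prod_obj C X Y"
    and cod_proj2 [simp]: "Cod C (proj2 C X Y) = Y"
    and prod_obj [simp]: "prod_obj C X Y \<in> Obj C"
    and inj1_arr [simp]: "inj1 C X Y \<in> Arr C"
    and dom_inj1 [simp]: "Dom C (inj1 C X Y) = X"
    and cod_inj1 [simp]: "Cod C (inj1 C X Y) = coprod_obj C X Y"
    and inj2_arr [simp]: "inj2 C X Y \<in> Arr C"
    and dom_inj2 [simp]: "Dom C (inj2 C X Y) = Y"
    and cod_inj2 [simp]: "Cod C (inj2 C X Y) = coprod_obj C X Y"
    and coprod_obj [simp]: "coprod_obj C X Y \<in> Obj C"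
  using proj1_hom[OF assms] proj2_hom[OF assms] inj1_hom[OF assms] inj2_hom[OF assms]
  by (auto simp: hom_iff)

lemma pairing:
  assumes "f \<in> hom C W X" "g \<in> hom C W Y"
  shows "pairing C f g \<in> hom C W (prod_obj C X Y) \<and>
    proj1 C X Y \<cdot> pairing C f g = f \<and> proj2 C X Y \<cdot> pairing C f g = g"
proof -
  have t: "Dom C f = W" "Cod C f = X" "Cod C g = Y" "X \<in> Obj C" "Y \<in> Obj C"
    using assms by (simp_all add: hom_iff)
  have "\<exists>!h. h \<in> hom C W (prod_obj C X Y) \<and> proj1 C X Y \<cdot> h = f \<and> proj2 C X Y \<cdot> h = g"
    using is_product_proj[OF t(4,5)] assms unfolding is_product_def prod_obj_def by auto
  then show ?thesis unfolding pairing_def t by (rule theI')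
qed

lemma copairing:
  assumes "f \<in> hom C X W" "g \<in> hom C Y W"
  shows "copairing C f g \<in> hom C (coprod_obj C X Y) W \<and>
    copairing C f g \<cdot> inj1 C X Y = f \<and> copairing C f g \<cdot> inj2 C X Y = g"
proof -
  have t: "Cod C f = W" "Dom C f = X" "Dom C g = Y" "X \<in> Obj C" "Y \<in> Obj C"
    using assms by (simp_all add: hom_iff)
  have "\<exists>!h. h \<in> hom C (coprod_obj C X Y) W \<and> h \<cdot> inj1 C X Y = f \<and> h \<cdot> inj2 C X Y = g"
    using is_coproduct_inj[OF t(4,5)] assms unfolding is_coproduct_def coprod_obj_def by auto
  then show ?thesis unfolding copairing_def t by (rule theI')
qed

lemma
  assumes "f \<in> Arr C" "g \<in> Arr C" "Dom C f = Dom C g" "Cod C f = X" "Cod C g = Y"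
  shows pairing_arr [simp]: "pairing C f g \<in> Arr C"
    and dom_pairing [simp]: "Dom C (pairing C f g) = Dom C f"
    and cod_pairing [simp]: "Cod C (pairing C f g) = prod_obj C X Y"
    and proj1_pairing [simp]: "proj1 C X Y \<cdot> pairing C f g = f"
    and proj2_pairing [simp]: "proj2 C X Y \<cdot> pairing C f g = g"
  using pairing[of f "Dom C f" X g Y] assms by (auto simp: hom_def)

lemma
  assumes "f \<in> Arr C" "g \<in> Arr C" "Cod C f = Cod C g" "Dom C f = X" "Dom C g = Y"
  shows copairing_arr [simp]: "copairing C f g \<in> Arr C"
    and dom_copairing [simp]: "Dom C (copairing C f g) = coprod_obj C X Y"
    and cod_copairing [simp]: "Cod C (copairing C f g) = Cod C f"
    and copairing_inj1 [simp]: "copairing C f g \<cdot> inj1 C X Y = f"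
    and copairing_inj2 [simp]: "copairing C f g \<cdot> inj2 C X Y = g"
  using copairing[of f X "Cod C f" g Y] assms by (auto simp: hom_def)

lemma
  assumes "f \<in> Arr C" "g \<in> Arr C" "Dom C f = Dom C g" "Cod C f = X" "Cod C g = Y"
    "u \<in> Arr C" "Cod C u = Dom C f"
  shows proj1_pairing_comp [simp]: "proj1 C X Y \<cdot> (pairing C f g \<cdot> u) = f \<cdot> u"
    and proj2_pairing_comp [simp]: "proj2 C X Y \<cdot> (pairing C f g \<cdot> u) = g \<cdot> u"
proof -
  have o: "X \<in> Obj C" "Y \<in> Obj C" using assms by auto
  show "proj1 C X Y \<cdot> (pairing C f g \<cdot> u) = f \<cdot> u"
    by (rule reassoc) (use assms o in simp_all)
  show "proj2 C X Y \<cdot> (pairing C f g \<cdot> u) = g \<cdot> u"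
    by (rule reassoc) (use assms o in simp_all)
qed

lemma
  assumes "f \<in> Arr C" "g \<in> Arr C" "Cod C f = Cod C g" "Dom C f = X" "Dom C g = Y" "u \<in> Arr C"
  shows copairing_inj1_comp [simp]: "Cod C u = X \<Longrightarrow> copairing C f g \<cdot> (inj1 C X Y \<cdot> u) = f \<cdot> u"
    and copairing_inj2_comp [simp]: "Cod C u = Y \<Longrightarrow> copairing C f g \<cdot> (inj2 C X Y \<cdot> u) = g \<cdot> u"
proof -
  have o: "X \<in> Obj C" "Y \<in> Obj C" using assms by auto
  show "copairing C f g \<cdot> (inj1 C X Y \<cdot> u) = f \<cdot> u" if "Cod C u = X"
    by (rule reassoc) (use assms o that in simp_all)
  show "copairing C f g \<cdot> (inj2 C X Y \<cdot> u) = g \<cdot> u" if "Cod C u = Y"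
    by (rule reassoc) (use assms o that in simp_all)
qed

lemma prod_eqI:
  assumes "X \<in> Obj C" "Y \<in> Obj C" "u \<in> hom C W (prod_obj C X Y)" "v \<in> hom C W (prod_obj C X Y)"
    "proj1 C X Y \<cdot> u = proj1 C X Y \<cdot> v" "proj2 C X Y \<cdot> u = proj2 C X Y \<cdot> v"
  shows "u = v"
proof -
  have "proj1 C X Y \<cdot> u \<in> hom C W X" "proj2 C X Y \<cdot> u \<in> hom C W Y"
    using assms(1-3) by (simp_all add: hom_iff)
  then show ?thesis
    using is_product_proj[OF assms(1,2)] assms(3-) unfolding is_product_def prod_obj_def by metis
qed

lemma coprod_eqI:
  assumes "X \<in> Obj C" "Y \<in> Obj C" "u \<in> hom C (coprod_obj C X Y) W" "v \<in> hom C (coprod_obj C X Y) W"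
    "u \<cdot> inj1 C X Y = v \<cdot> inj1 C X Y" "u \<cdot> inj2 C X Y = v \<cdot> inj2 C X Y"
  shows "u = v"
proof -
  have "u \<cdot> inj1 C X Y \<in> hom C X W" "u \<cdot> inj2 C X Y \<in> hom C Y W"
    using assms(1-3) by (simp_all add: hom_iff)
  then show ?thesis
    using is_coproduct_inj[OF assms(1,2)] assms(3-) unfolding is_coproduct_def coprod_obj_def by metis
qed

lemma pairing_comp:
  assumes "f \<in> hom C W X" "g \<in> hom C W Y" "u \<in> hom C V W"
  shows "pairing C f g \<cdot> u = pairing C (f \<cdot> u) (g \<cdot> u)"
  by (rule prod_eqI[of X Y _ V]) (use assms in \<open>simp_all add: hom_iff\<close>)

lemma kernelE:
  assumes "f \<in> hom C A B"
  obtains K k where "k \<in> hom C K A" "is_kernel C k f" "is_mono C k" "f \<cdot> k = \<zero> K B"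
    "\<And>W g. \<lbrakk>g \<in> hom C W A; f \<cdot> g = \<zero> W B\<rbrakk> \<Longrightarrow> \<exists>h \<in> hom C W K. k \<cdot> h = g"
proof -
  obtain k where k: "is_kernel C k f" using kernels assms by (auto simp: hom_iff)
  note t = is_kernel_hom[OF k assms]
  show ?thesis
    by (rule that[OF t k]) (use kernel_iff[OF assms t] k in auto)
qed

lemma is_kernel_kernel: "f \<in> Arr C \<Longrightarrow> is_kernel C (kernel C f) f"
  unfolding kernel_def using kernels[of f] by (rule someI_ex)

end

section \<open>Regular categories\<close>

lemma (in category) is_coequaliser_factor:
  assumes "is_coequaliser C r s e" "e \<in> hom C A B" "g \<in> hom C A D" "g \<cdot> r = g \<cdot> s"
  shows "\<exists>u \<in> hom C B D. u \<cdot> e = g"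
proof -
  have "e \<in> hom C (Cod C r) (Cod C e)" using assms(1) unfolding is_coequaliser_def by blast
  then have t: "Cod C r = A" "Cod C e = B" using assms(2) by (simp_all add: hom_def)
  have "\<exists>!h. h \<in> hom C B D \<and> h \<cdot> e = g"
    using assms(1,3,4) unfolding is_coequaliser_def t by blast
  then show ?thesis by blast
qed

context regular_category
begin

text \<open>Pullback stability read on elements: \<open>v\<close> is the pullback of
  \<open>e\<close> along \<open>g\<close>.\<close>

lemma regular_epi_cover:
  assumes e: "is_regular_epi C e" "e \<in> hom C A B" and g: "g \<in> hom C V B"
  obtains V' v g' where "is_regular_epi C v" "v \<in> hom C V' V" "g' \<in> hom C V' A" "e \<cdot> g' = g \<cdot> v"
proof -
  obtain V' v g' where "v \<in> hom C V' V" "g' \<in> hom C V' A" "g \<cdot> v = e \<cdot> g'" "is_pullback C g e v g'"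
    by (rule pullbackE[OF g e(2)]) blast
  then show ?thesis using that regular_epi_pullback_stable e(1) by metis
qed

text \<open>Only monicity of \<open>m\<close> is at stake. Two elements with the same value under
  \<open>m\<close> lift to \<open>A\<close> on a common cover; the lifts form an element of the
  kernel pair, which \<open>e\<close> identifies, and the covers can be cancelled.\<close>

lemma kernel_pair_coequaliser:
  assumes "is_kernel_pair C f r s" "is_coequaliser C r s e" "f \<in> hom C A B"
  obtains I m where "e \<in> hom C A I" "m \<in> hom C I B" "f = m \<cdot> e" "is_mono C m"
proof -
  have p: "r \<in> hom C (Dom C r) A" "s \<in> hom C (Dom C r) A" "f \<cdot> r = f \<cdot> s"
    using assms unfolding is_kernel_pair_def is_pullback_def by (auto simp: hom_def)
  have c: "e \<in> hom C A (Cod C e)" "e \<cdot> r = e \<cdot> s" "is_regular_epi C e"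
    using assms(2) p unfolding is_coequaliser_def is_regular_epi_def by (auto simp: hom_def)
  obtain m where m: "m \<in> hom C (Cod C e) B" "m \<cdot> e = f"
    using is_coequaliser_factor[OF assms(2) c(1) assms(3) p(3)] by blast
  have "is_mono C m"
  proof (rule is_monoI[OF m(1)])
    fix W u v assume u: "u \<in> hom C W (Cod C e)" and v: "v \<in> hom C W (Cod C e)" and eq: "m \<cdot> u = m \<cdot> v"
    obtain W1 w1 u1 where 1: "is_regular_epi C w1" "w1 \<in> hom C W1 W" "u1 \<in> hom C W1 A" "e \<cdot> u1 = u \<cdot> w1"
      by (rule regular_epi_cover[OF c(3,1) u])
    have "v \<cdot> w1 \<in> hom C W1 (Cod C e)" using v 1 by (simp add: hom_iff)
    then obtain W2 w2 v2 where 2: "is_regular_epi C w2" "w2 \<in> hom C W2 W1" "v2 \<in> hom C W2 A"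
      "e \<cdot> v2 = (v \<cdot> w1) \<cdot> w2"
      by (rule regular_epi_cover[OF c(3,1)])
    have "f \<cdot> (u1 \<cdot> w2) = m \<cdot> (u \<cdot> (w1 \<cdot> w2))"
      using 1 2 m(1) c(1) u reassoc2[OF 1(4), of w2] by (simp add: m(2)[symmetric] hom_iff)
    also have "\<dots> = m \<cdot> (v \<cdot> (w1 \<cdot> w2))"
      using reassoc2[OF eq, of "w1 \<cdot> w2"] 1 2 m(1) c(1) u v by (simp add: hom_iff)
    also have "\<dots> = f \<cdot> v2"
      using 1 2 m(1) c(1) v by (simp add: m(2)[symmetric] hom_iff)
    finally obtain h where h: "h \<in> hom C W2 (Dom C r)" "r \<cdot> h = u1 \<cdot> w2" "s \<cdot> h = v2"
      using is_pullback_lift[OF assms(1)[unfolded is_kernel_pair_def], of "u1 \<cdot> w2" W2 v2] 1 2 assms(3)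
      by (auto simp: hom_def)
    have "u \<cdot> (w1 \<cdot> w2) = e \<cdot> (r \<cdot> h)"
      using reassoc2[OF 1(4), of w2] 1 2 h c(1) u by (simp add: hom_iff)
    also have "\<dots> = e \<cdot> (s \<cdot> h)"
      using reassoc2[OF c(2), of h] h c p by (simp add: hom_iff)
    also have "\<dots> = v \<cdot> (w1 \<cdot> w2)" using h 1 2 c v by (simp add: hom_iff)
    finally have "(u \<cdot> w1) \<cdot> w2 = (v \<cdot> w1) \<cdot> w2" using 1 2 u v by (simp add: hom_iff)
    then have "u \<cdot> w1 = v \<cdot> w1"
      by (rule regular_epi_cancel[OF 2(1,2), of _ "Cod C e", rotated 2])
        (use 1 u v in \<open>simp_all add: hom_iff\<close>)
    then show "u = v"
      by (rule regular_epi_cancel[OF 1(1,2) u v])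
  qed
  then show ?thesis using that c m by metis
qed

lemma image_factorisation:
  assumes f: "f \<in> hom C A B"
  obtains I m e where "e \<in> hom C A I" "is_regular_epi C e" "m \<in> hom C I B" "is_mono C m" "f = m \<cdot> e"
proof -
  obtain P r s where "is_pullback C f f r s" by (rule pullbackE[OF f f])
  then have k: "is_kernel_pair C f r s" by (simp add: is_kernel_pair_def)
  then obtain e where e: "is_coequaliser C r s e" using kernel_pairs_have_coequalisers by blast
  then have "is_regular_epi C e" unfolding is_regular_epi_def by blast
  then show ?thesis using kernel_pair_coequaliser[OF k e f] that by metis
qed

text \<open>The pair that exhibits \<open>e\<close> as a coequaliser factors through the kernel
  pair, so an arrow that identifies the kernel pair identifies that pair as well.\<close>

lemma coequaliser_kernel_pair:
  assumes "is_regular_epi C e" "e \<in> hom C A B" "is_kernel_pair C e r s"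
    and "g \<in> hom C A D" "g \<cdot> r = g \<cdot> s"
  shows "\<exists>u \<in> hom C B D. u \<cdot> e = g"
proof -
  obtain r0 s0 where c: "is_coequaliser C r0 s0 e" using assms(1) unfolding is_regular_epi_def by blast
  then have t: "r0 \<in> hom C (Dom C r0) A" "s0 \<in> hom C (Dom C r0) A" "e \<cdot> r0 = e \<cdot> s0"
    using assms(2) unfolding is_coequaliser_def hom_def by auto
  have p: "r \<in> hom C (Dom C r) A" "s \<in> hom C (Dom C r) A" "e \<cdot> r = e \<cdot> s"
    using assms unfolding is_kernel_pair_def is_pullback_def by (auto simp: hom_def)
  obtain h where h: "h \<in> hom C (Dom C r0) (Dom C r)" "r \<cdot> h = r0" "s \<cdot> h = s0"
    using is_pullback_lift[OF assms(3)[unfolded is_kernel_pair_def], of r0 "Dom C r0" s0] t assms(2)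
    by (auto simp: hom_def)
  have "g \<cdot> r0 = g \<cdot> s0"
    using reassoc2[OF assms(5), of h] h p assms(4) by (simp add: hom_iff)
  then show ?thesis by (rule is_coequaliser_factor[OF c assms(2,4)])
qed

text \<open>The monic part of the image of \<open>f\<close> is split epic by assumption, hence
  invertible, so \<open>f\<close> inherits the coequaliser property of its regular epic part. The
  criterion suits sums, where one only knows that a subobject contains the generators.\<close>

lemma regular_epi_if_extremal:
  assumes f: "f \<in> hom C A B"
    and ext: "\<And>D m g. \<lbrakk>m \<in> hom C D B; is_mono C m; g \<in> hom C A D; m \<cdot> g = f\<rbrakk> \<Longrightarrow> \<exists>n \<in> hom C B D. m \<cdot> n = \<one> B"
  shows "is_regular_epi C f"
proof -
  obtain I m e where i: "e \<in> hom C A I" "is_regular_epi C e" "m \<in> hom C I B" "is_mono C m" "f = m \<cdot> e"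
    by (rule image_factorisation[OF f])
  obtain n where n: "n \<in> hom C B I" "m \<cdot> n = \<one> B" using ext i by metis
  have nm: "n \<cdot> m = \<one> I" by (rule iso_if_split_mono) (use i n in auto)
  obtain r s where c: "is_coequaliser C r s e" using i(2) unfolding is_regular_epi_def by blast
  then have t: "r \<in> hom C (Dom C r) A" "s \<in> hom C (Dom C r) A" "e \<cdot> r = e \<cdot> s"
    using i unfolding is_coequaliser_def hom_def by auto
  have "is_coequaliser C r s f" unfolding is_coequaliser_def
  proof (intro conjI allI ballI impI)
    show "r \<in> Arr C" "s \<in> hom C (Dom C r) (Cod C r)" using t by (simp_all add: hom_iff)
    show "f \<in> hom C (Cod C r) (Cod C f)" "f \<cdot> r = f \<cdot> s" using t i f by (simp_all add: hom_iff)
    fix W g assume g: "g \<in> hom C (Cod C r) W" "g \<cdot> r = g \<cdot> s"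
    then obtain u where u: "u \<in> hom C I W" "u \<cdot> e = g"
      using is_coequaliser_factor[OF c i(1), of g W] t by (auto simp: hom_iff)
    show "\<exists>!h. h \<in> hom C (Cod C f) W \<and> h \<cdot> f = g"
    proof (rule ex1I[of _ "u \<cdot> n"])
      show "u \<cdot> n \<in> hom C (Cod C f) W \<and> (u \<cdot> n) \<cdot> f = g"
        using u n i nm[THEN reassoc, of e] by (simp add: hom_iff)
      fix h assume h: "h \<in> hom C (Cod C f) W \<and> h \<cdot> f = g"
      have "h \<cdot> m = u"
        by (rule regular_epi_cancel[OF i(2,1), of _ W]) (use h u i in \<open>simp_all add: hom_iff\<close>)
      then have "u \<cdot> n = (h \<cdot> m) \<cdot> n" by simp
      also have "\<dots> = h" using h n i by (simp add: hom_iff)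
      finally show "h = u \<cdot> n" by simp
    qed
  qed
  then show ?thesis unfolding is_regular_epi_def by blast
qed

text \<open>If \<open>f\<close> factors through a subobject, so does \<open>f \<cdot> g\<close>, and
  the diagonal obtained from the strength of \<open>f \<cdot> g\<close> splits the
  inclusion.\<close>

lemma regular_epi_if_comp:
  assumes f: "f \<in> hom C A B" and g: "g \<in> hom C V A" and fg: "is_regular_epi C (f \<cdot> g)"
  shows "is_regular_epi C f"
proof (rule regular_epi_if_extremal[OF f])
  fix D m h assume m: "m \<in> hom C D B" "is_mono C m" and h: "h \<in> hom C A D" "m \<cdot> h = f"
  have "\<exists>d \<in> hom C B D. d \<cdot> (f \<cdot> g) = h \<cdot> g \<and> m \<cdot> d = \<one> B"
    by (rule regular_epi_strong[OF fg _ m(2,1), of V]) (use m h f g in \<open>simp_all add: hom_iff flip: h(2)\<close>)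
  then show "\<exists>n \<in> hom C B D. m \<cdot> n = \<one> B" by blast
qed

text \<open>A subobject through which the composite factors receives the middle object by the
  strength of \<open>e\<close>, and then the codomain by the strength of \<open>e'\<close>.\<close>

lemma regular_epi_comp:
  assumes e: "is_regular_epi C e" "e \<in> hom C A B" and e': "is_regular_epi C e'" "e' \<in> hom C B D"
  shows "is_regular_epi C (e' \<cdot> e)"
proof (rule regular_epi_if_extremal)
  show "e' \<cdot> e \<in> hom C A D" using assms by (simp add: hom_iff)
  fix I m g assume m: "m \<in> hom C I D" "is_mono C m" and g: "g \<in> hom C A I" "m \<cdot> g = e' \<cdot> e"
  obtain d where d: "d \<in> hom C B I" "m \<cdot> d = e'"
    using regular_epi_strong[OF e m(2,1) g(1) e'(2) g(2)] by blast
  have "\<exists>d' \<in> hom C D I. d' \<cdot> e' = d \<and> m \<cdot> d' = \<one> D"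
    by (rule regular_epi_strong[OF e' m(2,1) d(1)]) (use d m e' in \<open>simp_all add: hom_iff\<close>)
  then show "\<exists>n \<in> hom C D I. m \<cdot> n = \<one> D" by blast
qed

end

lemma (in finitely_complete_category) mono_pullback_stable:
  assumes "is_mono C m" "is_pullback C m g p q" "m \<in> hom C A D" "g \<in> hom C B D" "p \<in> hom C P A" "q \<in> hom C P B"
  shows "is_mono C q"
proof (rule is_monoI[OF assms(6)])
  fix W u v assume u: "u \<in> hom C W P" "v \<in> hom C W P" "q \<cdot> u = q \<cdot> v"
  have eq: "m \<cdot> p = g \<cdot> q" using assms(2) unfolding is_pullback_def by blast
  have "m \<cdot> (p \<cdot> u) = m \<cdot> (p \<cdot> v)"
    using u assms(3-) reassoc2[OF eq, of u] reassoc2[OF eq, of v] by (simp add: hom_iff)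
  then have "p \<cdot> u = p \<cdot> v"
    by (rule is_monoD[OF assms(1,3), of _ W, rotated 2]) (use u assms in \<open>simp_all add: hom_iff\<close>)
  then show "u = v"
    using is_pullback_unique[OF assms(2), of u W v] u assms(5) by (simp add: hom_iff)
qed

sublocale semi_abelian_category \<subseteq> cosmash_category
proof (unfold_locales, goal_cases)
  case (1 X Y) then show ?case by (rule product_exists)
next
  case (2 X Y) then show ?case by (rule has_coproducts)
next
  case (3 f)
  then have f: "f \<in> hom C (Dom C f) (Cod C f)" by (rule arr_hom)
  obtain Z where Z: "is_zero_obj C Z" using has_zero_obj by blast
  then have Z': "Z \<in> Obj C" "is_terminal C Z" by (auto simp: is_zero_obj_def is_terminal_def)
  have z: "\<zero> Z (Cod C f) \<in> hom C Z (Cod C f)" using 3 Z' by (simp add: hom_iff)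
  \<comment> \<open>The kernel is the pullback of \<open>f\<close> along the zero arrow out of a
    zero object; the other leg \<open>t\<close> carries no information because \<open>Z\<close> is
    terminal.\<close>
  obtain K k t where k: "k \<in> hom C K (Dom C f)" "t \<in> hom C K Z" "f \<cdot> k = \<zero> Z (Cod C f) \<cdot> t"
    "\<And>W u v. \<lbrakk>u \<in> hom C W (Dom C f); v \<in> hom C W Z; f \<cdot> u = \<zero> Z (Cod C f) \<cdot> v\<rbrakk>
      \<Longrightarrow> \<exists>h \<in> hom C W K. k \<cdot> h = u \<and> t \<cdot> h = v"
    "\<And>W h h'. \<lbrakk>h \<in> hom C W K; h' \<in> hom C W K; k \<cdot> h = k \<cdot> h'; t \<cdot> h = t \<cdot> h'\<rbrakk> \<Longrightarrow> h = h'"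
    by (rule pullbackE[OF f z]) blast
  have "is_kernel C k f" unfolding kernel_iff[OF f k(1)]
  proof (intro conjI allI ballI impI)
    show "f \<cdot> k = \<zero> K (Cod C f)" using k(2,3) 3 by (simp add: hom_iff)
    show "is_mono C k"
    proof (rule is_monoI[OF k(1)])
      fix W u v assume u: "u \<in> hom C W K" "v \<in> hom C W K" "k \<cdot> u = k \<cdot> v"
      have "t \<cdot> u = t \<cdot> v"
        by (rule terminal_eq[OF Z'(2), of _ W]) (use k u in \<open>simp_all add: hom_iff\<close>)
      then show "u = v" using k(5) u by blast
    qed
    fix W g assume g: "g \<in> hom C W (Dom C f)" "f \<cdot> g = \<zero> W (Cod C f)"
    then have "\<exists>h \<in> hom C W K. k \<cdot> h = g \<and> t \<cdot> h = \<zero> W Z"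
      using Z' 3 by (intro k(4)) (simp_all add: hom_iff)
    then show "\<exists>h \<in> hom C W K. k \<cdot> h = g" by blast
  qed
  then show ?case by blast
qed

section \<open>Consequences of protomodularity\<close>

context semi_abelian_category
begin

text \<open>This is protomodularity for change of base along the arrow from a zero object.\<close>

lemma point_generation:
  assumes p: "p \<in> hom C A Y" and s: "s \<in> hom C Y A" and ps: "p \<cdot> s = \<one> Y"
    and m: "m \<in> hom C D A" "is_mono C m" and b: "b \<in> hom C Y D" "m \<cdot> b = s"
    and ker: "\<And>W g. \<lbrakk>g \<in> hom C W A; p \<cdot> g = \<zero> W Y\<rbrakk> \<Longrightarrow> \<exists>h \<in> hom C W D. m \<cdot> h = g"
  shows "\<exists>n \<in> hom C A D. m \<cdot> n = \<one> A"
proof -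
  obtain Z where "is_zero_obj C Z" using has_zero_obj by blast
  then have Z: "Z \<in> Obj C" "is_terminal C Z" by (auto simp: is_zero_obj_def is_terminal_def)
  have z: "\<zero> Z Y \<in> hom C Z Y" using Z p by (simp add: hom_iff)
  obtain K a k where ak: "a \<in> hom C K Z" "k \<in> hom C K A" "\<zero> Z Y \<cdot> a = p \<cdot> k"
    "is_pullback C (\<zero> Z Y) p a k"
    "\<And>W u v. \<lbrakk>u \<in> hom C W Z; v \<in> hom C W A; \<zero> Z Y \<cdot> u = p \<cdot> v\<rbrakk>
      \<Longrightarrow> \<exists>h \<in> hom C W K. a \<cdot> h = u \<and> k \<cdot> h = v"
    "\<And>W h h'. \<lbrakk>h \<in> hom C W K; h' \<in> hom C W K; a \<cdot> h = a \<cdot> h'; k \<cdot> h = k \<cdot> h'\<rbrakk> \<Longrightarrow> h = h'"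
    by (rule pullbackE[OF z p]) blast
  have "p \<cdot> k = \<zero> K Y" using ak(1,3) p by (simp add: hom_iff flip: ak(3))
  then obtain l where l: "l \<in> hom C K D" "m \<cdot> l = k" using ker[OF ak(2)] by blast
  have pm: "p \<cdot> m \<in> hom C D Y" using p m by (simp add: hom_iff)
  \<comment> \<open>The kernel \<open>k\<close> of \<open>p\<close> factors through \<open>m\<close>
    as \<open>l\<close>, so \<open>p\<close> and \<open>p \<cdot> m\<close> have the same pullback
    along the zero arrow, and \<open>m\<close> induces the identity of \<open>K\<close> between the
    kernels.\<close>
  have pb: "is_pullback C (\<zero> Z Y) (p \<cdot> m) a l"
  proof (rule is_pullbackI[OF z pm ak(1) l(1)])
    show "\<zero> Z Y \<cdot> a = (p \<cdot> m) \<cdot> l" using ak(3) l p m by (simp add: hom_iff)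
    fix W u v assume u: "u \<in> hom C W Z" "v \<in> hom C W D" "\<zero> Z Y \<cdot> u = (p \<cdot> m) \<cdot> v"
    have "\<exists>h \<in> hom C W K. a \<cdot> h = u \<and> k \<cdot> h = m \<cdot> v"
      by (rule ak(5)) (use u p m in \<open>simp_all add: hom_iff\<close>)
    then obtain h where h: "h \<in> hom C W K" "a \<cdot> h = u" "k \<cdot> h = m \<cdot> v" by blast
    have "l \<cdot> h = v"
      by (rule is_monoD[OF m(2,1), of _ W]) (use h l u m reassoc[OF l(2), of h] in \<open>simp_all add: hom_iff\<close>)
    then show "\<exists>h \<in> hom C W K. a \<cdot> h = u \<and> l \<cdot> h = v" using h by blast
  next
    fix W h h' assume h: "h \<in> hom C W K" "h' \<in> hom C W K" "a \<cdot> h = a \<cdot> h'" "l \<cdot> h = l \<cdot> h'"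
    have "k \<cdot> h = k \<cdot> h'"
      using reassoc[OF l(2), of h] reassoc[OF l(2), of h'] h m l by (simp add: hom_iff)
    then show "h = h'" using ak(6) h by blast
  qed
  have d: "Dom C a = K" "Dom C (p \<cdot> m) = D" "Dom C p = A" "K \<in> Obj C" using p m ak by (simp_all add: hom_iff)
  have "is_iso C m"
  proof (rule change_of_base_reflects_iso[OF z _ _ _ pb ak(4)])
    show "is_point C Y (p \<cdot> m) b" "is_point C Y p s" "is_point_arrow C (p \<cdot> m) b p s m"
      unfolding is_point_def is_point_arrow_def d using p s ps m b by (simp_all add: hom_iff)
    show "\<one> K \<in> hom C (Dom C a) (Dom C a)" "a \<cdot> \<one> K = a" "k \<cdot> \<one> K = m \<cdot> l"
      using ak l d by (simp_all add: hom_iff)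
    show "is_iso C (\<one> K)" unfolding is_iso_def using d by (auto intro!: bexI[of _ "\<one> K"] simp: hom_iff)
  qed
  then show ?thesis unfolding is_iso_def using m by (auto simp: hom_def)
qed

section \<open>Kernels control kernel pairs\<close>

text \<open>Pullback of the graphs of \<open>u\<close> and \<open>v\<close>: the first components
  force its two legs to coincide.\<close>

lemma equaliserE:
  assumes "u \<in> hom C A B" "v \<in> hom C A B"
  obtains E m where "m \<in> hom C E A" "is_mono C m" "u \<cdot> m = v \<cdot> m"
    "\<And>W g. \<lbrakk>g \<in> hom C W A; u \<cdot> g = v \<cdot> g\<rbrakk> \<Longrightarrow> \<exists>h \<in> hom C W E. m \<cdot> h = g"
proof -
  have A: "A \<in> Obj C" "B \<in> Obj C" using assms by (simp_all add: hom_iff)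
  let ?u = "pairing C (\<one> A) u" and ?v = "pairing C (\<one> A) v"
  have h: "?u \<in> hom C A (prod_obj C A B)" "?v \<in> hom C A (prod_obj C A B)"
    using assms by (simp_all add: hom_iff)
  obtain E m n where mn: "m \<in> hom C E A" "n \<in> hom C E A" "?u \<cdot> m = ?v \<cdot> n"
    "\<And>W f g. \<lbrakk>f \<in> hom C W A; g \<in> hom C W A; ?u \<cdot> f = ?v \<cdot> g\<rbrakk> \<Longrightarrow> \<exists>h \<in> hom C W E. m \<cdot> h = f \<and> n \<cdot> h = g"
    "\<And>W h h'. \<lbrakk>h \<in> hom C W E; h' \<in> hom C W E; m \<cdot> h = m \<cdot> h'; n \<cdot> h = n \<cdot> h'\<rbrakk> \<Longrightarrow> h = h'"
    by (rule pullbackE[OF h]) blast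
  have "proj1 C A B \<cdot> (?u \<cdot> m) = proj1 C A B \<cdot> (?v \<cdot> n)" using mn(3) by simp
  then have nm: "n = m" using assms A mn(1,2) by (simp add: hom_iff)
  have "proj2 C A B \<cdot> (?u \<cdot> m) = proj2 C A B \<cdot> (?v \<cdot> n)" using mn(3) by simp
  then have eq: "u \<cdot> m = v \<cdot> m" using assms A mn(1,2) by (simp add: hom_iff nm)
  have "is_mono C m" using mn(5) by (intro is_monoI[OF mn(1)]) (simp add: nm)
  moreover have "\<exists>h \<in> hom C W E. m \<cdot> h = g" if g: "g \<in> hom C W A" "u \<cdot> g = v \<cdot> g" for W g
  proof -
    have "?u \<cdot> g = ?v \<cdot> g"
      by (rule prod_eqI[of A B _ W]) (use g assms A in \<open>simp_all add: hom_iff\<close>)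
    then show ?thesis using mn(4)[of g W g] g by blast
  qed
  ultimately show ?thesis using that mn(1) eq by blast
qed

text \<open>The equaliser of \<open>u\<close> and \<open>v\<close> contains the section and the
  kernel of \<open>p\<close>, so by generation it is all of \<open>A\<close>.\<close>

lemma point_jointly_epic:
  assumes p: "p \<in> hom C A Y" and s: "s \<in> hom C Y A" and ps: "p \<cdot> s = \<one> Y"
    and uv: "u \<in> hom C A D" "v \<in> hom C A D" "u \<cdot> s = v \<cdot> s"
    and ker: "\<And>W g. \<lbrakk>g \<in> hom C W A; p \<cdot> g = \<zero> W Y\<rbrakk> \<Longrightarrow> u \<cdot> g = v \<cdot> g"
  shows "u = v"
proof -
  obtain E m where m: "m \<in> hom C E A" "is_mono C m" "u \<cdot> m = v \<cdot> m"
    "\<And>W g. \<lbrakk>g \<in> hom C W A; u \<cdot> g = v \<cdot> g\<rbrakk> \<Longrightarrow> \<exists>h \<in> hom C W E. m \<cdot> h = g"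
    by (rule equaliserE[OF uv(1,2)]) blast
  obtain b where b: "b \<in> hom C Y E" "m \<cdot> b = s" using m(4)[OF s uv(3)] by blast
  obtain n where n: "n \<in> hom C A E" "m \<cdot> n = \<one> A"
    using point_generation[OF p s ps m(1,2) b] m(4) ker by meson
  have "u \<cdot> (m \<cdot> n) = v \<cdot> (m \<cdot> n)"
    using reassoc2[OF m(3), of n] uv m n by (simp add: hom_iff)
  then show ?thesis using n uv by (simp add: hom_iff)
qed

text \<open>The kernel pair of \<open>f\<close> is a point over \<open>A\<close> through
  \<open>r\<close> and the diagonal \<open>d\<close>. The kernel of \<open>r\<close> consists of the
  pairs \<open>(0, x)\<close> with \<open>f x = 0\<close>, on which \<open>g\<close> takes the value
  zero through both legs; on the diagonal the legs agree trivially.\<close>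

lemma coequalise_if_kernel_killed:
  assumes f: "f \<in> hom C A B" and g: "g \<in> hom C A D"
    and ker: "\<And>W h. \<lbrakk>h \<in> hom C W A; f \<cdot> h = \<zero> W B\<rbrakk> \<Longrightarrow> g \<cdot> h = \<zero> W D"
    and uv: "u \<in> hom C V A" "v \<in> hom C V A" "f \<cdot> u = f \<cdot> v"
  shows "g \<cdot> u = g \<cdot> v"
proof -
  obtain R r s where rs: "r \<in> hom C R A" "s \<in> hom C R A" "f \<cdot> r = f \<cdot> s"
    "\<And>W u v. \<lbrakk>u \<in> hom C W A; v \<in> hom C W A; f \<cdot> u = f \<cdot> v\<rbrakk> \<Longrightarrow> \<exists>h \<in> hom C W R. r \<cdot> h = u \<and> s \<cdot> h = v"
    by (rule pullbackE[OF f f]) blast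
  have A: "A \<in> Obj C" using f by (simp add: hom_iff)
  have "\<exists>d \<in> hom C A R. r \<cdot> d = \<one> A \<and> s \<cdot> d = \<one> A"
    by (rule rs(4)) (use A in \<open>simp_all add: hom_iff\<close>)
  then obtain d where d: "d \<in> hom C A R" "r \<cdot> d = \<one> A" "s \<cdot> d = \<one> A" by blast
  have eq: "g \<cdot> r = g \<cdot> s"
  proof (rule point_jointly_epic[OF rs(1) d(1,2)])
    show "g \<cdot> r \<in> hom C R D" "g \<cdot> s \<in> hom C R D" "(g \<cdot> r) \<cdot> d = (g \<cdot> s) \<cdot> d"
      using g rs d by (simp_all add: hom_iff)
    fix W h assume h: "h \<in> hom C W R" "r \<cdot> h = \<zero> W A"
    have "f \<cdot> (s \<cdot> h) = \<zero> W B" using reassoc2[OF rs(3), of h] h f rs by (simp add: hom_iff)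
    then have "g \<cdot> (s \<cdot> h) = \<zero> W D" using ker[of "s \<cdot> h" W] rs h by (simp add: hom_iff)
    then show "(g \<cdot> r) \<cdot> h = (g \<cdot> s) \<cdot> h" using h rs g by (simp add: hom_iff)
  qed
  obtain h where h: "h \<in> hom C V R" "r \<cdot> h = u" "s \<cdot> h = v" using rs(4)[OF uv] by blast
  show ?thesis
    using reassoc2[OF eq, of h] g rs(1,2) h(1) by (simp add: hom_iff h(2,3))
qed

text \<open>The identity kills whatever \<open>f\<close> kills, hence it identifies whatever
  \<open>f\<close> identifies.\<close>

lemma mono_if_trivial_kernel:
  assumes f: "f \<in> hom C A B"
    and "\<And>W h. \<lbrakk>h \<in> hom C W A; f \<cdot> h = \<zero> W B\<rbrakk> \<Longrightarrow> h = \<zero> W A"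
  shows "is_mono C f"
proof (rule is_monoI[OF f])
  fix W u v assume u: "u \<in> hom C W A" "v \<in> hom C W A" "f \<cdot> u = f \<cdot> v"
  have A: "\<one> A \<in> hom C A A" using f by (simp add: hom_iff)
  have "\<one> A \<cdot> u = \<one> A \<cdot> v"
  proof (rule coequalise_if_kernel_killed[OF f A _ u])
    fix V h assume h: "h \<in> hom C V A" "f \<cdot> h = \<zero> V B"
    then have "h = \<zero> V A" by (rule assms(2))
    then show "\<one> A \<cdot> h = \<zero> V A" using h A by (simp add: hom_iff)
  qed
  then show "u = v" using u by (simp add: hom_iff)
qed

text \<open>The condition on the kernel of \<open>e\<close> is upgraded to one on its kernel pair,
  whose coequaliser is \<open>e\<close>.\<close>

lemma regular_epi_factor:
  assumes e: "is_regular_epi C e" "e \<in> hom C A B" and g: "g \<in> hom C A D"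
    and ker: "\<And>W h. \<lbrakk>h \<in> hom C W A; e \<cdot> h = \<zero> W B\<rbrakk> \<Longrightarrow> g \<cdot> h = \<zero> W D"
  shows "\<exists>u \<in> hom C B D. u \<cdot> e = g"
proof -
  obtain R r s where rs: "r \<in> hom C R A" "s \<in> hom C R A" "e \<cdot> r = e \<cdot> s" "is_pullback C e e r s"
    by (rule pullbackE[OF e(2,2)]) blast
  have "g \<cdot> r = g \<cdot> s" by (rule coequalise_if_kernel_killed[OF e(2) g ker rs(1-3)])
  then show ?thesis using coequaliser_kernel_pair[OF e _ g] rs(4) by (simp add: is_kernel_pair_def)
qed

text \<open>A form of the short five lemma.\<close>

lemma split_if_onto_and_contains_kernel:
  assumes e: "e \<in> hom C P B" and i: "i \<in> hom C I P" "is_mono C i" and ei: "is_regular_epi C (e \<cdot> i)"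
    and ker: "\<And>W h. \<lbrakk>h \<in> hom C W P; e \<cdot> h = \<zero> W B\<rbrakk> \<Longrightarrow> \<exists>h' \<in> hom C W I. i \<cdot> h' = h"
  shows "\<exists>n \<in> hom C P I. i \<cdot> n = \<one> P"
proof -
  have ei': "e \<cdot> i \<in> hom C I B" using e i by (simp add: hom_iff)
  have o: "I \<in> Obj C" "P \<in> Obj C" using i by (simp_all add: hom_iff)
  \<comment> \<open>\<open>Q\<close> consists of the pairs \<open>(x, y)\<close> with
    \<open>e x = e (i y)\<close>. It is a point over \<open>I\<close> with section
    \<open>y \<mapsto> (i y, y)\<close>, and its projection \<open>q2\<close> to \<open>P\<close> is
    regular epic because \<open>e \<cdot> i\<close> is.\<close>
  obtain Q q1 q2 where q: "q2 \<in> hom C Q P" "q1 \<in> hom C Q I" "e \<cdot> q2 = (e \<cdot> i) \<cdot> q1" "is_pullback C e (e \<cdot> i) q2 q1"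
    "\<And>W u v. \<lbrakk>u \<in> hom C W P; v \<in> hom C W I; e \<cdot> u = (e \<cdot> i) \<cdot> v\<rbrakk> \<Longrightarrow> \<exists>h \<in> hom C W Q. q2 \<cdot> h = u \<and> q1 \<cdot> h = v"
    by (rule pullbackE[OF e ei']) blast
  have epi: "is_regular_epi C q2" using regular_epi_pullback_stable[OF q(4) ei] .
  have "\<exists>t \<in> hom C I Q. q2 \<cdot> t = i \<and> q1 \<cdot> t = \<one> I"
    by (rule q(5)) (use i e o in \<open>simp_all add: hom_iff\<close>)
  then obtain t where t: "t \<in> hom C I Q" "q2 \<cdot> t = i" "q1 \<cdot> t = \<one> I" by blast
  \<comment> \<open>\<open>J\<close> is the subobject of \<open>Q\<close> where \<open>x\<close>
    lies in \<open>I\<close>. It contains the section, and also the kernel of \<open>q1\<close>,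
    whose elements have \<open>e x = 0\<close>.\<close>
  obtain J j j' where j: "j' \<in> hom C J I" "j \<in> hom C J Q" "i \<cdot> j' = q2 \<cdot> j" "is_pullback C i q2 j' j"
    "\<And>W u v. \<lbrakk>u \<in> hom C W I; v \<in> hom C W Q; i \<cdot> u = q2 \<cdot> v\<rbrakk> \<Longrightarrow> \<exists>h \<in> hom C W J. j' \<cdot> h = u \<and> j \<cdot> h = v"
    by (rule pullbackE[OF i(1) q(1)]) blast
  have jm: "is_mono C j" by (rule mono_pullback_stable[OF i(2) j(4) i(1) q(1) j(1,2)])
  have "\<exists>b \<in> hom C I J. j' \<cdot> b = \<one> I \<and> j \<cdot> b = t"
    by (rule j(5)) (use t i o in \<open>simp_all add: hom_iff\<close>)
  then obtain b where b: "b \<in> hom C I J" "j \<cdot> b = t" by blast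
  have "\<exists>n \<in> hom C Q J. j \<cdot> n = \<one> Q"
  proof (rule point_generation[OF q(2) t(1,3) j(2) jm b])
    fix W g assume g: "g \<in> hom C W Q" "q1 \<cdot> g = \<zero> W I"
    have "e \<cdot> (q2 \<cdot> g) = \<zero> W B"
      using reassoc2[OF q(3), of g] g e i q(1,2) by (simp add: hom_iff)
    moreover have "q2 \<cdot> g \<in> hom C W P" using q(1) g by (simp add: hom_iff)
    ultimately obtain h' where "h' \<in> hom C W I" "i \<cdot> h' = q2 \<cdot> g" using ker by blast
    then show "\<exists>h \<in> hom C W J. j \<cdot> h = g" using j(5)[of h' W g] g by blast
  qed
  then obtain n where n: "n \<in> hom C Q J" "j \<cdot> n = \<one> Q" by blast
  \<comment> \<open>So \<open>q2\<close> factors through the monomorphism \<open>i\<close>, and the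
    diagonal of this square splits \<open>i\<close>.\<close>
  have eq: "i \<cdot> (j' \<cdot> n) = \<one> P \<cdot> q2"
    using reassoc2[OF j(3), of n] n i j q(1) by (simp add: hom_iff)
  have "\<exists>d \<in> hom C P I. d \<cdot> q2 = j' \<cdot> n \<and> i \<cdot> d = \<one> P"
    by (rule regular_epi_strong[OF epi q(1) i(2,1) _ _ eq]) (use j n o in \<open>simp_all add: hom_iff\<close>)
  then show ?thesis by blast
qed

section \<open>Lifting elements of kernels\<close>

text \<open>In the image factorisation \<open>e = s \<cdot> p\<close> idempotency reads
  \<open>s \<cdot> p \<cdot> s \<cdot> p = s \<cdot> p\<close>; cancelling the monic
  \<open>s\<close> on the left and the epic \<open>p\<close> on the right leaves an
  identity.\<close>

lemma idempotent_splitting: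
  assumes "e \<in> hom C A A" "e \<cdot> e = e"
  obtains B p s where "p \<in> hom C A B" "s \<in> hom C B A" "p \<cdot> s = \<one> B" "s \<cdot> p = e"
proof -
  obtain B s p where f: "p \<in> hom C A B" "is_regular_epi C p" "s \<in> hom C B A" "is_mono C s" "e = s \<cdot> p"
    by (rule image_factorisation[OF assms(1)])
  have "s \<cdot> (p \<cdot> (s \<cdot> p)) = s \<cdot> p" using assms(2) f(1,3) unfolding f(5) by (simp add: hom_iff)
  then have "p \<cdot> (s \<cdot> p) = p"
    by (rule is_monoD[OF f(4,3), of _ A, rotated 2]) (use f(1,3) in \<open>simp_all add: hom_iff\<close>)
  then have "(p \<cdot> s) \<cdot> p = \<one> B \<cdot> p" using f(1,3) by (simp add: hom_iff)
  then have "p \<cdot> s = \<one> B"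
    by (rule regular_epi_cancel[OF f(2,1), of _ B, rotated 2]) (use f(1,3) in \<open>simp_all add: hom_iff\<close>)
  then show ?thesis using that f by blast
qed

text \<open>
  Split both idempotents: the square formed by \<open>e\<close> and the two retractions is a regular pushout.
\<close>

lemma lift_to_kernel:
  assumes e: "is_regular_epi C e" "e \<in> hom C A B"
    and i: "i \<in> hom C A A" "i \<cdot> i = i" and i': "i' \<in> hom C B B" "e \<cdot> i = i' \<cdot> e"
    and g: "g \<in> hom C V B" "i' \<cdot> g = \<zero> V B"
  obtains V' v g' where "is_regular_epi C v" "v \<in> hom C V' V" "g' \<in> hom C V' A" "i \<cdot> g' = \<zero> V' A"
    "e \<cdot> g' = g \<cdot> v"
proof -
  have "(i' \<cdot> i') \<cdot> e = i' \<cdot> e"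
    using i i' e(2) reassoc2[OF i'(2), of i] by (simp add: hom_iff)
  then have "i' \<cdot> i' = i'"
    by (rule regular_epi_cancel[OF e, of _ B, rotated 2]) (use i' in \<open>simp_all add: hom_iff\<close>)
  then obtain B' p' s' where b: "p' \<in> hom C B B'" "s' \<in> hom C B' B" "p' \<cdot> s' = \<one> B'" "s' \<cdot> p' = i'"
    using idempotent_splitting[OF i'(1)] by metis
  obtain A' p s where a: "p \<in> hom C A A'" "s \<in> hom C A' A" "p \<cdot> s = \<one> A'" "s \<cdot> p = i"
    using idempotent_splitting[OF i] by metis
  have o: "A \<in> Obj C" "B \<in> Obj C" "A' \<in> Obj C" "B' \<in> Obj C" "V \<in> Obj C"
    using a b g by (simp_all add: hom_iff)
  define e' where "e' = p' \<cdot> (e \<cdot> s)"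
  have e': "e' \<in> hom C A' B'" unfolding e'_def using a b e by (simp add: hom_iff)
  have ie: "i' \<cdot> e = s' \<cdot> (p' \<cdot> e)" using b e by (simp add: hom_iff flip: b(4))
  have "e' \<cdot> p = p' \<cdot> (e \<cdot> i)" unfolding e'_def using a b e by (simp add: hom_iff flip: a(4))
  also have "\<dots> = p' \<cdot> e" unfolding i'(2) ie using b e reassoc[OF b(3), of "p' \<cdot> e"] by (simp add: hom_iff)
  finally have ep: "e' \<cdot> p = p' \<cdot> e" .
  have "s' \<cdot> e' = i' \<cdot> (e \<cdot> s)" unfolding e'_def using a b e by (simp add: hom_iff flip: b(4))
  also have "\<dots> = e \<cdot> (i \<cdot> s)" using reassoc2[OF i'(2), of s] i i' a e by (simp add: hom_iff)
  also have "i \<cdot> s = s" using a by (simp add: hom_iff flip: a(4))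
  finally have se: "e \<cdot> s = s' \<cdot> e'" by simp
  \<comment> \<open>\<open>P\<close> is the pullback of the induced arrow \<open>e'\<close> and the
    retraction \<open>p'\<close>. The aim is that the comparison \<open>c\<close> from
    \<open>A\<close> covers \<open>P\<close>, that is, that its image \<open>m\<close> is all of
    \<open>P\<close>.\<close>
  obtain P a1 b1 where P: "a1 \<in> hom C P A'" "b1 \<in> hom C P B" "e' \<cdot> a1 = p' \<cdot> b1"
    "\<And>W u v. \<lbrakk>u \<in> hom C W A'; v \<in> hom C W B; e' \<cdot> u = p' \<cdot> v\<rbrakk> \<Longrightarrow> \<exists>h \<in> hom C W P. a1 \<cdot> h = u \<and> b1 \<cdot> h = v"
    "\<And>W h h'. \<lbrakk>h \<in> hom C W P; h' \<in> hom C W P; a1 \<cdot> h = a1 \<cdot> h'; b1 \<cdot> h = b1 \<cdot> h'\<rbrakk> \<Longrightarrow> h = h'"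
    by (rule pullbackE[OF e' b(1)]) blast
  obtain c where c: "c \<in> hom C A P" "a1 \<cdot> c = p" "b1 \<cdot> c = e" using P(4)[OF a(1) e(2) ep] by blast
  obtain I m n where mn: "n \<in> hom C A I" "is_regular_epi C n" "m \<in> hom C I P" "is_mono C m" "c = m \<cdot> n"
    by (rule image_factorisation[OF c(1)])
  have bm: "b1 \<cdot> m \<in> hom C I B" using P mn by (simp add: hom_iff)
  have "(b1 \<cdot> m) \<cdot> n = e" using c(3) mn P(2) by (simp add: hom_iff)
  then have bmr: "is_regular_epi C (b1 \<cdot> m)" using regular_epi_if_comp[OF bm mn(1)] e by simp
  have "\<exists>d \<in> hom C P I. m \<cdot> d = \<one> P"
  proof (rule split_if_onto_and_contains_kernel[OF P(2) mn(3,4) bmr])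
    fix W h assume h: "h \<in> hom C W P" "b1 \<cdot> h = \<zero> W B"
    have z: "e' \<cdot> (a1 \<cdot> h) = \<zero> W B'" using reassoc2[OF P(3), of h] h P e' b by (simp add: hom_iff)
    \<comment> \<open>Elements of the kernel of \<open>b1\<close> come from \<open>A\<close> through
      the section \<open>s\<close>: both sides have first component \<open>a1 h\<close>, and the
      second component of the left side is \<open>s' (e' (a1 h)) = 0\<close>.\<close>
    have "c \<cdot> (s \<cdot> (a1 \<cdot> h)) = h"
    proof (rule P(5)[of _ W])
      show "c \<cdot> (s \<cdot> (a1 \<cdot> h)) \<in> hom C W P" "h \<in> hom C W P" using c P a h by (simp_all add: hom_iff)
      show "a1 \<cdot> (c \<cdot> (s \<cdot> (a1 \<cdot> h))) = a1 \<cdot> h"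
        using reassoc[OF c(2), of "s \<cdot> (a1 \<cdot> h)"] reassoc[OF a(3), of "a1 \<cdot> h"] c(1) P(1) a(1,2) h(1)
        by (simp add: hom_iff)
      show "b1 \<cdot> (c \<cdot> (s \<cdot> (a1 \<cdot> h))) = b1 \<cdot> h"
        using reassoc[OF c(3), of "s \<cdot> (a1 \<cdot> h)"] reassoc2[OF se, of "a1 \<cdot> h"] c(1) P(1,2) a(1,2) b(2) h e e' z
        by (simp add: hom_iff)
    qed
    then have "m \<cdot> (n \<cdot> (s \<cdot> (a1 \<cdot> h))) = h" using mn P(1) a(2) h(1) by (simp add: hom_iff)
    moreover have "n \<cdot> (s \<cdot> (a1 \<cdot> h)) \<in> hom C W I" using mn P(1) a(2) h(1) by (simp add: hom_iff)
    ultimately show "\<exists>h' \<in> hom C W I. m \<cdot> h' = h" by blast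
  qed
  then obtain d where d: "d \<in> hom C P I" "m \<cdot> d = \<one> P" by blast
  have pg: "p' \<cdot> g = \<zero> V B'"
  proof -
    have "p' \<cdot> g = p' \<cdot> (i' \<cdot> g)" using b g reassoc[OF b(3), of "p' \<cdot> g"] by (simp add: hom_iff flip: b(4))
    then show ?thesis using g b by (simp add: hom_iff)
  qed
  \<comment> \<open>The element \<open>(0, g)\<close> of \<open>P\<close> is lifted to
    \<open>A\<close>; its zero component is what makes the lift die under \<open>p\<close>, hence
    under \<open>i\<close>.\<close>
  have "\<exists>h \<in> hom C V P. a1 \<cdot> h = \<zero> V A' \<and> b1 \<cdot> h = g"
    by (rule P(4)) (use g o e' pg in \<open>simp_all add: hom_iff\<close>)
  then obtain h where h: "h \<in> hom C V P" "a1 \<cdot> h = \<zero> V A'" "b1 \<cdot> h = g" by blast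
  have dh: "d \<cdot> h \<in> hom C V I" using d h by (simp add: hom_iff)
  obtain V' v g' where v: "is_regular_epi C v" "v \<in> hom C V' V" "g' \<in> hom C V' A" "n \<cdot> g' = (d \<cdot> h) \<cdot> v"
    by (rule regular_epi_cover[OF mn(2,1) dh])
  have "c \<cdot> g' = m \<cdot> (d \<cdot> (h \<cdot> v))" using mn v d h by (simp add: hom_iff)
  also have "\<dots> = h \<cdot> v" using reassoc[OF d(2), of "h \<cdot> v"] mn(3) d(1) h v by (simp add: hom_iff)
  finally have cg: "c \<cdot> g' = h \<cdot> v" .
  have "e \<cdot> g' = b1 \<cdot> (h \<cdot> v)" using reassoc[OF c(3), of g'] cg c(1) v(3) P(2) by (simp add: hom_iff)
  also have "\<dots> = g \<cdot> v" using reassoc[OF h(3), of v] h v P by (simp add: hom_iff)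
  finally have 1: "e \<cdot> g' = g \<cdot> v" .
  have "p \<cdot> g' = a1 \<cdot> (h \<cdot> v)" using reassoc[OF c(2), of g'] cg c(1) v(3) P(1) by (simp add: hom_iff)
  also have "\<dots> = \<zero> V' A'" using reassoc[OF h(2), of v] h(1) v(2) P(1) o by (simp add: hom_iff)
  finally have "i \<cdot> g' = \<zero> V' A" using a v(2,3) by (simp add: hom_iff flip: a(4))
  then show ?thesis using that v 1 by blast
qed

text \<open>The inclusion \<open>k'\<close> is treated as an element of \<open>B\<close>: its lift
  factors through \<open>K\<close>, so a cover of \<open>K'\<close> factors through
  \<open>e1\<close>.\<close>

lemma kernel_restriction_regular_epi:
  assumes e: "is_regular_epi C e" "e \<in> hom C A B"
    and i: "i \<in> hom C A A" "i \<cdot> i = i" and i': "i' \<in> hom C B B" "e \<cdot> i = i' \<cdot> e"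
    and k: "k \<in> hom C K A" "\<And>W g. \<lbrakk>g \<in> hom C W A; i \<cdot> g = \<zero> W A\<rbrakk> \<Longrightarrow> \<exists>h \<in> hom C W K. k \<cdot> h = g"
    and k': "k' \<in> hom C K' B" "is_mono C k'" "i' \<cdot> k' = \<zero> K' B"
    and e1: "e1 \<in> hom C K K'" "k' \<cdot> e1 = e \<cdot> k"
  shows "is_regular_epi C e1"
proof -
  obtain V' v g' where v: "is_regular_epi C v" "v \<in> hom C V' K'" "g' \<in> hom C V' A" "i \<cdot> g' = \<zero> V' A"
    "e \<cdot> g' = k' \<cdot> v"
    by (rule lift_to_kernel[OF e i i' k'(1,3)])
  obtain h where h: "h \<in> hom C V' K" "k \<cdot> h = g'" using k(2)[OF v(3,4)] by blast
  have "k' \<cdot> (e1 \<cdot> h) = k' \<cdot> v"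
    using reassoc2[OF e1(2), of h] h v(5) k k' e e1(1) by (simp add: hom_iff)
  then have "e1 \<cdot> h = v"
    by (rule is_monoD[OF k'(2,1), of _ V', rotated 2]) (use e1 h v in \<open>simp_all add: hom_iff\<close>)
  then show ?thesis using regular_epi_if_comp[OF e1(1) h(1)] v(1) by simp
qed

text \<open>Induction on the number of idempotents. Since they commute with the first one, the
  others restrict to its kernel, and the restriction of \<open>e\<close> to kernels is again regular
  epic; what remains is the same problem for a shorter list.\<close>

lemma lift_to_joint_kernel:
  assumes "is_regular_epi C e" "e \<in> hom C A B" "g \<in> hom C V B"
    and "\<And>i i'. (i, i') \<in> set L \<Longrightarrow> i \<in> hom C A A \<and> i' \<in> hom C B B \<and> i \<cdot> i = i \<and> e \<cdot> i = i' \<cdot> e \<and> i' \<cdot> g = \<zero> V B"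
    and "\<And>i i' j j'. \<lbrakk>(i, i') \<in> set L; (j, j') \<in> set L\<rbrakk> \<Longrightarrow> i \<cdot> j = j \<cdot> i"
  shows "\<exists>V' v g'. is_regular_epi C v \<and> v \<in> hom C V' V \<and> g' \<in> hom C V' A \<and> e \<cdot> g' = g \<cdot> v \<and>
    (\<forall>(i, i') \<in> set L. i \<cdot> g' = \<zero> V' A)"
  using assms
proof (induction "length L" arbitrary: L e A B g)
  case 0
  then have "set L = {}" by simp
  then show ?case using regular_epi_cover[OF 0(2-4)] by (metis empty_iff)
next
  case (Suc n M)
  then obtain ii L where M: "M = ii # L" "n = length L" by (cases M) auto
  note prems = Suc.prems[unfolded M(1)]
  note e = prems(1,2)
  obtain i i' where ii: "ii = (i, i')" by (cases ii)
  have i: "i \<in> hom C A A" "i' \<in> hom C B B" "i \<cdot> i = i" "e \<cdot> i = i' \<cdot> e" "i' \<cdot> g = \<zero> V B"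
    using prems(4)[of i i'] ii by auto
  obtain K k where k: "k \<in> hom C K A" "is_mono C k" "i \<cdot> k = \<zero> K A"
    "\<And>W g. \<lbrakk>g \<in> hom C W A; i \<cdot> g = \<zero> W A\<rbrakk> \<Longrightarrow> \<exists>h \<in> hom C W K. k \<cdot> h = g"
    by (rule kernelE[OF i(1)]) blast
  obtain K' k' where k': "k' \<in> hom C K' B" "is_mono C k'" "i' \<cdot> k' = \<zero> K' B"
    "\<And>W g. \<lbrakk>g \<in> hom C W B; i' \<cdot> g = \<zero> W B\<rbrakk> \<Longrightarrow> \<exists>h \<in> hom C W K'. k' \<cdot> h = g"
    by (rule kernelE[OF i(2)]) blast
  have "i' \<cdot> (e \<cdot> k) = \<zero> K B" using reassoc2[OF i(4), of k] e i(1,2) k(1,3) by (simp add: hom_iff)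
  moreover have ek: "e \<cdot> k \<in> hom C K B" using e k by (simp add: hom_iff)
  ultimately obtain e1 where e1: "e1 \<in> hom C K K'" "k' \<cdot> e1 = e \<cdot> k" using k'(4) by blast
  have e1r: "is_regular_epi C e1"
    by (rule kernel_restriction_regular_epi[OF e i(1,3,2,4) k(1,4) k'(1-3) e1])
  obtain g1 where g1: "g1 \<in> hom C V K'" "k' \<cdot> g1 = g" using k'(4)[OF prems(3) i(5)] by blast
  \<comment> \<open>Endomorphisms induced on the kernels \<open>K\<close> and \<open>K'\<close>.
    Making them functions of \<open>j\<close> lets the rest of the list be mapped to its
    restrictions.\<close>
  define R where "R j = (SOME r. r \<in> hom C K K \<and> k \<cdot> r = j \<cdot> k)" for j
  define R' where "R' j = (SOME r. r \<in> hom C K' K' \<and> k' \<cdot> r = j \<cdot> k')" for j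
  have RR: "j \<in> hom C A A \<and> j' \<in> hom C B B \<and> j \<cdot> j = j \<and> e \<cdot> j = j' \<cdot> e \<and> j' \<cdot> g = \<zero> V B \<and>
      R j \<in> hom C K K \<and> k \<cdot> R j = j \<cdot> k \<and> R' j' \<in> hom C K' K' \<and> k' \<cdot> R' j' = j' \<cdot> k'"
    if jj: "(j, j') \<in> set L" for j j'
  proof -
    have j: "j \<in> hom C A A" "j' \<in> hom C B B" "j \<cdot> j = j" "e \<cdot> j = j' \<cdot> e" "j' \<cdot> g = \<zero> V B"
      using prems(4)[of j j'] jj by auto
    have ij: "i \<cdot> j = j \<cdot> i" using prems(5)[of i i' j j'] ii jj by auto
    have "i \<cdot> (j \<cdot> k) = \<zero> K A" using reassoc2[OF ij, of k] i(1) j(1) k(1,3) by (simp add: hom_iff)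
    moreover have "j \<cdot> k \<in> hom C K A" using j k by (simp add: hom_iff)
    ultimately have "\<exists>r. r \<in> hom C K K \<and> k \<cdot> r = j \<cdot> k" using k(4) by blast
    then have 1: "R j \<in> hom C K K \<and> k \<cdot> R j = j \<cdot> k" unfolding R_def by (rule someI_ex)
    \<comment> \<open>Commutation is assumed on \<open>A\<close> only; it descends to
      \<open>B\<close> along the epimorphism \<open>e\<close>.\<close>
    have "(i' \<cdot> j') \<cdot> e = (j' \<cdot> i') \<cdot> e"
    proof -
      have "(i' \<cdot> j') \<cdot> e = i' \<cdot> (e \<cdot> j)" using e i(2) j by (simp add: hom_iff)
      also have "\<dots> = e \<cdot> (i \<cdot> j)" using reassoc2[OF i(4), of j] e i(1,2) j(1) by (simp add: hom_iff)
      also have "\<dots> = j' \<cdot> (e \<cdot> i)" unfolding ij using reassoc2[OF j(4), of i] e i(1) j(1,2) by (simp add: hom_iff)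
      also have "\<dots> = (j' \<cdot> i') \<cdot> e" unfolding i(4) using e i(2) j(2) by (simp add: hom_iff)
      finally show ?thesis .
    qed
    then have ij': "i' \<cdot> j' = j' \<cdot> i'"
      by (rule regular_epi_cancel[OF e, of _ B, rotated 2]) (use i j in \<open>simp_all add: hom_iff\<close>)
    have "i' \<cdot> (j' \<cdot> k') = \<zero> K' B" using reassoc2[OF ij', of k'] i(2) j(2) k'(1,3) by (simp add: hom_iff)
    moreover have "j' \<cdot> k' \<in> hom C K' B" using j k' by (simp add: hom_iff)
    ultimately have "\<exists>r. r \<in> hom C K' K' \<and> k' \<cdot> r = j' \<cdot> k'" using k'(4) by blast
    then have 2: "R' j' \<in> hom C K' K' \<and> k' \<cdot> R' j' = j' \<cdot> k'" unfolding R'_def by (rule someI_ex)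
    show ?thesis using 1 2 j by blast
  qed
  let ?L = "map (\<lambda>(j, j'). (R j, R' j')) L"
  have "\<exists>V' v g'. is_regular_epi C v \<and> v \<in> hom C V' V \<and> g' \<in> hom C V' K \<and> e1 \<cdot> g' = g1 \<cdot> v \<and>
    (\<forall>(i, i') \<in> set ?L. i \<cdot> g' = \<zero> V' K)"
  proof (rule Suc.hyps(1)[OF _ e1r e1(1) g1(1)])
    show "n = length ?L" using M by simp
    fix r r' assume "(r, r') \<in> set ?L"
    then obtain j j' where jj: "(j, j') \<in> set L" and r: "r = R j" "r' = R' j'" by auto
    from RR[OF jj] have j: "j \<in> hom C A A" "j' \<in> hom C B B" "j \<cdot> j = j" "e \<cdot> j = j' \<cdot> e" "j' \<cdot> g = \<zero> V B"
      "r \<in> hom C K K" "k \<cdot> r = j \<cdot> k" "r' \<in> hom C K' K'" "k' \<cdot> r' = j' \<cdot> k'" unfolding r by auto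
    have "k \<cdot> (r \<cdot> r) = k \<cdot> r"
      using reassoc2[OF j(7), of r] reassoc[OF j(3), of k] j(1,6,7) k(1) by (simp add: hom_iff)
    then have 1: "r \<cdot> r = r"
      by (rule is_monoD[OF k(2,1), of _ K, rotated 2]) (use j in \<open>simp_all add: hom_iff\<close>)
    have "k' \<cdot> (e1 \<cdot> r) = e \<cdot> (j \<cdot> k)"
      using reassoc2[OF e1(2), of r] e1(1) k(1) k'(1) e j(6,7) by (simp add: hom_iff)
    also have "\<dots> = j' \<cdot> (e \<cdot> k)" using reassoc2[OF j(4), of k] k(1) j(1,2) e by (simp add: hom_iff)
    also have "\<dots> = k' \<cdot> (r' \<cdot> e1)"
      using reassoc2[OF j(9), of e1] e1 k'(1) j(2,8) by (simp add: hom_iff)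
    finally have 2: "e1 \<cdot> r = r' \<cdot> e1"
      by (rule is_monoD[OF k'(2,1), of _ K, rotated 2]) (use j e1 in \<open>simp_all add: hom_iff\<close>)
    have "k' \<cdot> (r' \<cdot> g1) = k' \<cdot> \<zero> V K'"
      using reassoc2[OF j(9), of g1] g1 j(2,5,8) k'(1) prems(3) by (simp add: hom_iff)
    then have 3: "r' \<cdot> g1 = \<zero> V K'"
      by (rule is_monoD[OF k'(2,1), of _ V, rotated 2]) (use j g1 in \<open>simp_all add: hom_iff\<close>)
    show "r \<in> hom C K K \<and> r' \<in> hom C K' K' \<and> r \<cdot> r = r \<and> e1 \<cdot> r = r' \<cdot> e1 \<and> r' \<cdot> g1 = \<zero> V K'"
      using j 1 2 3 by blast
  next
    fix r r' s s' assume "(r, r') \<in> set ?L" "(s, s') \<in> set ?L"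
    then obtain j j' l l' where jj: "(j, j') \<in> set L" "r = R j" and ll: "(l, l') \<in> set L" "s = R l" by auto
    have j: "j \<in> hom C A A" "r \<in> hom C K K" "k \<cdot> r = j \<cdot> k" using RR[OF jj(1)] jj(2) by auto
    have l: "l \<in> hom C A A" "s \<in> hom C K K" "k \<cdot> s = l \<cdot> k" using RR[OF ll(1)] ll(2) by auto
    have jl: "j \<cdot> l = l \<cdot> j" using prems(5)[of j j' l l'] jj ll by auto
    have "k \<cdot> (r \<cdot> s) = k \<cdot> (s \<cdot> r)"
      using reassoc2[OF j(3), of s] reassoc2[OF l(3), of r] reassoc2[OF jl, of k] j l k(1) by (simp add: hom_iff)
    then show "r \<cdot> s = s \<cdot> r"
      by (rule is_monoD[OF k(2,1), of _ K, rotated 2]) (use j l in \<open>simp_all add: hom_iff\<close>)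
  qed
  then obtain V' v h where v: "is_regular_epi C v" "v \<in> hom C V' V" "h \<in> hom C V' K" "e1 \<cdot> h = g1 \<cdot> v"
    "\<And>i i'. (i, i') \<in> set ?L \<Longrightarrow> i \<cdot> h = \<zero> V' K" by blast
  have "e \<cdot> (k \<cdot> h) = g \<cdot> v"
    using reassoc2[OF e1(2), of h] reassoc[OF g1(2), of v] v(2-4) e k(1) k'(1) e1(1) g1(1) by (simp add: hom_iff)
  moreover have "j \<cdot> (k \<cdot> h) = \<zero> V' A" if "(j, j') \<in> set (ii # L)" for j j'
  proof (cases "(j, j') \<in> set L")
    case True
    then have "R j \<cdot> h = \<zero> V' K" by (intro v(5)[of _ "R' j'"]) force
    moreover have "k \<cdot> R j = j \<cdot> k" "R j \<in> hom C K K" "j \<in> hom C A A" using RR[OF True] by auto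
    ultimately show ?thesis using reassoc2[of k "R j" j k h] v(3) k(1) by (simp add: hom_iff)
  next
    case False
    then have "j = i" using that ii by auto
    then show ?thesis using reassoc[OF k(3), of h] v(3) k(1) i(1) by (simp add: hom_iff)
  qed
  ultimately show ?case unfolding M(1) using v(1-3) k(1)
    by (intro exI[of _ V'] exI[of _ v] exI[of _ "k \<cdot> h"]) (auto simp: comp_in_hom)
qed

section \<open>Reflexive graphs and cokernels\<close>

text \<open>
  Relations are difunctional: \<open>x R y\<close>, \<open>z R y\<close> and \<open>z R w\<close> imply \<open>x R w\<close>. The quadruples
  \<open>(x, y, z, w)\<close> form a pullback of split epimorphisms, which is generated by those with \<open>y = w\<close>
  together with those with \<open>x = z\<close>.
\<close>

lemma relation_difunctional:
  assumes r: "r \<in> hom C R X" and s: "s \<in> hom C R X"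
    and jm: "\<And>W u v. \<lbrakk>u \<in> hom C W R; v \<in> hom C W R; r \<cdot> u = r \<cdot> v; s \<cdot> u = s \<cdot> v\<rbrakk> \<Longrightarrow> u = v"
    and abc: "a \<in> hom C W R" "b \<in> hom C W R" "c \<in> hom C W R" "s \<cdot> a = s \<cdot> b" "r \<cdot> b = r \<cdot> c"
  shows "\<exists>h \<in> hom C W R. r \<cdot> h = r \<cdot> a \<and> s \<cdot> h = s \<cdot> c"
proof -
  have o: "R \<in> Obj C" "X \<in> Obj C" using r by (simp_all add: hom_iff)
  obtain A a1 a2 where A: "a1 \<in> hom C A R" "a2 \<in> hom C A R" "s \<cdot> a1 = s \<cdot> a2"
    "\<And>W u v. \<lbrakk>u \<in> hom C W R; v \<in> hom C W R; s \<cdot> u = s \<cdot> v\<rbrakk> \<Longrightarrow> \<exists>h \<in> hom C W A. a1 \<cdot> h = u \<and> a2 \<cdot> h = v"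
    by (rule pullbackE[OF s s]) blast
  obtain B b1 b2 where B: "b1 \<in> hom C B R" "b2 \<in> hom C B R" "r \<cdot> b1 = r \<cdot> b2"
    "\<And>W u v. \<lbrakk>u \<in> hom C W R; v \<in> hom C W R; r \<cdot> u = r \<cdot> v\<rbrakk> \<Longrightarrow> \<exists>h \<in> hom C W B. b1 \<cdot> h = u \<and> b2 \<cdot> h = v"
    by (rule pullbackE[OF r r]) blast
  obtain P m n where P: "m \<in> hom C P A" "n \<in> hom C P B" "a2 \<cdot> m = b1 \<cdot> n"
    "\<And>W u v. \<lbrakk>u \<in> hom C W A; v \<in> hom C W B; a2 \<cdot> u = b1 \<cdot> v\<rbrakk> \<Longrightarrow> \<exists>h \<in> hom C W P. m \<cdot> h = u \<and> n \<cdot> h = v"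
    by (rule pullbackE[OF A(2) B(1)]) blast
  have "\<exists>d \<in> hom C R B. b1 \<cdot> d = \<one> R \<and> b2 \<cdot> d = \<one> R"
    by (rule B(4)) (use o in \<open>simp_all add: hom_iff\<close>)
  then obtain d where d: "d \<in> hom C R B" "b1 \<cdot> d = \<one> R" "b2 \<cdot> d = \<one> R" by blast
  \<comment> \<open>The section repeats the last pair: from \<open>x R y\<close> and
    \<open>z R y\<close> it forms the quadruple with \<open>w = y\<close>.\<close>
  have "\<exists>t \<in> hom C A P. m \<cdot> t = \<one> A \<and> n \<cdot> t = d \<cdot> a2"
    by (rule P(4)) (use A(1,2) B(1,2) d reassoc[OF d(2), of a2] in \<open>simp_all add: hom_iff\<close>)
  then obtain t where t: "t \<in> hom C A P" "m \<cdot> t = \<one> A" "n \<cdot> t = d \<cdot> a2" by blast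
  let ?rs = "pairing C r s" and ?q = "pairing C (r \<cdot> (a1 \<cdot> m)) (s \<cdot> (b2 \<cdot> n))"
  have rs: "?rs \<in> hom C R (prod_obj C X X)" using r s o by (simp add: hom_iff)
  have q: "?q \<in> hom C P (prod_obj C X X)" using r s o A(1) B(2) P(1,2) by (simp add: hom_iff)
  have mono: "is_mono C ?rs"
  proof (rule is_monoI[OF rs])
    fix W u v assume u: "u \<in> hom C W R" "v \<in> hom C W R" "?rs \<cdot> u = ?rs \<cdot> v"
    have "proj1 C X X \<cdot> (?rs \<cdot> u) = proj1 C X X \<cdot> (?rs \<cdot> v)" "proj2 C X X \<cdot> (?rs \<cdot> u) = proj2 C X X \<cdot> (?rs \<cdot> v)"
      using u(3) by simp_all
    then show "u = v" by (intro jm[OF u(1,2)]) (use r s u(1,2) o in \<open>simp_all add: hom_iff\<close>)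
  qed
  \<comment> \<open>\<open>J\<close> is the subobject of those quadruples that satisfy
    \<open>x R w\<close>; the arrow \<open>?q\<close> picks \<open>(x, w)\<close>.\<close>
  obtain J k j where J: "k \<in> hom C J R" "j \<in> hom C J P" "?rs \<cdot> k = ?q \<cdot> j" "is_pullback C ?rs ?q k j"
    "\<And>W u v. \<lbrakk>u \<in> hom C W R; v \<in> hom C W P; ?rs \<cdot> u = ?q \<cdot> v\<rbrakk> \<Longrightarrow> \<exists>h \<in> hom C W J. k \<cdot> h = u \<and> j \<cdot> h = v"
    by (rule pullbackE[OF rs q]) blast
  have jmono: "is_mono C j" by (rule mono_pullback_stable[OF mono J(4) rs q J(1,2)])
  have lift: "\<exists>h \<in> hom C W J. k \<cdot> h = u \<and> j \<cdot> h = v"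
    if u: "u \<in> hom C W R" and v: "v \<in> hom C W P"
      and eq: "r \<cdot> u = r \<cdot> (a1 \<cdot> (m \<cdot> v))" "s \<cdot> u = s \<cdot> (b2 \<cdot> (n \<cdot> v))" for W u v
  proof (rule J(5)[OF u v])
    show "?rs \<cdot> u = ?q \<cdot> v"
      by (rule prod_eqI[of X X _ W]) (use u v eq r s o A(1) B(2) P(1,2) in \<open>simp_all add: hom_iff\<close>)
  qed
  have "\<exists>h \<in> hom C A J. k \<cdot> h = a1 \<and> j \<cdot> h = t"
    by (rule lift) (use A B(1,2) P(1,2) t d(1) reassoc[OF d(3), of a2] in \<open>simp_all add: hom_iff\<close>)
  then obtain l where l: "l \<in> hom C A J" "j \<cdot> l = t" by blast
  have "\<exists>i \<in> hom C P J. j \<cdot> i = \<one> P"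
  proof (rule point_generation[OF P(1) t(1,2) J(2) jmono l])
    \<comment> \<open>Here \<open>a1\<close> and \<open>a2\<close> vanish, so \<open>x\<close>,
      \<open>y\<close> and \<open>z\<close> are zero, and \<open>x R w\<close> is witnessed by the
      pair \<open>b2\<close>, which relates \<open>z\<close> to \<open>w\<close>.\<close>
    fix W g assume g: "g \<in> hom C W P" "m \<cdot> g = \<zero> W A"
    have 1: "b1 \<cdot> (n \<cdot> g) = \<zero> W R" using reassoc2[OF P(3), of g] g A(1,2) B(1) P(1,2) by (simp add: hom_iff)
    have 2: "r \<cdot> (b2 \<cdot> (n \<cdot> g)) = \<zero> W X"
      using reassoc2[OF B(3), of "n \<cdot> g"] 1 g(1) B(1,2) P(2) r by (simp add: hom_iff)
    have "\<exists>h \<in> hom C W J. k \<cdot> h = b2 \<cdot> (n \<cdot> g) \<and> j \<cdot> h = g"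
      by (rule lift) (use 2 g A(1) B(2) P(2) r o in \<open>simp_all add: hom_iff\<close>)
    then show "\<exists>h \<in> hom C W J. j \<cdot> h = g" by blast
  qed
  then obtain i where i: "i \<in> hom C P J" "j \<cdot> i = \<one> P" by blast
  \<comment> \<open>The given elements \<open>a\<close>, \<open>b\<close>, \<open>c\<close> assemble
    to an element \<open>w\<close> of \<open>P\<close>, which the splitting \<open>i\<close> moves
    into \<open>J\<close>.\<close>
  obtain u where u: "u \<in> hom C W A" "a1 \<cdot> u = a" "a2 \<cdot> u = b" using A(4)[OF abc(1,2,4)] by blast
  obtain v where v: "v \<in> hom C W B" "b1 \<cdot> v = b" "b2 \<cdot> v = c" using B(4)[OF abc(2,3,5)] by blast
  obtain w where w: "w \<in> hom C W P" "m \<cdot> w = u" "n \<cdot> w = v" using P(4)[OF u(1) v(1)] u(3) v(2) by metis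
  have jiw: "j \<cdot> (i \<cdot> w) = w" using reassoc[OF i(2), of w] i(1) w(1) J(2) by (simp add: hom_iff)
  define h where "h = k \<cdot> (i \<cdot> w)"
  have h: "h \<in> hom C W R" unfolding h_def using J(1) i(1) w(1) by (simp add: hom_iff)
  have iw: "i \<cdot> w \<in> hom C W J" using i w by (simp add: hom_iff)
  have "?rs \<cdot> h = ?q \<cdot> w"
    unfolding h_def using reassoc2[OF J(3), of "i \<cdot> w"] jiw iw rs q J(1,2) by (simp add: hom_iff)
  then have "proj1 C X X \<cdot> (?rs \<cdot> h) = proj1 C X X \<cdot> (?q \<cdot> w)" "proj2 C X X \<cdot> (?rs \<cdot> h) = proj2 C X X \<cdot> (?q \<cdot> w)"
    by simp_all
  then have "r \<cdot> h = r \<cdot> (a1 \<cdot> (m \<cdot> w))" "s \<cdot> h = s \<cdot> (b2 \<cdot> (n \<cdot> w))"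
    using h w(1) r s o A(1) B(2) P(1,2) by (simp_all add: hom_iff)
  then show ?thesis using h unfolding w u(2) v(3) by blast
qed

text \<open>Symmetry is difunctionality applied to \<open>y R y\<close>, \<open>x R y\<close>,
  \<open>x R x\<close>; transitivity is difunctionality applied to \<open>x R y\<close>,
  \<open>y R y\<close>, \<open>y R z\<close>. Reflexivity supplies the pairs with equal
  entries.\<close>

lemma reflexive_relation_equiv:
  assumes r: "r \<in> hom C R X" and s: "s \<in> hom C R X"
    and jm: "\<And>W u v. \<lbrakk>u \<in> hom C W R; v \<in> hom C W R; r \<cdot> u = r \<cdot> v; s \<cdot> u = s \<cdot> v\<rbrakk> \<Longrightarrow> u = v"
    and d: "d \<in> hom C X R" "r \<cdot> d = \<one> X" "s \<cdot> d = \<one> X"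
  shows "is_internal_equiv C X r s"
proof -
  have o: "R \<in> Obj C" "X \<in> Obj C" and D: "Dom C r = R" using r by (simp_all add: hom_iff)
  have "\<exists>t \<in> hom C R R. r \<cdot> t = r \<cdot> (d \<cdot> s) \<and> s \<cdot> t = s \<cdot> (d \<cdot> r)"
    by (rule relation_difunctional[OF r s, where b = "\<one> R"], erule (3) jm)
      (use r s d(1) o reassoc[OF d(2)] reassoc[OF d(3)] in \<open>simp_all add: hom_iff\<close>)
  then have t: "\<exists>t \<in> hom C R R. r \<cdot> t = s \<and> s \<cdot> t = r"
    using r s d(1) reassoc[OF d(2), of s] reassoc[OF d(3), of r] by (simp add: hom_iff)
  have tr: "\<exists>c \<in> hom C (Dom C p) R. r \<cdot> c = r \<cdot> p \<and> s \<cdot> c = s \<cdot> q" if pb: "is_pullback C s r p q" for p q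
  proof -
    have pq: "p \<in> hom C (Dom C p) R" "q \<in> hom C (Dom C p) R" "s \<cdot> p = r \<cdot> q"
      using pb r s unfolding is_pullback_def by (simp_all add: hom_def)
    show ?thesis
      by (rule relation_difunctional[OF r s, where b = "d \<cdot> (s \<cdot> p)"], erule (3) jm)
        (use r s d(1) o pq reassoc[OF d(2), of "s \<cdot> p"] reassoc[OF d(3), of "s \<cdot> p"] in \<open>simp_all add: hom_iff\<close>)
  qed
  show ?thesis
    unfolding is_internal_equiv_def D using r s jm d t tr by blast
qed

text \<open>
  The image of a reflexive graph is an effective equivalence relation, so that its coequaliser exists
  and the kernel of the coequaliser is the direct image of the kernel of one leg along the other.
\<close>

lemma reflexive_coequaliser:
  assumes c: "c \<in> hom C P B" and d: "d \<in> hom C P B" and s: "s \<in> hom C B P"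
    and ds: "d \<cdot> s = \<one> B" and cs: "c \<cdot> s = \<one> B"
  obtains Q q where "q \<in> hom C B Q" "is_regular_epi C q" "q \<cdot> d = q \<cdot> c"
    "\<And>W g. \<lbrakk>g \<in> hom C B W; g \<cdot> d = g \<cdot> c\<rbrakk> \<Longrightarrow> \<exists>u \<in> hom C Q W. u \<cdot> q = g"
    "\<And>V g. \<lbrakk>g \<in> hom C V B; q \<cdot> g = \<zero> V Q\<rbrakk> \<Longrightarrow>
      \<exists>V' v g'. is_regular_epi C v \<and> v \<in> hom C V' V \<and> g' \<in> hom C V' P \<and> d \<cdot> g' = \<zero> V' B \<and> c \<cdot> g' = g \<cdot> v"
proof -
  have o: "B \<in> Obj C" using c by (simp add: hom_iff)
  have dc: "pairing C d c \<in> hom C P (prod_obj C B B)" using c d o by (simp add: hom_iff)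
  obtain R m e where m: "e \<in> hom C P R" "is_regular_epi C e" "m \<in> hom C R (prod_obj C B B)" "is_mono C m"
    "pairing C d c = m \<cdot> e"
    by (rule image_factorisation[OF dc])
  define r t where "r = proj1 C B B \<cdot> m" and "t = proj2 C B B \<cdot> m"
  have rt: "r \<in> hom C R B" "t \<in> hom C R B" unfolding r_def t_def using m o by (simp_all add: hom_iff)
  have "proj1 C B B \<cdot> (m \<cdot> e) = d" "proj2 C B B \<cdot> (m \<cdot> e) = c"
    using c d o by (simp_all add: hom_iff flip: m(5))
  then have rte: "r \<cdot> e = d" "t \<cdot> e = c" unfolding r_def t_def using m(1,3) o by (simp_all add: hom_iff)
  have jm: "u = v" if u: "u \<in> hom C W R" "v \<in> hom C W R" and eq: "r \<cdot> u = r \<cdot> v" "t \<cdot> u = t \<cdot> v" for W u v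
  proof -
    have "m \<cdot> u = m \<cdot> v"
      by (rule prod_eqI[of B B _ W]) (use u eq m(3) o in \<open>simp_all add: hom_iff r_def t_def\<close>)
    then show ?thesis by (rule is_monoD[OF m(4,3) u])
  qed
  \<comment> \<open>The common section \<open>s\<close> of the graph yields the diagonal
    \<open>e \<cdot> s\<close> of its image.\<close>
  have "is_internal_equiv C B r t"
    by (rule reflexive_relation_equiv[OF rt, where d = "e \<cdot> s"], erule (3) jm)
      (use m(1) s ds cs reassoc[OF rte(1), of s] reassoc[OF rte(2), of s] rt in \<open>simp_all add: hom_iff\<close>)
  then obtain f where f: "is_kernel_pair C f r t" using equiv_effective by blast
  then have f': "f \<in> hom C B (Cod C f)" "f \<cdot> r = f \<cdot> t"
    using rt unfolding is_kernel_pair_def is_pullback_def by (simp_all add: hom_iff)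
  obtain q where q: "is_coequaliser C r t q" using kernel_pairs_have_coequalisers[OF f] by blast
  then have q': "q \<in> hom C B (Cod C q)" "q \<cdot> r = q \<cdot> t" "is_regular_epi C q"
    using rt unfolding is_coequaliser_def is_regular_epi_def by (auto simp: hom_def)
  obtain u where u: "u \<in> hom C (Cod C q) (Cod C f)" "u \<cdot> q = f"
    using is_coequaliser_factor[OF q q'(1) f'] by blast
  show ?thesis
  proof (rule that[OF q'(1,3)])
    show "q \<cdot> d = q \<cdot> c" using reassoc2[OF q'(2), of e] q'(1) rt m(1) rte by (simp add: hom_iff)
  next
    fix W g assume g: "g \<in> hom C B W" "g \<cdot> d = g \<cdot> c"
    have "(g \<cdot> r) \<cdot> e = (g \<cdot> t) \<cdot> e" using g rt m(1) rte by (simp add: hom_iff)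
    then have "g \<cdot> r = g \<cdot> t"
      by (rule regular_epi_cancel[OF m(2,1), of _ W, rotated 2]) (use g rt in \<open>simp_all add: hom_iff\<close>)
    then show "\<exists>u \<in> hom C (Cod C q) W. u \<cdot> q = g" using is_coequaliser_factor[OF q q'(1) g(1)] by blast
  next
    fix V g assume g: "g \<in> hom C V B" "q \<cdot> g = \<zero> V (Cod C q)"
    \<comment> \<open>As \<open>f\<close> factors through \<open>q\<close>, it kills
      \<open>g\<close> too. Since \<open>r\<close>, \<open>t\<close> is the kernel pair of
      \<open>f\<close>, the pair \<open>(0, g)\<close> is an element of \<open>R\<close>, and on a
      cover it comes from \<open>P\<close>.\<close>
    have "f \<cdot> g = \<zero> V (Cod C f)" using reassoc[OF u(2), of g] g u(1) q'(1) by (simp add: hom_iff)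
    moreover have z: "\<zero> V B \<in> hom C V (Dom C f)" "g \<in> hom C V (Dom C f)" using g o f' by (simp_all add: hom_iff)
    ultimately have "f \<cdot> \<zero> V B = f \<cdot> g" using f' by (simp add: hom_iff)
    then obtain h where h: "h \<in> hom C V R" "r \<cdot> h = \<zero> V B" "t \<cdot> h = g"
      using is_pullback_lift[OF f[unfolded is_kernel_pair_def] z] rt by (auto simp: hom_def)
    obtain V' v g' where v: "is_regular_epi C v" "v \<in> hom C V' V" "g' \<in> hom C V' P" "e \<cdot> g' = h \<cdot> v"
      by (rule regular_epi_cover[OF m(2,1) h(1)])
    have "d \<cdot> g' = r \<cdot> (h \<cdot> v)" "c \<cdot> g' = t \<cdot> (h \<cdot> v)"
      using reassoc[OF rte(1), of g'] reassoc[OF rte(2), of g'] rt m(1) v(3,4) by (simp_all add: hom_iff)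
    then have "d \<cdot> g' = \<zero> V' B" "c \<cdot> g' = g \<cdot> v"
      using reassoc[OF h(2), of v] reassoc[OF h(3), of v] h(1) v(2) rt o by (simp_all add: hom_iff)
    then show "\<exists>V' v g'. is_regular_epi C v \<and> v \<in> hom C V' V \<and> g' \<in> hom C V' P \<and> d \<cdot> g' = \<zero> V' B \<and> c \<cdot> g' = g \<cdot> v"
      using v by blast
  qed
qed

section \<open>Cokernels\<close>

lemma cokernel_iff:
  assumes k: "k \<in> hom C K B" and f: "f \<in> hom C B A"
  shows "is_cokernel C f k \<longleftrightarrow> f \<cdot> k = \<zero> K A \<and>
    (\<forall>W. \<forall>g \<in> hom C B W. g \<cdot> k = \<zero> K W \<longrightarrow> (\<exists>!h. h \<in> hom C A W \<and> h \<cdot> f = g))"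
proof -
  have zk: "is_zero_arrow C (g \<cdot> k) \<longleftrightarrow> g \<cdot> k = \<zero> K W" if "g \<in> hom C B W" for g W
    by (rule is_zero_arrow_iff) (use that k in \<open>simp add: hom_iff\<close>)
  have "Cod C k = B" "Cod C f = A" "k \<in> Arr C" using assms by (simp_all add: hom_iff)
  then show ?thesis unfolding is_cokernel_def using f zk by auto
qed

lemma cokernel_regular_epi:
  assumes k: "k \<in> hom C K B" and f: "f \<in> hom C B A" and c: "is_cokernel C f k"
  shows "is_regular_epi C f"
proof -
  have "is_coequaliser C k (\<zero> K B) f" unfolding is_coequaliser_def
  proof (intro conjI allI ballI impI)
    show "k \<in> Arr C" "\<zero> K B \<in> hom C (Dom C k) (Cod C k)" "f \<in> hom C (Cod C k) (Cod C f)"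
      "f \<cdot> k = f \<cdot> \<zero> K B"
      using k f c cokernel_iff[OF k f] by (simp_all add: hom_iff)
    fix W g assume "g \<in> hom C (Cod C k) W" "g \<cdot> k = g \<cdot> \<zero> K B"
    then show "\<exists>!h. h \<in> hom C (Cod C f) W \<and> h \<cdot> f = g"
      using c[unfolded cokernel_iff[OF k f]] k f by (simp add: hom_iff)
  qed
  then show ?thesis unfolding is_regular_epi_def by blast
qed

text \<open>An arrow out of \<open>B\<close> kills \<open>k\<close> exactly when it coequalises
  \<open>[0, 1]\<close> and \<open>[k, 1]\<close> from \<open>K + B\<close>. This pair has the
  second inclusion as common section, so exactness provides its coequaliser.\<close>

lemma cokernel_exists:
  assumes k: "k \<in> hom C K B"
  shows "\<exists>f. is_cokernel C f k"
proof -
  have o: "K \<in> Obj C" "B \<in> Obj C" using k by (simp_all add: hom_iff)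
  let ?d = "copairing C (\<zero> K B) (\<one> B)" and ?c = "copairing C k (\<one> B)"
  have h: "?c \<in> hom C (coprod_obj C K B) B" "?d \<in> hom C (coprod_obj C K B) B" "inj2 C K B \<in> hom C B (coprod_obj C K B)"
    "?d \<cdot> inj2 C K B = \<one> B" "?c \<cdot> inj2 C K B = \<one> B"
    using k o by (simp_all add: hom_iff)
  obtain Q q where q: "q \<in> hom C B Q" "is_regular_epi C q" "q \<cdot> ?d = q \<cdot> ?c"
    "\<And>W g. \<lbrakk>g \<in> hom C B W; g \<cdot> ?d = g \<cdot> ?c\<rbrakk> \<Longrightarrow> \<exists>u \<in> hom C Q W. u \<cdot> q = g"
    by (rule reflexive_coequaliser[OF h]) blast
  have "(q \<cdot> ?d) \<cdot> inj1 C K B = (q \<cdot> ?c) \<cdot> inj1 C K B" by (simp only: q(3))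
  then have 1: "q \<cdot> k = \<zero> K Q" using k o q(1) by (simp add: hom_iff)
  have "\<exists>!h. h \<in> hom C Q W \<and> h \<cdot> q = g" if g: "g \<in> hom C B W" "g \<cdot> k = \<zero> K W" for W g
  proof -
    have "g \<cdot> ?d = g \<cdot> ?c"
      by (rule coprod_eqI[of K B _ W]) (use g k o in \<open>simp_all add: hom_iff\<close>)
    then obtain u where "u \<in> hom C Q W" "u \<cdot> q = g" using q(4) g by blast
    then show ?thesis using regular_epi_cancel[OF q(2,1)] by (intro ex1I[of _ u]) auto
  qed
  then show ?thesis using 1 cokernel_iff[OF k q(1)] by blast
qed

end

section \<open>Ternary sums\<close>

context cosmash_category
begin

lemma
  assumes "f \<in> hom C A A'" "g \<in> hom C B B'"
  shows coprod_map_hom: "coprod_map C f g \<in> hom C (coprod_obj C A B) (coprod_obj C A' B')"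
    and coprod_map_inj1: "coprod_map C f g \<cdot> inj1 C A B = inj1 C A' B' \<cdot> f"
    and coprod_map_inj2: "coprod_map C f g \<cdot> inj2 C A B = inj2 C A' B' \<cdot> g"
  unfolding coprod_map_def using assms by (simp_all add: hom_iff)

lemma zero_obj_iff:
  assumes "M \<in> Obj C"
  shows "is_zero_obj C M \<longleftrightarrow> \<one> M = \<zero> M M"
proof
  assume "is_zero_obj C M"
  then show "\<one> M = \<zero> M M"
    using assms by (intro initial_eq[of M _ M]) (simp_all add: is_zero_obj_def hom_iff)
next
  assume M: "\<one> M = \<zero> M M"
  have "f = \<zero> M X" if "f \<in> hom C M X" for f X
    using arg_cong[OF M, of "\<lambda>x. f \<cdot> x"] that by (simp add: hom_iff)
  moreover have "f = \<zero> X M" if "f \<in> hom C X M" for f X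
    using arg_cong[OF M, of "\<lambda>x. x \<cdot> f"] that by (simp add: hom_iff)
  moreover have "\<zero> M X \<in> hom C M X" "\<zero> X M \<in> hom C X M" if "X \<in> Obj C" for X
    using that assms by (simp_all add: hom_iff)
  ultimately show "is_zero_obj C M"
    using assms unfolding is_zero_obj_def is_initial_def is_terminal_def by metis
qed

section \<open>Idempotents that kill one summand\<close>

abbreviation sum3 where "sum3 A B D \<equiv> coprod_obj C (coprod_obj C A B) D"

lemma sum3_eqI:
  assumes "u \<in> hom C (sum3 A B D) W" "v \<in> hom C (sum3 A B D) W"
    and "A \<in> Obj C" "B \<in> Obj C" "D \<in> Obj C"
    and "u \<cdot> (inj1 C (coprod_obj C A B) D \<cdot> inj1 C A B) = v \<cdot> (inj1 C (coprod_obj C A B) D \<cdot> inj1 C A B)"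
    and "u \<cdot> (inj1 C (coprod_obj C A B) D \<cdot> inj2 C A B) = v \<cdot> (inj1 C (coprod_obj C A B) D \<cdot> inj2 C A B)"
    and "u \<cdot> inj2 C (coprod_obj C A B) D = v \<cdot> inj2 C (coprod_obj C A B) D"
  shows "u = v"
proof (rule coprod_eqI[OF _ assms(5,1,2) _ assms(8)])
  show "coprod_obj C A B \<in> Obj C" using assms by simp
  show "u \<cdot> inj1 C (coprod_obj C A B) D = v \<cdot> inj1 C (coprod_obj C A B) D"
    by (rule coprod_eqI[of A B _ W]) (use assms in \<open>simp_all add: hom_iff\<close>)
qed

text \<open>Endomorphisms of the sum take the place of the components of the comparison arrow, which
  land in binary sums: elements of kernels can be lifted along regular epimorphisms when these are
  kernels of commuting idempotents.\<close>

definition kill1 where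
  "kill1 A B D = copairing C (copairing C (\<zero> A (sum3 A B D)) (inj1 C (coprod_obj C A B) D \<cdot> inj2 C A B))
     (inj2 C (coprod_obj C A B) D)"

definition kill2 where
  "kill2 A B D = copairing C (copairing C (inj1 C (coprod_obj C A B) D \<cdot> inj1 C A B) (\<zero> B (sum3 A B D)))
     (inj2 C (coprod_obj C A B) D)"

definition kill3 where
  "kill3 A B D = copairing C (copairing C (inj1 C (coprod_obj C A B) D \<cdot> inj1 C A B)
     (inj1 C (coprod_obj C A B) D \<cdot> inj2 C A B)) (\<zero> D (sum3 A B D))"

lemmas kill_defs = kill1_def kill2_def kill3_def

lemma
  assumes "A \<in> Obj C" "B \<in> Obj C" "D \<in> Obj C"
  shows kill_hom: "kill1 A B D \<in> hom C (sum3 A B D) (sum3 A B D)"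
      "kill2 A B D \<in> hom C (sum3 A B D) (sum3 A B D)" "kill3 A B D \<in> hom C (sum3 A B D) (sum3 A B D)"
    and kill_idem: "kill1 A B D \<cdot> kill1 A B D = kill1 A B D" "kill2 A B D \<cdot> kill2 A B D = kill2 A B D"
      "kill3 A B D \<cdot> kill3 A B D = kill3 A B D"
    and kill_commute: "kill1 A B D \<cdot> kill2 A B D = kill2 A B D \<cdot> kill1 A B D"
      "kill1 A B D \<cdot> kill3 A B D = kill3 A B D \<cdot> kill1 A B D"
      "kill2 A B D \<cdot> kill3 A B D = kill3 A B D \<cdot> kill2 A B D"
proof -
  show h: "kill1 A B D \<in> hom C (sum3 A B D) (sum3 A B D)"
      "kill2 A B D \<in> hom C (sum3 A B D) (sum3 A B D)" "kill3 A B D \<in> hom C (sum3 A B D) (sum3 A B D)"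
    using assms by (simp_all add: kill_defs hom_iff)
  show "kill1 A B D \<cdot> kill1 A B D = kill1 A B D"
    by (rule sum3_eqI[OF _ h(1) assms]) (use assms in \<open>simp_all add: kill_defs hom_iff\<close>)
  show "kill2 A B D \<cdot> kill2 A B D = kill2 A B D"
    by (rule sum3_eqI[OF _ h(2) assms]) (use assms in \<open>simp_all add: kill_defs hom_iff\<close>)
  show "kill3 A B D \<cdot> kill3 A B D = kill3 A B D"
    by (rule sum3_eqI[OF _ h(3) assms]) (use assms in \<open>simp_all add: kill_defs hom_iff\<close>)
  show "kill1 A B D \<cdot> kill2 A B D = kill2 A B D \<cdot> kill1 A B D"
    by (rule sum3_eqI[OF _ _ assms, of _ "sum3 A B D"]) (use assms in \<open>simp_all add: kill_defs hom_iff\<close>)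
  show "kill1 A B D \<cdot> kill3 A B D = kill3 A B D \<cdot> kill1 A B D"
    by (rule sum3_eqI[OF _ _ assms, of _ "sum3 A B D"]) (use assms in \<open>simp_all add: kill_defs hom_iff\<close>)
  show "kill2 A B D \<cdot> kill3 A B D = kill3 A B D \<cdot> kill2 A B D"
    by (rule sum3_eqI[OF _ _ assms, of _ "sum3 A B D"]) (use assms in \<open>simp_all add: kill_defs hom_iff\<close>)
qed

text \<open>Values on the three inclusions, for use where the definitions of the idempotents should
  stay folded.\<close>

lemma kill_in:
  assumes "A \<in> Obj C" "B \<in> Obj C" "D \<in> Obj C"
  defines "i \<equiv> inj1 C (coprod_obj C A B) D \<cdot> inj1 C A B"
    and "j \<equiv> inj1 C (coprod_obj C A B) D \<cdot> inj2 C A B"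
    and "k \<equiv> inj2 C (coprod_obj C A B) D"
  shows "kill1 A B D \<cdot> i = \<zero> A (sum3 A B D)" "kill1 A B D \<cdot> j = j" "kill1 A B D \<cdot> k = k"
    "kill2 A B D \<cdot> i = i" "kill2 A B D \<cdot> j = \<zero> B (sum3 A B D)" "kill2 A B D \<cdot> k = k"
    "kill3 A B D \<cdot> i = i" "kill3 A B D \<cdot> j = j" "kill3 A B D \<cdot> k = \<zero> D (sum3 A B D)"
  unfolding i_def j_def k_def using assms(1-3) by (simp_all add: kill_defs)

text \<open>Generalised elements of the ternary cosmash product.\<close>

definition cross_effect where
  "cross_effect A B D V g \<longleftrightarrow> g \<in> hom C V (sum3 A B D) \<and>
     kill1 A B D \<cdot> g = \<zero> V (sum3 A B D) \<and> kill2 A B D \<cdot> g = \<zero> V (sum3 A B D) \<and>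
     kill3 A B D \<cdot> g = \<zero> V (sum3 A B D)"

lemma cosmash3_comparison_hom:
  assumes "A \<in> Obj C" "B \<in> Obj C" "D \<in> Obj C"
  shows "cosmash3_comparison C A B D \<in> hom C (sum3 A B D)
    (prod_obj C (prod_obj C (coprod_obj C A B) (coprod_obj C A D)) (coprod_obj C B D))"
  using assms unfolding cosmash3_comparison_def by (simp add: hom_iff)

text \<open>Each of \<open>q\<close> and \<open>e\<close> is the other one followed or preceded by
  something: \<open>e = i \<cdot> q\<close> shows one direction and \<open>q = q \<cdot> e\<close>
  the other.\<close>

lemma killed_iff:
  assumes "q \<in> hom C S T" "i \<in> hom C T S" "e \<in> hom C S S" "i \<cdot> q = e" "q \<cdot> e = q" "g \<in> hom C V S"
  shows "q \<cdot> g = \<zero> V T \<longleftrightarrow> e \<cdot> g = \<zero> V S"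
  using assms(1-3,6) reassoc[OF assms(4), of g] reassoc[OF assms(5), of g] by (auto simp: hom_iff)

text \<open>Each component of the comparison, followed by the evident inclusion of a binary sum into
  the ternary one, is one of the three idempotents, and both kill the same elements.\<close>

lemma cross_effect_iff:
  assumes o: "A \<in> Obj C" "B \<in> Obj C" "D \<in> Obj C" and g: "g \<in> hom C V (sum3 A B D)"
  shows "cross_effect A B D V g \<longleftrightarrow> cosmash3_comparison C A B D \<cdot> g =
    \<zero> V (prod_obj C (prod_obj C (coprod_obj C A B) (coprod_obj C A D)) (coprod_obj C B D))"
proof -
  let ?S = "sum3 A B D"
  let ?c12 = "copairing C (copairing C (inj1 C A B) (inj2 C A B)) (\<zero> D (coprod_obj C A B))"
  let ?c13 = "copairing C (copairing C (inj1 C A D) (\<zero> B (coprod_obj C A D))) (inj2 C A D)"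
  let ?c23 = "copairing C (copairing C (\<zero> A (coprod_obj C B D)) (inj1 C B D)) (inj2 C B D)"
  let ?AB = "coprod_obj C A B" and ?AD = "coprod_obj C A D" and ?BD = "coprod_obj C B D"
  have V: "V \<in> Obj C" using g by (simp add: hom_iff)
  note k = kill_hom[OF o]
  have c: "?c12 \<in> hom C ?S ?AB" "?c13 \<in> hom C ?S ?AD" "?c23 \<in> hom C ?S ?BD"
    using o by (simp_all add: hom_iff)
  have "?c12 \<cdot> g = \<zero> V ?AB \<longleftrightarrow> kill3 A B D \<cdot> g = \<zero> V ?S"
  proof (rule killed_iff[OF c(1) _ k(3) _ _ g])
    show i: "inj1 C ?AB D \<in> hom C ?AB ?S" using o by (simp add: hom_iff)
    show "inj1 C ?AB D \<cdot> ?c12 = kill3 A B D"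
      by (rule sum3_eqI[OF comp_in_hom[OF c(1) i] k(3) o]) (use o in \<open>simp_all add: kill_defs\<close>)
    show "?c12 \<cdot> kill3 A B D = ?c12"
      by (rule sum3_eqI[OF comp_in_hom[OF k(3) c(1)] c(1) o]) (use o in \<open>simp_all add: kill_defs\<close>)
  qed
  moreover have "?c13 \<cdot> g = \<zero> V ?AD \<longleftrightarrow> kill2 A B D \<cdot> g = \<zero> V ?S"
  proof (rule killed_iff[OF c(2) _ k(2) _ _ g])
    let ?i = "copairing C (inj1 C ?AB D \<cdot> inj1 C A B) (inj2 C ?AB D)"
    show i: "?i \<in> hom C ?AD ?S" using o by (simp add: hom_iff)
    show "?i \<cdot> ?c13 = kill2 A B D"
      by (rule sum3_eqI[OF comp_in_hom[OF c(2) i] k(2) o]) (use o in \<open>simp_all add: kill_defs\<close>)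
    show "?c13 \<cdot> kill2 A B D = ?c13"
      by (rule sum3_eqI[OF comp_in_hom[OF k(2) c(2)] c(2) o]) (use o in \<open>simp_all add: kill_defs\<close>)
  qed
  moreover have "?c23 \<cdot> g = \<zero> V ?BD \<longleftrightarrow> kill1 A B D \<cdot> g = \<zero> V ?S"
  proof (rule killed_iff[OF c(3) _ k(1) _ _ g])
    let ?i = "copairing C (inj1 C ?AB D \<cdot> inj2 C A B) (inj2 C ?AB D)"
    show i: "?i \<in> hom C ?BD ?S" using o by (simp add: hom_iff)
    show "?i \<cdot> ?c23 = kill1 A B D"
      by (rule sum3_eqI[OF comp_in_hom[OF c(3) i] k(1) o]) (use o in \<open>simp_all add: kill_defs\<close>)
    show "?c23 \<cdot> kill1 A B D = ?c23"
      by (rule sum3_eqI[OF comp_in_hom[OF k(1) c(3)] c(3) o]) (use o in \<open>simp_all add: kill_defs\<close>)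
  qed
  moreover have "cosmash3_comparison C A B D \<cdot> g = \<zero> V (prod_obj C (prod_obj C ?AB ?AD) ?BD) \<longleftrightarrow>
    ?c12 \<cdot> g = \<zero> V ?AB \<and> ?c13 \<cdot> g = \<zero> V ?AD \<and> ?c23 \<cdot> g = \<zero> V ?BD" (is "?L \<longleftrightarrow> ?R")
  proof
    assume l: ?L
    have "proj1 C ?AB ?AD \<cdot> (proj1 C (prod_obj C ?AB ?AD) ?BD \<cdot> (cosmash3_comparison C A B D \<cdot> g)) = \<zero> V ?AB"
      "proj2 C ?AB ?AD \<cdot> (proj1 C (prod_obj C ?AB ?AD) ?BD \<cdot> (cosmash3_comparison C A B D \<cdot> g)) = \<zero> V ?AD"
      "proj2 C (prod_obj C ?AB ?AD) ?BD \<cdot> (cosmash3_comparison C A B D \<cdot> g) = \<zero> V ?BD"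
      unfolding l using o V by simp_all
    then show ?R using o V g unfolding cosmash3_comparison_def by (simp add: hom_iff)
  next
    assume r: ?R
    let ?P = "prod_obj C ?AB ?AD"
    have "pairing C (pairing C ?c12 ?c13) ?c23 \<cdot> g = \<zero> V (prod_obj C ?P ?BD)"
    proof (rule prod_eqI[of ?P ?BD _ V])
      show "proj1 C ?P ?BD \<cdot> (pairing C (pairing C ?c12 ?c13) ?c23 \<cdot> g) = proj1 C ?P ?BD \<cdot> \<zero> V (prod_obj C ?P ?BD)"
        by (rule prod_eqI[of ?AB ?AD _ V]) (use r o V g in \<open>simp_all add: hom_iff\<close>)
    qed (use r o V g in \<open>simp_all add: hom_iff\<close>)
    then show ?L unfolding cosmash3_comparison_def .
  qed
  ultimately show ?thesis using g unfolding cross_effect_def by blast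
qed

text \<open>Sums of arrows commute with the killing of a summand.\<close>

lemma cross_effect_map:
  assumes "a \<in> hom C A A'" "b \<in> hom C B B'" "d \<in> hom C D D'" "cross_effect A B D V g"
  shows "cross_effect A' B' D' V (coprod_map C (coprod_map C a b) d \<cdot> g)"
proof -
  let ?m = "coprod_map C (coprod_map C a b) d"
  have o: "A \<in> Obj C" "B \<in> Obj C" "D \<in> Obj C" "A' \<in> Obj C" "B' \<in> Obj C" "D' \<in> Obj C"
    using assms by (simp_all add: hom_iff)
  have m: "?m \<in> hom C (sum3 A B D) (sum3 A' B' D')"
    using assms by (intro coprod_map_hom)
  note g = assms(4)[unfolded cross_effect_def]
  have V: "V \<in> Obj C" using g by (simp add: hom_iff)
  note k = kill_hom[OF o(1-3)] and k' = kill_hom[OF o(4-6)]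
  have nat: "x' \<cdot> (?m \<cdot> g) = \<zero> V (sum3 A' B' D')"
    if x: "x \<in> hom C (sum3 A B D) (sum3 A B D)" "x' \<in> hom C (sum3 A' B' D') (sum3 A' B' D')"
      "x' \<cdot> ?m = ?m \<cdot> x" "x \<cdot> g = \<zero> V (sum3 A B D)" for x x'
    using reassoc2[OF x(3), of g] x(1,2,4) m g V by (simp add: hom_iff)
  have "kill1 A' B' D' \<cdot> ?m = ?m \<cdot> kill1 A B D" "kill2 A' B' D' \<cdot> ?m = ?m \<cdot> kill2 A B D"
    "kill3 A' B' D' \<cdot> ?m = ?m \<cdot> kill3 A B D"
    by (rule sum3_eqI[of _ A B D "sum3 A' B' D'"];
        use assms(1-3) o in \<open>simp add: kill_defs hom_iff coprod_map_def\<close>)+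
  then show ?thesis
    unfolding cross_effect_def using nat k k' g comp_in_hom[OF conjunct1[OF g] m] by simp
qed

end

section \<open>Two-nilpotent objects\<close>

context semi_abelian_category
begin

text \<open>A subobject through which the sum of the arrows factors contains both summands of the
  codomain, as \<open>e\<close> and \<open>f\<close> are strong; hence it is everything.\<close>

lemma coprod_map_regular_epi:
  assumes e: "is_regular_epi C e" "e \<in> hom C A A'" and f: "is_regular_epi C f" "f \<in> hom C B B'"
  shows "is_regular_epi C (coprod_map C e f)"
proof (rule regular_epi_if_extremal[OF coprod_map_hom[OF e(2) f(2)]])
  fix D m g
  assume m: "m \<in> hom C D (coprod_obj C A' B')" "is_mono C m" and g: "g \<in> hom C (coprod_obj C A B) D"
    "m \<cdot> g = coprod_map C e f"
  have o: "A \<in> Obj C" "B \<in> Obj C" "A' \<in> Obj C" "B' \<in> Obj C" using e f by (simp_all add: hom_iff)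
  have "\<exists>x \<in> hom C A' D. x \<cdot> e = g \<cdot> inj1 C A B \<and> m \<cdot> x = inj1 C A' B'"
    by (rule regular_epi_strong[OF e m(2,1)])
      (use o g(1) m(1) coprod_map_inj1[OF e(2) f(2)] reassoc[OF g(2), of "inj1 C A B"]
        in \<open>simp_all add: hom_iff\<close>)
  then obtain x where x: "x \<in> hom C A' D" "m \<cdot> x = inj1 C A' B'" by blast
  have "\<exists>x \<in> hom C B' D. x \<cdot> f = g \<cdot> inj2 C A B \<and> m \<cdot> x = inj2 C A' B'"
    by (rule regular_epi_strong[OF f m(2,1)])
      (use o g(1) m(1) coprod_map_inj2[OF e(2) f(2)] reassoc[OF g(2), of "inj2 C A B"]
        in \<open>simp_all add: hom_iff\<close>)
  then obtain y where y: "y \<in> hom C B' D" "m \<cdot> y = inj2 C A' B'" by blast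
  have "m \<cdot> copairing C x y = \<one> (coprod_obj C A' B')"
    by (rule coprod_eqI[of A' B' _ "coprod_obj C A' B'"]) (use x y m o in \<open>simp_all add: hom_iff\<close>)
  then show "\<exists>n \<in> hom C (coprod_obj C A' B') D. m \<cdot> n = \<one> (coprod_obj C A' B')"
    using x y by (intro bexI[of _ "copairing C x y"]) (simp_all add: hom_iff)
qed

section \<open>Images and the ternary commutator\<close>

lemma is_image_image:
  assumes f: "f \<in> hom C A B"
  shows "is_image C (image C f) f"
proof -
  obtain I m e where "e \<in> hom C A I" "is_regular_epi C e" "m \<in> hom C I B" "is_mono C m" "f = m \<cdot> e"
    by (rule image_factorisation[OF f])
  then have "is_image C m f" using f unfolding is_image_def by (auto simp: hom_def)
  then show ?thesis unfolding image_def by (rule someI)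
qed

lemma imageE:
  assumes f: "f \<in> hom C A B"
  obtains I e where "image C f \<in> hom C I B" "is_mono C (image C f)" "e \<in> hom C A I" "is_regular_epi C e"
    "image C f \<cdot> e = f"
proof -
  have i: "image C f \<in> hom C (Dom C (image C f)) B" "is_mono C (image C f)"
    using is_image_image[OF f] f unfolding is_image_def is_mono_def by (simp_all add: hom_def)
  then show ?thesis using is_image_image[OF f] f that unfolding is_image_def
    by (metis (no_types, lifting) hom_iff)
qed

lemma cosmash3_incl:
  assumes o: "A \<in> Obj C" "B \<in> Obj C" "D \<in> Obj C"
  obtains T where "cosmash3_incl C A B D \<in> hom C T (sum3 A B D)"
    "cross_effect A B D T (cosmash3_incl C A B D)"
    "\<And>V g. cross_effect A B D V g \<Longrightarrow> \<exists>h \<in> hom C V T. cosmash3_incl C A B D \<cdot> h = g"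
proof -
  note c = cosmash3_comparison_hom[OF o]
  have k: "is_kernel C (cosmash3_incl C A B D) (cosmash3_comparison C A B D)"
    unfolding cosmash3_incl_def using c by (intro is_kernel_kernel) (simp add: hom_iff)
  note h = is_kernel_hom[OF k c]
  note k' = k[unfolded kernel_iff[OF c h]]
  have "\<exists>h \<in> hom C V (Dom C (cosmash3_incl C A B D)). cosmash3_incl C A B D \<cdot> h = g"
    if g: "cross_effect A B D V g" for V g
  proof -
    have g': "g \<in> hom C V (sum3 A B D)" using g unfolding cross_effect_def by blast
    show ?thesis using k' g'  g[unfolded cross_effect_iff[OF o g']] by blast
  qed
  then show ?thesis using that[OF h] k' cross_effect_iff[OF o h] by blast
qed

lemma codiagonal3_hom: "X \<in> Obj C \<Longrightarrow> codiagonal3 C X \<in> hom C (sum3 X X X) X"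
  unfolding codiagonal3_def by (simp add: hom_iff)

text \<open>\<open>[X, X, X]\<close> is used only through the arrows that kill it. As it is covered
  by the ternary cosmash product, these can be tested on the elements of that product.\<close>

lemma commutator3:
  assumes X: "X \<in> Obj C"
  obtains M where "commutator3 C X \<in> hom C M X" "is_mono C (commutator3 C X)"
    "\<And>h Y. h \<in> hom C X Y \<Longrightarrow> h \<cdot> commutator3 C X = \<zero> M Y \<longleftrightarrow>
       (\<forall>V g. cross_effect X X X V g \<longrightarrow> h \<cdot> (codiagonal3 C X \<cdot> g) = \<zero> V Y)"
proof -
  let ?i = "cosmash3_incl C X X X" and ?n = "codiagonal3 C X"
  obtain T where i: "?i \<in> hom C T (sum3 X X X)" "cross_effect X X X T ?i"
    "\<And>V g. cross_effect X X X V g \<Longrightarrow> \<exists>h \<in> hom C V T. ?i \<cdot> h = g"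
    by (rule cosmash3_incl[OF X X X]) blast
  note n = codiagonal3_hom[OF X]
  have ni: "?n \<cdot> ?i \<in> hom C T X" using n i by (simp add: hom_iff)
  obtain M e where m: "commutator3 C X \<in> hom C M X" "is_mono C (commutator3 C X)" "e \<in> hom C T M"
    "is_regular_epi C e" "commutator3 C X \<cdot> e = ?n \<cdot> ?i"
    unfolding commutator3_def by (rule imageE[OF ni])
  have "h \<cdot> commutator3 C X = \<zero> M Y \<longleftrightarrow>
    (\<forall>V g. cross_effect X X X V g \<longrightarrow> h \<cdot> (?n \<cdot> g) = \<zero> V Y)" (is "?L \<longleftrightarrow> ?R") if h: "h \<in> hom C X Y" for h Y
  proof
    assume l: ?L
    have "h \<cdot> (?n \<cdot> ?i) = \<zero> T Y"
      using reassoc[OF l, of e] h m(1,3) by (simp add: hom_iff flip: m(5))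
    then have "h \<cdot> (?n \<cdot> (?i \<cdot> t)) = \<zero> V Y" if "t \<in> hom C V T" for V t
      using reassoc[of h "?n \<cdot> ?i" "\<zero> T Y" t] that h n i(1) by (simp add: hom_iff)
    then show ?R using i(3) by metis
  next
    assume r: ?R
    have "(h \<cdot> commutator3 C X) \<cdot> e = \<zero> M Y \<cdot> e"
      using r i(1,2) h m by (simp add: hom_iff)
    then show ?L
      by (rule regular_epi_cancel[OF m(4,3), of _ Y, rotated 2]) (use h m in \<open>simp_all add: hom_iff\<close>)
  qed
  then show ?thesis using that m by blast
qed

text \<open>The case \<open>h = \<one> X\<close> of the preceding description, since a monomorphism
  is zero exactly when its domain is a zero object.\<close>

lemma two_nilpotent_iff:
  assumes X: "X \<in> Obj C"
  shows "two_nilpotent C X \<longleftrightarrow> (\<forall>V g. cross_effect X X X V g \<longrightarrow> codiagonal3 C X \<cdot> g = \<zero> V X)"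
proof -
  obtain M where m: "commutator3 C X \<in> hom C M X" "is_mono C (commutator3 C X)"
    "\<And>h Y. h \<in> hom C X Y \<Longrightarrow> h \<cdot> commutator3 C X = \<zero> M Y \<longleftrightarrow>
       (\<forall>V g. cross_effect X X X V g \<longrightarrow> h \<cdot> (codiagonal3 C X \<cdot> g) = \<zero> V Y)"
    by (rule commutator3[OF X]) blast
  have M: "M \<in> Obj C" "Dom C (commutator3 C X) = M" using m(1) by (simp_all add: hom_iff)
  have "is_zero_obj C M \<longleftrightarrow> commutator3 C X = \<zero> M X"
  proof
    assume "is_zero_obj C M"
    then show "commutator3 C X = \<zero> M X"
      using m(1) X M unfolding zero_obj_iff[OF M(1)] by (metis hom_iff ident_right zero_comp_left)
  next
    assume z: "commutator3 C X = \<zero> M X"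
    have "\<one> M = \<zero> M M"
      by (rule is_monoD[OF m(2,1)]) (use z M X in \<open>simp_all add: hom_iff\<close>)
    then show "is_zero_obj C M" using zero_obj_iff M by blast
  qed
  moreover have "\<one> X \<cdot> commutator3 C X = commutator3 C X" using m(1) by (simp add: hom_iff)
  moreover have "\<one> X \<cdot> (codiagonal3 C X \<cdot> g) = codiagonal3 C X \<cdot> g" if "cross_effect X X X V g" for V g
    using that codiagonal3_hom[OF X] X unfolding cross_effect_def by (simp add: hom_iff)
  ultimately show ?thesis
    unfolding two_nilpotent_def M using m(3)[of "\<one> X" X] X ident_in_hom by metis
qed

lemma codiagonal3_coprod_map:
  assumes "a \<in> hom C A X" "b \<in> hom C B X" "d \<in> hom C D X"
  shows "codiagonal3 C X \<cdot> coprod_map C (coprod_map C a b) d = copairing C (copairing C a b) d"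
proof -
  have o: "A \<in> Obj C" "B \<in> Obj C" "D \<in> Obj C" "X \<in> Obj C" using assms by (simp_all add: hom_iff)
  show ?thesis
    by (rule sum3_eqI[of _ A B D X]; use assms o in \<open>simp add: codiagonal3_def coprod_map_def hom_iff\<close>)
qed

text \<open>The copairing of the three arrows is their sum followed by the codiagonal of
  \<open>X\<close>, and the sum of arrows preserves elements of the ternary cosmash product.\<close>

lemma two_nilpotent_cross_effect:
  assumes X: "two_nilpotent C X" and abd: "a \<in> hom C A X" "b \<in> hom C B X" "d \<in> hom C D X"
    and g: "cross_effect A B D V g"
  shows "copairing C (copairing C a b) d \<cdot> g = \<zero> V X"
proof -
  have o: "X \<in> Obj C" using abd by (simp add: hom_iff)
  let ?m = "coprod_map C (coprod_map C a b) d"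
  have m: "?m \<in> hom C (sum3 A B D) (sum3 X X X)" using abd by (intro coprod_map_hom)
  have "codiagonal3 C X \<cdot> (?m \<cdot> g) = \<zero> V X"
    using X[unfolded two_nilpotent_iff[OF o]] cross_effect_map[OF abd g] by blast
  moreover have "codiagonal3 C X \<cdot> (?m \<cdot> g) = copairing C (copairing C a b) d \<cdot> g"
    by (rule reassoc[OF codiagonal3_coprod_map[OF abd]])
      (use m codiagonal3_hom[OF o] g[unfolded cross_effect_def] in \<open>simp_all add: hom_iff\<close>)
  ultimately show ?thesis by simp
qed

section \<open>Closure properties of two-nilpotent objects\<close>

text \<open>Elements of the ternary commutator of \<open>A\<close> die in both targets. A
  monomorphism taken twice gives closure under subobjects; the two projections give closure under
  products.\<close>

lemma two_nilpotent_jointly_monic: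
  assumes p: "p \<in> hom C A X" "two_nilpotent C X" and q: "q \<in> hom C A Y" "two_nilpotent C Y"
    and jm: "\<And>W g. \<lbrakk>g \<in> hom C W A; p \<cdot> g = \<zero> W X; q \<cdot> g = \<zero> W Y\<rbrakk> \<Longrightarrow> g = \<zero> W A"
  shows "two_nilpotent C A"
proof -
  have A: "A \<in> Obj C" using p by (simp add: hom_iff)
  have n: "f \<cdot> (codiagonal3 C A \<cdot> g) = \<zero> V B"
    if f: "f \<in> hom C A B" "two_nilpotent C B" and g: "cross_effect A A A V g" for f B V g
  proof -
    have B: "B \<in> Obj C" using f by (simp add: hom_iff)
    have "f \<cdot> codiagonal3 C A = copairing C (copairing C f f) f"
      by (rule sum3_eqI[of _ A A A B]; use f(1) A B in \<open>simp add: codiagonal3_def hom_iff\<close>)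
    then have "f \<cdot> (codiagonal3 C A \<cdot> g) = copairing C (copairing C f f) f \<cdot> g"
      by (rule reassoc)
        (use f codiagonal3_hom[OF A] g[unfolded cross_effect_def] in \<open>simp_all add: hom_iff\<close>)
    then show ?thesis using two_nilpotent_cross_effect[OF f(2,1,1,1) g] by simp
  qed
  show ?thesis unfolding two_nilpotent_iff[OF A]
  proof (intro allI impI)
    fix V g assume g: "cross_effect A A A V g"
    show "codiagonal3 C A \<cdot> g = \<zero> V A"
      by (rule jm) (use n[OF p g] n[OF q g] g codiagonal3_hom[OF A] in \<open>simp_all add: cross_effect_def hom_iff\<close>)
  qed
qed

lemma two_nilpotent_subobject:
  assumes "m \<in> hom C A X" "is_mono C m" "two_nilpotent C X"
  shows "two_nilpotent C A"
proof (rule two_nilpotent_jointly_monic[OF assms(1,3,1,3)])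
  fix W g assume "g \<in> hom C W A" "m \<cdot> g = \<zero> W X"
  then show "g = \<zero> W A" using assms(1)
    by (intro is_monoD[OF assms(2,1), of g W]) (simp_all add: hom_iff)
qed

text \<open>The arrows \<open>k1\<close>, \<open>k2\<close>, \<open>k3\<close> mirror the
  idempotents of the sum on its quotient \<open>W\<close>. An element that all three kill is
  therefore, on a cover, the image of an element of the ternary cosmash product, where
  \<open>h\<close> is known to vanish.\<close>

lemma cross_effect_vanish:
  assumes o: "A \<in> Obj C" "B \<in> Obj C" "D \<in> Obj C"
    and e: "is_regular_epi C e" "e \<in> hom C (sum3 A B D) W"
    and k: "k1 \<in> hom C W W" "k2 \<in> hom C W W" "k3 \<in> hom C W W" "e \<cdot> kill1 A B D = k1 \<cdot> e"
      "e \<cdot> kill2 A B D = k2 \<cdot> e" "e \<cdot> kill3 A B D = k3 \<cdot> e"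
    and h: "h \<in> hom C W Y" "\<And>V g. cross_effect A B D V g \<Longrightarrow> h \<cdot> (e \<cdot> g) = \<zero> V Y"
    and g: "g \<in> hom C V W" "k1 \<cdot> g = \<zero> V W" "k2 \<cdot> g = \<zero> V W" "k3 \<cdot> g = \<zero> V W"
  shows "h \<cdot> g = \<zero> V Y"
proof -
  let ?L = "[(kill1 A B D, k1), (kill2 A B D, k2), (kill3 A B D, k3)]"
  have "\<exists>V' v g'. is_regular_epi C v \<and> v \<in> hom C V' V \<and> g' \<in> hom C V' (sum3 A B D) \<and> e \<cdot> g' = g \<cdot> v \<and>
    (\<forall>(i, i') \<in> set ?L. i \<cdot> g' = \<zero> V' (sum3 A B D))"
  proof (rule lift_to_joint_kernel[OF e g(1)])
    fix i i' assume "(i, i') \<in> set ?L"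
    then show "i \<in> hom C (sum3 A B D) (sum3 A B D) \<and> i' \<in> hom C W W \<and> i \<cdot> i = i \<and> e \<cdot> i = i' \<cdot> e \<and> i' \<cdot> g = \<zero> V W"
      using k g kill_hom[OF o] kill_idem[OF o] by auto
  next
    fix i i' j j' assume "(i, i') \<in> set ?L" "(j, j') \<in> set ?L"
    then show "i \<cdot> j = j \<cdot> i" using kill_commute[OF o] by auto
  qed
  then obtain V' v g' where v: "is_regular_epi C v" "v \<in> hom C V' V" "g' \<in> hom C V' (sum3 A B D)"
    "e \<cdot> g' = g \<cdot> v" "cross_effect A B D V' g'" unfolding cross_effect_def by auto
  have Y: "Y \<in> Obj C" "V \<in> Obj C" using h g by (simp_all add: hom_iff)
  have "(h \<cdot> g) \<cdot> v = \<zero> V Y \<cdot> v" using h(2)[OF v(5)] v(2-4) h(1) g(1) Y by (simp add: hom_iff)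
  then show ?thesis
    by (rule regular_epi_cancel[OF v(1,2), of _ Y, rotated 2]) (use h(1) g(1) in \<open>simp_all add: hom_iff\<close>)
qed

text \<open>Vanishing is applied to \<open>q + q + q\<close>, which is regular epic and compatible
  with killing summands. The assumption is phrased as \<open>q\<close> killing the commutator of
  \<open>X\<close>, so that it covers quotients of two-nilpotent objects as well as the quotient of
  any object by its commutator.\<close>

lemma two_nilpotent_quotient:
  assumes q: "is_regular_epi C q" "q \<in> hom C X Q"
    and c: "\<And>V g. cross_effect X X X V g \<Longrightarrow> q \<cdot> (codiagonal3 C X \<cdot> g) = \<zero> V Q"
  shows "two_nilpotent C Q"
proof -
  have o: "X \<in> Obj C" "Q \<in> Obj C" using q by (simp_all add: hom_iff)
  let ?e = "coprod_map C (coprod_map C q q) q"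
  have e: "is_regular_epi C ?e" "?e \<in> hom C (sum3 X X X) (sum3 Q Q Q)"
    using q by (auto intro!: coprod_map_regular_epi coprod_map_hom)
  have nat: "?e \<cdot> kill1 X X X = kill1 Q Q Q \<cdot> ?e" "?e \<cdot> kill2 X X X = kill2 Q Q Q \<cdot> ?e"
    "?e \<cdot> kill3 X X X = kill3 Q Q Q \<cdot> ?e"
    by (rule sum3_eqI[of _ X X X "sum3 Q Q Q"];
        use q(2) o in \<open>simp add: kill_defs hom_iff coprod_map_def\<close>)+
  have "codiagonal3 C Q \<cdot> ?e = q \<cdot> codiagonal3 C X"
    by (rule sum3_eqI[of _ X X X Q]; use q(2) o in \<open>simp add: codiagonal3_def coprod_map_def hom_iff\<close>)
  then have z: "codiagonal3 C Q \<cdot> (?e \<cdot> g) = \<zero> V Q" if "cross_effect X X X V g" for V g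
    using c[OF that] reassoc2[of "codiagonal3 C Q" ?e q "codiagonal3 C X" g] that
      codiagonal3_hom[OF o(1)] codiagonal3_hom[OF o(2)] q(2) e(2)
    by (simp add: cross_effect_def hom_iff)
  show ?thesis unfolding two_nilpotent_iff[OF o(2)]
  proof (intro allI impI)
    fix V g assume g: "cross_effect Q Q Q V g"
    show "codiagonal3 C Q \<cdot> g = \<zero> V Q"
      by (rule cross_effect_vanish[OF o(1,1,1) e kill_hom[OF o(2,2,2)] nat codiagonal3_hom[OF o(2)] z])
        (use g in \<open>simp_all add: cross_effect_def\<close>)
  qed
qed

lemma two_nilpotent_regular_quotient:
  assumes "is_regular_epi C q" "q \<in> hom C X Q" "two_nilpotent C X"
  shows "two_nilpotent C Q"
proof (rule two_nilpotent_quotient[OF assms(1,2)])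
  fix V g assume g: "cross_effect X X X V g"
  have "X \<in> Obj C" "Q \<in> Obj C" "V \<in> Obj C" using assms(2) g by (simp_all add: cross_effect_def hom_iff)
  then show "q \<cdot> (codiagonal3 C X \<cdot> g) = \<zero> V Q"
    using g assms(2,3) two_nilpotent_iff[of X] by (simp add: hom_iff)
qed

section \<open>The reflector to two-nilpotent objects\<close>

text \<open>The quotient is two-nilpotent because it kills the commutator. An arrow to a
  two-nilpotent object kills the commutator too, since the codiagonal followed by it is a copairing
  of three arrows into that object.\<close>

lemma nil2_unit:
  assumes X: "X \<in> Obj C"
  shows nil2_unit_hom: "nil2_unit C X \<in> hom C X (nil2_obj C X)"
    and nil2_unit_regular_epi: "is_regular_epi C (nil2_unit C X)"
    and nil2_obj_two_nilpotent: "two_nilpotent C (nil2_obj C X)"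
    and nil2_unit_factor: "\<And>h Y. \<lbrakk>h \<in> hom C X Y; two_nilpotent C Y\<rbrakk> \<Longrightarrow>
      \<exists>u \<in> hom C (nil2_obj C X) Y. u \<cdot> nil2_unit C X = h"
proof -
  obtain M where m: "commutator3 C X \<in> hom C M X" "is_mono C (commutator3 C X)"
    "\<And>h Y. h \<in> hom C X Y \<Longrightarrow> h \<cdot> commutator3 C X = \<zero> M Y \<longleftrightarrow>
       (\<forall>V g. cross_effect X X X V g \<longrightarrow> h \<cdot> (codiagonal3 C X \<cdot> g) = \<zero> V Y)"
    by (rule commutator3[OF X]) blast
  have c: "is_cokernel C (nil2_unit C X) (commutator3 C X)"
    unfolding nil2_unit_def cokernel_def using cokernel_exists[OF m(1)] by (rule someI_ex)
  show u: "nil2_unit C X \<in> hom C X (nil2_obj C X)"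
    using c m(1) unfolding is_cokernel_def nil2_obj_def by (simp add: hom_def)
  note c' = c[unfolded cokernel_iff[OF m(1) u]]
  show e: "is_regular_epi C (nil2_unit C X)" by (rule cokernel_regular_epi[OF m(1) u c])
  show "two_nilpotent C (nil2_obj C X)"
    by (rule two_nilpotent_quotient[OF e u]) (use m(3)[OF u] c' in blast)
  fix h Y assume h: "h \<in> hom C X Y" "two_nilpotent C Y"
  have "h \<cdot> (codiagonal3 C X \<cdot> g) = \<zero> V Y" if g: "cross_effect X X X V g" for V g
  proof -
    have "h \<cdot> codiagonal3 C X = copairing C (copairing C h h) h"
      by (rule sum3_eqI[of _ X X X Y]; use h(1) X in \<open>simp add: codiagonal3_def hom_iff\<close>)
    then have "h \<cdot> (codiagonal3 C X \<cdot> g) = copairing C (copairing C h h) h \<cdot> g"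
      by (rule reassoc)
        (use h codiagonal3_hom[OF X] g[unfolded cross_effect_def] in \<open>simp_all add: hom_iff\<close>)
    then show ?thesis using two_nilpotent_cross_effect[OF h(2,1,1,1) g] by simp
  qed
  then have "h \<cdot> commutator3 C X = \<zero> M Y" using m(3)[OF h(1)] by blast
  then show "\<exists>u \<in> hom C (nil2_obj C X) Y. u \<cdot> nil2_unit C X = h" using c' h(1) by blast
qed

section \<open>The category of two-nilpotent objects\<close>

lemma two_nilpotent_obj [simp]: "two_nilpotent C X \<Longrightarrow> X \<in> Obj C"
  by (simp add: two_nilpotent_def)

lemma nil2_simps [simp]:
  "Dom (Nil2 C) = Dom C" "Cod (Nil2 C) = Cod C" "Ident (Nil2 C) = Ident C" "Comp (Nil2 C) = Comp C"
  by (simp_all add: Nil2_def full_subcategory_def)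

lemma obj_nil2: "X \<in> Obj (Nil2 C) \<longleftrightarrow> two_nilpotent C X"
  by (auto simp: Nil2_def full_subcategory_def)

lemma arr_nil2: "f \<in> Arr (Nil2 C) \<longleftrightarrow> f \<in> Arr C \<and> two_nilpotent C (Dom C f) \<and> two_nilpotent C (Cod C f)"
  by (auto simp: Nil2_def full_subcategory_def)

lemma hom_nil2: "f \<in> hom (Nil2 C) X Y \<longleftrightarrow> f \<in> hom C X Y \<and> two_nilpotent C X \<and> two_nilpotent C Y"
  by (auto simp: hom_def arr_nil2)

lemma zero_obj_two_nilpotent:
  assumes "is_zero_obj C Z"
  shows "two_nilpotent C Z"
proof -
  have Z: "Z \<in> Obj C" "is_terminal C Z" using assms by (auto simp: is_zero_obj_def is_terminal_def)
  show ?thesis unfolding two_nilpotent_iff[OF Z(1)]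
  proof (intro allI impI)
    fix V g assume "cross_effect Z Z Z V g"
    then have "codiagonal3 C Z \<cdot> g \<in> hom C V Z" "\<zero> V Z \<in> hom C V Z"
      using codiagonal3_hom[OF Z(1)] Z(1) by (simp_all add: cross_effect_def hom_iff)
    then show "codiagonal3 C Z \<cdot> g = \<zero> V Z" by (rule terminal_eq[OF Z(2)])
  qed
qed

lemma nil2_zero_obj:
  assumes "is_zero_obj C Z"
  shows "is_zero_obj (Nil2 C) Z"
proof -
  note Z = zero_obj_two_nilpotent[OF assms]
  have i: "is_initial C Z" and t: "is_terminal C Z" using assms by (auto simp: is_zero_obj_def)
  have "\<exists>!f. f \<in> hom (Nil2 C) Z X" if X: "two_nilpotent C X" for X
  proof -
    obtain f where "f \<in> hom C Z X" using i two_nilpotent_obj[OF X] unfolding is_initial_def by blast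
    then show ?thesis using X Z initial_eq[OF i] unfolding hom_nil2 by (intro ex1I[of _ f]) blast+
  qed
  moreover have "\<exists>!f. f \<in> hom (Nil2 C) X Z" if X: "two_nilpotent C X" for X
  proof -
    obtain f where "f \<in> hom C X Z" using t two_nilpotent_obj[OF X] unfolding is_terminal_def by blast
    then show ?thesis using X Z terminal_eq[OF t] unfolding hom_nil2 by (intro ex1I[of _ f]) blast+
  qed
  ultimately show ?thesis
    using Z by (simp add: is_zero_obj_def is_initial_def is_terminal_def obj_nil2)
qed

lemma nil2_category: "category (Nil2 C)"
proof (unfold_locales, unfold nil2_simps arr_nil2 obj_nil2 hom_nil2, goal_cases)
  case (3 X) then show ?case by (simp add: ident_in_hom)
next
  case (4 f X Y g Z) then show ?case using comp_in_hom by blast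
next
  case (5 f X Y) then show ?case using comp_ident_left by blast
next
  case (6 f X Y) then show ?case using comp_ident_right by blast
next
  case (7 f W X g Y h Z) then show ?case using comp_assoc by blast
qed simp_all

lemma nil2_pointed_category: "pointed_category (Nil2 C)"
proof -
  interpret N: category "Nil2 C" by (rule nil2_category)
  show ?thesis using has_zero_obj nil2_zero_obj by unfold_locales blast
qed

lemma nil2_is_zero_arrow:
  assumes "f \<in> Arr (Nil2 C)"
  shows "is_zero_arrow (Nil2 C) f \<longleftrightarrow> is_zero_arrow C f"
proof -
  interpret N: pointed_category "Nil2 C" by (rule nil2_pointed_category)
  define X Y where "X = Dom C f" and "Y = Cod C f"
  have f: "f \<in> hom C X Y" "two_nilpotent C X" "two_nilpotent C Y"
    using assms unfolding X_def Y_def by (simp_all add: arr_nil2 hom_def)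
  then have f': "f \<in> hom (Nil2 C) X Y" by (simp add: hom_nil2)
  show ?thesis
  proof
    assume "is_zero_arrow (Nil2 C) f"
    then obtain Z g h where z: "is_zero_obj (Nil2 C) Z" "g \<in> hom (Nil2 C) X Z" "h \<in> hom (Nil2 C) Z Y" "f = h \<cdot> g"
      using N.is_zero_arrow_hom_iff[OF f'] by auto
    then have g: "g \<in> hom C X Z" "h \<in> hom C Z Y" "two_nilpotent C Z" by (simp_all add: hom_nil2)
    \<comment> \<open>\<open>Z\<close> is known to be a zero object among two-nilpotent objects
      only; being terminal there is enough to identify \<open>g\<close> with the zero arrow of the
      ambient category.\<close>
    have "\<zero> X Z \<in> hom (Nil2 C) X Z" using f g by (simp add: hom_nil2 hom_iff)
    moreover have "is_terminal (Nil2 C) Z" using z by (simp add: is_zero_obj_def)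
    ultimately have "g = \<zero> X Z" using z(2) N.terminal_eq by blast
    then have "f = \<zero> X Y" using z(4) g by (simp add: hom_iff)
    then show "is_zero_arrow C f" using f by simp
  next
    assume "is_zero_arrow C f"
    then obtain Z g h where z: "is_zero_obj C Z" "g \<in> hom C X Z" "h \<in> hom C Z Y" "f = h \<cdot> g"
      using is_zero_arrow_hom_iff[OF f(1)] by blast
    then have "g \<in> hom (Nil2 C) X Z" "h \<in> hom (Nil2 C) Z Y"
      using f zero_obj_two_nilpotent by (simp_all add: hom_nil2)
    then show "is_zero_arrow (Nil2 C) f"
      using z nil2_zero_obj N.is_zero_arrow_hom_iff[OF f'] by auto
  qed
qed

lemma nil2_zero:
  assumes "two_nilpotent C X" "two_nilpotent C Y"
  shows "zero_arrow (Nil2 C) X Y = \<zero> X Y"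
proof -
  interpret N: pointed_category "Nil2 C" by (rule nil2_pointed_category)
  have "\<zero> X Y \<in> hom (Nil2 C) X Y" using assms by (simp add: hom_nil2 hom_iff)
  moreover have "is_zero_arrow (Nil2 C) (\<zero> X Y)"
    using assms by (simp add: nil2_is_zero_arrow arr_nil2)
  ultimately show ?thesis using N.is_zero_arrow_iff by simp
qed

text \<open>Closure under subobjects puts the domain of \<open>k\<close> among the two-nilpotent
  objects, so the universal property merely gets fewer test objects.\<close>

lemma nil2_kernel:
  assumes f: "f \<in> hom C A B" "two_nilpotent C A" "two_nilpotent C B" and k: "is_kernel C k f"
  shows "is_kernel (Nil2 C) k f"
proof -
  interpret N: pointed_category "Nil2 C" by (rule nil2_pointed_category)
  define K where "K = Dom C k"
  have h: "k \<in> hom C K A" using is_kernel_hom[OF k f(1)] unfolding K_def .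
  note k' = k[unfolded kernel_iff[OF f(1) h]]
  have K: "two_nilpotent C K" using two_nilpotent_subobject[OF h] k' f by blast
  have f': "f \<in> hom (Nil2 C) A B" and h': "k \<in> hom (Nil2 C) K A" using f h K by (simp_all add: hom_nil2)
  have "is_mono (Nil2 C) k"
    using k' h by (intro N.is_monoI[OF h']) (auto simp: hom_nil2 intro: is_monoD)
  moreover have "\<exists>h \<in> hom (Nil2 C) W K. k \<cdot> h = g"
    if g: "g \<in> hom C W A" "two_nilpotent C W" "f \<cdot> g = \<zero> W B" for W g
  proof -
    obtain h where "h \<in> hom C W K" "k \<cdot> h = g" using k' g by blast
    then show ?thesis using g K by (intro bexI[of _ h]) (simp_all add: hom_nil2)
  qed
  ultimately show ?thesis
    using k' f K h unfolding N.kernel_iff[OF f' h'] by (auto simp: hom_nil2 nil2_zero)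
qed

text \<open>Products and kernels are those of the ambient category; sums are the reflections of its
  sums.\<close>

lemma nil2_cosmash_category: "cosmash_category (Nil2 C)"
proof -
  interpret N: pointed_category "Nil2 C" by (rule nil2_pointed_category)
  show ?thesis
  proof (unfold_locales, goal_cases)
    case (1 X Y)
    then have n: "two_nilpotent C X" "two_nilpotent C Y" by (simp_all add: obj_nil2)
    then have o: "X \<in> Obj C" "Y \<in> Obj C" by simp_all
    let ?p = "proj1 C X Y" and ?q = "proj2 C X Y" and ?P = "prod_obj C X Y"
    have h: "?p \<in> hom C ?P X" "?q \<in> hom C ?P Y" using o by (simp_all add: hom_iff)
    have P: "two_nilpotent C ?P"
    proof (rule two_nilpotent_jointly_monic[OF h(1) n(1) h(2) n(2)])
      fix W g assume "g \<in> hom C W ?P" "?p \<cdot> g = \<zero> W X" "?q \<cdot> g = \<zero> W Y"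
      then show "g = \<zero> W ?P" by (intro prod_eqI[OF o, of g W]) (use o in \<open>simp_all add: hom_iff\<close>)
    qed
    have "is_product (Nil2 C) X Y ?p ?q"
    proof (rule N.is_productI[of _ ?P])
      show "?p \<in> hom (Nil2 C) ?P X" "?q \<in> hom (Nil2 C) ?P Y" using h n P by (simp_all add: hom_nil2)
      fix W u v assume u: "u \<in> hom (Nil2 C) W X" "v \<in> hom (Nil2 C) W Y"
      then show "\<exists>h \<in> hom (Nil2 C) W ?P. ?p \<cdot>\<^bsub>Nil2 C\<^esub> h = u \<and> ?q \<cdot>\<^bsub>Nil2 C\<^esub> h = v"
        using pairing[of u W X v Y] P by (intro bexI[of _ "pairing C u v"]) (simp_all add: hom_nil2)
    next
      fix W u v assume "u \<in> hom (Nil2 C) W ?P" "v \<in> hom (Nil2 C) W ?P" "?p \<cdot>\<^bsub>Nil2 C\<^esub> u = ?p \<cdot>\<^bsub>Nil2 C\<^esub> v"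
        "?q \<cdot>\<^bsub>Nil2 C\<^esub> u = ?q \<cdot>\<^bsub>Nil2 C\<^esub> v"
      then show "u = v" by (intro prod_eqI[OF o, of u W v]) (simp_all add: hom_nil2)
    qed
    then show ?case by blast
  next
    case (2 X Y)
    then have n: "two_nilpotent C X" "two_nilpotent C Y" by (simp_all add: obj_nil2)
    then have o: "X \<in> Obj C" "Y \<in> Obj C" by simp_all
    let ?S = "coprod_obj C X Y"
    have S: "?S \<in> Obj C" using o by simp
    let ?R = "nil2_obj C ?S" and ?u = "nil2_unit C ?S"
    note u = nil2_unit_hom[OF S]
    let ?i = "?u \<cdot> inj1 C X Y" and ?j = "?u \<cdot> inj2 C X Y"
    have h: "?i \<in> hom C X ?R" "?j \<in> hom C Y ?R" using o u by (simp_all add: hom_iff)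
    note R = nil2_obj_two_nilpotent[OF S]
    have "is_coproduct (Nil2 C) X Y ?i ?j"
    proof (rule N.is_coproductI[of _ _ ?R])
      show "?i \<in> hom (Nil2 C) X ?R" "?j \<in> hom (Nil2 C) Y ?R" using h n R by (simp_all add: hom_nil2)
      fix W f g assume "f \<in> hom (Nil2 C) X W" "g \<in> hom (Nil2 C) Y W"
      then have fg: "f \<in> hom C X W" "g \<in> hom C Y W" "two_nilpotent C W" by (simp_all add: hom_nil2)
      then obtain t where t: "t \<in> hom C ?R W" "t \<cdot> ?u = copairing C f g"
        using nil2_unit_factor[OF S, of "copairing C f g" W] copairing[OF fg(1,2)] by blast
      have "t \<cdot> ?i = f" "t \<cdot> ?j = g"
        using reassoc[OF t(2), of "inj1 C X Y"] reassoc[OF t(2), of "inj2 C X Y"] t(1) u o fg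
        by (simp_all add: hom_iff)
      then show "\<exists>h \<in> hom (Nil2 C) ?R W. h \<cdot>\<^bsub>Nil2 C\<^esub> ?i = f \<and> h \<cdot>\<^bsub>Nil2 C\<^esub> ?j = g"
        using t R fg by (intro bexI[of _ t]) (simp_all add: hom_nil2)
    next
      fix W f g assume "f \<in> hom (Nil2 C) ?R W" "g \<in> hom (Nil2 C) ?R W" "f \<cdot>\<^bsub>Nil2 C\<^esub> ?i = g \<cdot>\<^bsub>Nil2 C\<^esub> ?i"
        "f \<cdot>\<^bsub>Nil2 C\<^esub> ?j = g \<cdot>\<^bsub>Nil2 C\<^esub> ?j"
      then have fg: "f \<in> hom C ?R W" "g \<in> hom C ?R W" "f \<cdot> ?i = g \<cdot> ?i" "f \<cdot> ?j = g \<cdot> ?j"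
        by (simp_all add: hom_nil2)
      have "f \<cdot> ?u = g \<cdot> ?u"
        by (rule coprod_eqI[OF o, of _ W]) (use fg u o in \<open>simp_all add: hom_iff\<close>)
      then show "f = g" by (rule regular_epi_cancel[OF nil2_unit_regular_epi[OF S] u fg(1,2)])
    qed
    then show ?case by blast
  next
    case (3 f)
    then have f: "f \<in> hom C (Dom C f) (Cod C f)" "two_nilpotent C (Dom C f)" "two_nilpotent C (Cod C f)"
      by (simp_all add: arr_nil2 hom_def)
    then obtain k where "is_kernel C k f" using kernels[of f] by (auto simp: hom_def)
    then show ?case using nil2_kernel[OF f] by blast
  qed
qed

section \<open>Sums and cosmash products of two-nilpotent objects\<close>

abbreviation nsum where "nsum X Y \<equiv> coprod_obj (Nil2 C) X Y"
abbreviation nin1 where "nin1 X Y \<equiv> inj1 (Nil2 C) X Y"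
abbreviation nin2 where "nin2 X Y \<equiv> inj2 (Nil2 C) X Y"
abbreviation ncop where "ncop f g \<equiv> copairing (Nil2 C) f g"
abbreviation nret1 where "nret1 X Y \<equiv> ncop (\<one> X) (\<zero> Y X)"
abbreviation nret2 where "nret2 X Y \<equiv> ncop (\<zero> X Y) (\<one> Y)"
abbreviation nmap where "nmap X g \<equiv> coprod_map (Nil2 C) (\<one> X) g"
abbreviation nsmash where "nsmash X Y \<equiv> cosmash (Nil2 C) X Y"
abbreviation nincl where "nincl X Y \<equiv> cosmash_incl (Nil2 C) X Y"
abbreviation smap where "smap X g \<equiv> cosmash_map (Nil2 C) (\<one> X) g"

text \<open>The sums chosen among two-nilpotent objects, read as arrows of the ambient category, so
  that the simplifier computes in one category only.\<close>

lemma
  assumes "two_nilpotent C X" "two_nilpotent C Y"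
  shows nin1_arr [simp]: "nin1 X Y \<in> Arr C"
    and dom_nin1 [simp]: "Dom C (nin1 X Y) = X"
    and cod_nin1 [simp]: "Cod C (nin1 X Y) = nsum X Y"
    and nin2_arr [simp]: "nin2 X Y \<in> Arr C"
    and dom_nin2 [simp]: "Dom C (nin2 X Y) = Y"
    and cod_nin2 [simp]: "Cod C (nin2 X Y) = nsum X Y"
    and nsum_two_nilpotent [simp]: "two_nilpotent C (nsum X Y)"
proof -
  interpret N: cosmash_category "Nil2 C" by (rule nil2_cosmash_category)
  have o: "X \<in> Obj (Nil2 C)" "Y \<in> Obj (Nil2 C)" using assms by (simp_all add: obj_nil2)
  show "nin1 X Y \<in> Arr C" "Dom C (nin1 X Y) = X" "Cod C (nin1 X Y) = nsum X Y" "nin2 X Y \<in> Arr C"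
    "Dom C (nin2 X Y) = Y" "Cod C (nin2 X Y) = nsum X Y" "two_nilpotent C (nsum X Y)"
    using N.inj1_hom[OF o] N.inj2_hom[OF o] by (simp_all add: hom_nil2 hom_iff)
qed

lemma
  assumes "f \<in> Arr C" "g \<in> Arr C" "Cod C f = Cod C g" "Dom C f = X" "Dom C g = Y"
    and "two_nilpotent C X" "two_nilpotent C Y" "two_nilpotent C (Cod C g)"
  shows ncop_arr [simp]: "ncop f g \<in> Arr C"
    and dom_ncop [simp]: "Dom C (ncop f g) = nsum X Y"
    and cod_ncop [simp]: "Cod C (ncop f g) = Cod C f"
    and ncop_nin1 [simp]: "ncop f g \<cdot> nin1 X Y = f"
    and ncop_nin2 [simp]: "ncop f g \<cdot> nin2 X Y = g"
    and ncop_nin1_comp [simp]: "\<And>u. \<lbrakk>u \<in> Arr C; Cod C u = X\<rbrakk> \<Longrightarrow> ncop f g \<cdot> (nin1 X Y \<cdot> u) = f \<cdot> u"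
    and ncop_nin2_comp [simp]: "\<And>u. \<lbrakk>u \<in> Arr C; Cod C u = Y\<rbrakk> \<Longrightarrow> ncop f g \<cdot> (nin2 X Y \<cdot> u) = g \<cdot> u"
proof -
  interpret N: cosmash_category "Nil2 C" by (rule nil2_cosmash_category)
  have "f \<in> hom (Nil2 C) X (Cod C f)" "g \<in> hom (Nil2 C) Y (Cod C f)"
    using assms by (simp_all add: hom_def arr_nil2)
  from N.copairing[OF this]
  have "ncop f g \<in> hom C (nsum X Y) (Cod C f)" "ncop f g \<cdot> nin1 X Y = f" "ncop f g \<cdot> nin2 X Y = g"
    by (simp_all add: hom_nil2)
  then show a: "ncop f g \<in> Arr C" "Dom C (ncop f g) = nsum X Y" "Cod C (ncop f g) = Cod C f"
    and b: "ncop f g \<cdot> nin1 X Y = f" "ncop f g \<cdot> nin2 X Y = g" by (simp_all add: hom_def)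
  fix u assume u: "u \<in> Arr C"
  show "ncop f g \<cdot> (nin1 X Y \<cdot> u) = f \<cdot> u" if "Cod C u = X"
    by (rule reassoc[OF b(1)]) (use assms a u that in simp_all)
  show "ncop f g \<cdot> (nin2 X Y \<cdot> u) = g \<cdot> u" if "Cod C u = Y"
    by (rule reassoc[OF b(2)]) (use assms a u that in simp_all)
qed

lemma nsum_eqI:
  assumes "u \<in> hom C (nsum X Y) W" "v \<in> hom C (nsum X Y) W"
    and n: "two_nilpotent C X" "two_nilpotent C Y" "two_nilpotent C W"
    and "u \<cdot> nin1 X Y = v \<cdot> nin1 X Y" "u \<cdot> nin2 X Y = v \<cdot> nin2 X Y"
  shows "u = v"
proof -
  interpret N: cosmash_category "Nil2 C" by (rule nil2_cosmash_category)
  show ?thesis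
    by (rule N.coprod_eqI[of X Y u W v]) (use assms in \<open>simp_all add: hom_nil2 obj_nil2\<close>)
qed

text \<open>
  Here \<open>D\<close> ranges over all objects, but as a subobject of a two-nilpotent one it is two-nilpotent.
\<close>

lemma nsum_generation:
  assumes n: "two_nilpotent C X" "two_nilpotent C Y"
    and m: "m \<in> hom C D (nsum X Y)" "is_mono C m"
    and a: "a \<in> hom C X D" "m \<cdot> a = nin1 X Y" and b: "b \<in> hom C Y D" "m \<cdot> b = nin2 X Y"
  shows "\<exists>d \<in> hom C (nsum X Y) D. m \<cdot> d = \<one> (nsum X Y)"
proof -
  have D: "two_nilpotent C D" using two_nilpotent_subobject[OF m] n by simp
  have "m \<cdot> ncop a b = \<one> (nsum X Y)"
    by (rule nsum_eqI[of _ X Y "nsum X Y"]) (use a b m n D in \<open>simp_all add: hom_iff\<close>)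
  then show ?thesis
    using a b D n by (intro bexI[of _ "ncop a b"]) (simp_all add: hom_iff)
qed

lemma nmap_eq:
  assumes "g \<in> hom C Y Z" "two_nilpotent C X" "two_nilpotent C Z"
  shows "nmap X g = ncop (nin1 X Z) (nin2 X Z \<cdot> g)"
  using assms by (simp add: coprod_map_def hom_iff)

text \<open>The kernel \<open>nincl\<close> is chosen among two-nilpotent objects, so at first its
  monicity and its lifting property concern two-nilpotent test objects only. Comparison with a
  kernel \<open>l\<close> in the ambient category extends both to all test objects, as the covers of
  elements require.\<close>

lemma nsmash:
  assumes n: "two_nilpotent C X" "two_nilpotent C Y"
  shows nincl_hom: "nincl X Y \<in> hom C (nsmash X Y) (nsum X Y)"
    and nincl_mono: "is_mono C (nincl X Y)"
    and nsmash_two_nilpotent: "two_nilpotent C (nsmash X Y)"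
    and nret1_nincl: "nret1 X Y \<cdot> nincl X Y = \<zero> (nsmash X Y) X"
    and nret2_nincl: "nret2 X Y \<cdot> nincl X Y = \<zero> (nsmash X Y) Y"
    and nincl_lift: "\<And>V g. \<lbrakk>g \<in> hom C V (nsum X Y); nret1 X Y \<cdot> g = \<zero> V X; nret2 X Y \<cdot> g = \<zero> V Y\<rbrakk>
      \<Longrightarrow> \<exists>h \<in> hom C V (nsmash X Y). nincl X Y \<cdot> h = g"
proof -
  interpret N: cosmash_category "Nil2 C" by (rule nil2_cosmash_category)
  have o: "X \<in> Obj C" "Y \<in> Obj C" "X \<in> Obj (Nil2 C)" "Y \<in> Obj (Nil2 C)"
    using n by (simp_all add: obj_nil2)
  let ?k = "nincl X Y" and ?T = "nsmash X Y" and ?S = "nsum X Y" and ?P = "prod_obj (Nil2 C) X Y"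
  have r: "nret1 X Y \<in> hom C ?S X" "nret2 X Y \<in> hom C ?S Y" using n by (simp_all add: hom_iff)
  then have rN: "nret1 X Y \<in> hom (Nil2 C) ?S X" "nret2 X Y \<in> hom (Nil2 C) ?S Y"
    using n by (simp_all add: hom_nil2)
  let ?c = "pairing (Nil2 C) (nret1 X Y) (nret2 X Y)"
  have c: "?c \<in> hom (Nil2 C) ?S ?P" "proj1 (Nil2 C) X Y \<cdot> ?c = nret1 X Y" "proj2 (Nil2 C) X Y \<cdot> ?c = nret2 X Y"
    using N.pairing[OF rN] by simp_all
  then have cc: "?c \<in> hom C ?S ?P" "two_nilpotent C ?P" by (simp_all add: hom_nil2)
  have p: "proj1 (Nil2 C) X Y \<in> hom C ?P X" "proj2 (Nil2 C) X Y \<in> hom C ?P Y"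
    using N.proj1_hom[OF o(3,4)] N.proj2_hom[OF o(3,4)] by (simp_all add: hom_nil2)
  have "?k = kernel (Nil2 C) ?c"
    using n by (simp add: cosmash_incl_def cosmash_comparison_def nil2_zero)
  then have k: "is_kernel (Nil2 C) ?k ?c" using N.is_kernel_kernel[of ?c] c(1) by (simp add: hom_def)
  have kN: "?k \<in> hom (Nil2 C) ?T ?S" using N.is_kernel_hom[OF k c(1)] by (simp add: cosmash_def)
  then show kh: "?k \<in> hom C ?T ?S" and T: "two_nilpotent C ?T" by (simp_all add: hom_nil2)
  note k' = k[unfolded N.kernel_iff[OF c(1) kN] nil2_simps]
  have ck: "?c \<cdot> ?k = \<zero> ?T ?P" using k' T cc by (simp add: nil2_zero)
  show r1: "nret1 X Y \<cdot> ?k = \<zero> ?T X" and r2: "nret2 X Y \<cdot> ?k = \<zero> ?T Y"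
    using reassoc[OF c(2), of ?k] reassoc[OF c(3), of ?k] ck cc(1) p kh by (simp_all add: hom_iff)
  let ?d = "pairing C (nret1 X Y) (nret2 X Y)"
  have d: "?d \<in> hom C ?S (prod_obj C X Y)" using r o by (simp add: hom_iff)
  have dz: "?d \<cdot> g = \<zero> V (prod_obj C X Y)"
    if "g \<in> hom C V ?S" "nret1 X Y \<cdot> g = \<zero> V X" "nret2 X Y \<cdot> g = \<zero> V Y" for g V
    by (rule prod_eqI[of X Y _ V]) (use that r o n in \<open>simp_all add: hom_iff\<close>)
  obtain L l where l: "l \<in> hom C L ?S" "is_mono C l" "?d \<cdot> l = \<zero> L (prod_obj C X Y)"
    "\<And>W g. \<lbrakk>g \<in> hom C W ?S; ?d \<cdot> g = \<zero> W (prod_obj C X Y)\<rbrakk> \<Longrightarrow> \<exists>h \<in> hom C W L. l \<cdot> h = g"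
    by (rule kernelE[OF d]) blast
  \<comment> \<open>Closure under subobjects makes \<open>l\<close> itself a legitimate test arrow,
    so it will factor through \<open>nincl\<close>.\<close>
  have L: "two_nilpotent C L" using two_nilpotent_subobject[OF l(1,2)] n by simp
  have "proj1 C X Y \<cdot> (?d \<cdot> l) = \<zero> L X" "proj2 C X Y \<cdot> (?d \<cdot> l) = \<zero> L Y"
    unfolding l(3) using o L by simp_all
  then have rl: "nret1 X Y \<cdot> l = \<zero> L X" "nret2 X Y \<cdot> l = \<zero> L Y"
    using r o l(1) n by (simp_all add: hom_iff)
  have cl: "?c \<cdot> l = \<zero> L ?P"
  proof (rule N.prod_eqI[OF o(3,4), of _ L, unfolded nil2_simps])
    show "?c \<cdot> l \<in> hom (Nil2 C) L ?P" "\<zero> L ?P \<in> hom (Nil2 C) L ?P"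
      using cc l(1) L n by (simp_all add: hom_nil2 hom_iff)
    show "proj1 (Nil2 C) X Y \<cdot> (?c \<cdot> l) = proj1 (Nil2 C) X Y \<cdot> \<zero> L ?P"
      "proj2 (Nil2 C) X Y \<cdot> (?c \<cdot> l) = proj2 (Nil2 C) X Y \<cdot> \<zero> L ?P"
      using reassoc[OF c(2), of l] reassoc[OF c(3), of l] rl p cc(1) l(1) L by (simp_all add: hom_iff)
  qed
  then have "?c \<cdot> l = N.zero L ?P" using L cc by (simp add: nil2_zero)
  moreover have "l \<in> hom (Nil2 C) L ?S" using l L n by (simp add: hom_nil2)
  ultimately obtain u where "u \<in> hom (Nil2 C) L ?T" "?k \<cdot> u = l" using k' by blast
  then have u: "u \<in> hom C L ?T" "?k \<cdot> u = l" by (simp_all add: hom_nil2)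
  obtain w where w: "w \<in> hom C ?T L" "l \<cdot> w = ?k" using l(4)[OF kh dz[OF kh r1 r2]] by blast
  have "?k \<cdot> (u \<cdot> w) = ?k \<cdot> \<one> ?T" using reassoc[OF u(2), of w] u(1) w kh T by (simp add: hom_iff)
  moreover have "u \<cdot> w \<in> hom (Nil2 C) ?T ?T" "\<one> ?T \<in> hom (Nil2 C) ?T ?T"
    using u(1) w(1) T by (simp_all add: hom_nil2 hom_iff)
  moreover have "is_mono (Nil2 C) ?k" using k' by blast
  ultimately have uw: "u \<cdot> w = \<one> ?T" using N.is_monoD[OF _ kN, unfolded nil2_simps] by blast
  \<comment> \<open>As \<open>u \<cdot> w\<close> is an identity, \<open>w\<close> is split monic,
    and \<open>nincl\<close>, being \<open>l \<cdot> w\<close>, inherits monicity from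
    \<open>l\<close>.\<close>
  show "is_mono C ?k"
  proof (rule is_monoI[OF kh])
    fix W a b assume a: "a \<in> hom C W ?T" "b \<in> hom C W ?T" "?k \<cdot> a = ?k \<cdot> b"
    have "l \<cdot> (w \<cdot> a) = l \<cdot> (w \<cdot> b)"
      using reassoc[OF w(2), of a] reassoc[OF w(2), of b] a l(1) w(1) by (simp add: hom_iff)
    then have wab: "w \<cdot> a = w \<cdot> b"
      by (rule is_monoD[OF l(2,1), of _ W, rotated 2]) (use a w in \<open>simp_all add: hom_iff\<close>)
    have "u \<cdot> (w \<cdot> a) = a" "u \<cdot> (w \<cdot> b) = b"
      using reassoc[OF uw, of a] reassoc[OF uw, of b] a(1,2) u(1) w(1) by (simp_all add: hom_iff)
    then show "a = b" unfolding wab by simp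
  qed
  fix V g assume g: "g \<in> hom C V ?S" "nret1 X Y \<cdot> g = \<zero> V X" "nret2 X Y \<cdot> g = \<zero> V Y"
  then obtain h where h: "h \<in> hom C V L" "l \<cdot> h = g" using l(4)[OF g(1) dz[OF g]] by blast
  have "?k \<cdot> (u \<cdot> h) = g" using reassoc[OF u(2), of h] u(1) h kh by (simp add: hom_iff)
  then show "\<exists>h \<in> hom C V ?T. ?k \<cdot> h = g" using h u(1) by (intro bexI[of _ "u \<cdot> h"]) (simp_all add: hom_iff)
qed

section \<open>Additivity of the bilinear product\<close>

lemma nmap_hom:
  assumes "g \<in> hom C Y Z" "two_nilpotent C X" "two_nilpotent C Y" "two_nilpotent C Z"
  shows "nmap X g \<in> hom C (nsum X Y) (nsum X Z)"
  unfolding nmap_eq[OF assms(1,2,4)] using assms by (simp add: hom_iff)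

lemma nmap_comp:
  assumes "f \<in> hom C Y Z" "g \<in> hom C Z W"
    and n: "two_nilpotent C X" "two_nilpotent C Y" "two_nilpotent C Z" "two_nilpotent C W"
  shows "nmap X (g \<cdot> f) = nmap X g \<cdot> nmap X f"
proof -
  have gf: "g \<cdot> f \<in> hom C Y W" using assms by (simp add: hom_iff)
  show ?thesis unfolding nmap_eq[OF gf n(1,4)] nmap_eq[OF assms(1) n(1,3)] nmap_eq[OF assms(2) n(1,4)]
    by (rule nsum_eqI[of _ X Y "nsum X W"]) (use assms in \<open>simp_all add: hom_iff\<close>)
qed

lemma nmap_ident: "two_nilpotent C X \<Longrightarrow> two_nilpotent C Y \<Longrightarrow> nmap X (\<one> Y) = \<one> (nsum X Y)"
proof -
  assume n: "two_nilpotent C X" "two_nilpotent C Y"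
  then have h: "\<one> Y \<in> hom C Y Y" by (simp add: hom_iff)
  show ?thesis unfolding nmap_eq[OF h n]
    by (rule nsum_eqI[of _ X Y "nsum X Y"]) (use n in \<open>simp_all add: hom_iff\<close>)
qed

lemma nret_nmap:
  assumes g: "g \<in> hom C Y Z" and n: "two_nilpotent C X" "two_nilpotent C Y" "two_nilpotent C Z"
  shows "nret1 X Z \<cdot> nmap X g = nret1 X Y" "nret2 X Z \<cdot> nmap X g = g \<cdot> nret2 X Y"
  unfolding nmap_eq[OF g n(1,3)]
   apply (rule nsum_eqI[of _ X Y X]; use assms in \<open>simp add: hom_iff\<close>)
  apply (rule nsum_eqI[of _ X Y Z]; use assms in \<open>simp add: hom_iff\<close>)
  done

text \<open>The arrow of sums is compatible with both retractions, so it restricts to cosmash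
  products; monicity of \<open>nincl\<close> makes the restriction the arrow described by
  \<open>cosmash_map\<close>.\<close>

lemma smap:
  assumes g: "g \<in> hom C Y Z" and n: "two_nilpotent C X" "two_nilpotent C Y" "two_nilpotent C Z"
  shows smap_hom: "smap X g \<in> hom C (nsmash X Y) (nsmash X Z)"
    and nincl_smap: "nincl X Z \<cdot> smap X g = nmap X g \<cdot> nincl X Y"
proof -
  note h = nmap_hom[OF assms] and k = nincl_hom[OF n(1,2)]
  note t = nsmash_two_nilpotent[OF n(1,2)] nsmash_two_nilpotent[OF n(1,3)]
  have "nmap X g \<cdot> nincl X Y \<in> hom C (nsmash X Y) (nsum X Z)" using h k by (simp add: hom_iff)
  moreover have "nret1 X Z \<cdot> (nmap X g \<cdot> nincl X Y) = \<zero> (nsmash X Y) X"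
    using reassoc[OF nret_nmap(1)[OF assms], of "nincl X Y"] nret1_nincl[OF n(1,2)] h k n by (simp add: hom_iff)
  moreover have "nret2 X Z \<cdot> (nmap X g \<cdot> nincl X Y) = \<zero> (nsmash X Y) Z"
    using reassoc[OF nret_nmap(2)[OF assms], of "nincl X Y"] nret2_nincl[OF n(1,2)] h k n g t
    by (simp add: hom_iff)
  ultimately obtain s where s: "s \<in> hom C (nsmash X Y) (nsmash X Z)" "nincl X Z \<cdot> s = nmap X g \<cdot> nincl X Y"
    using nincl_lift[OF n(1,3)] by blast
  let ?P = "\<lambda>s. s \<in> hom C (nsmash X Y) (nsmash X Z) \<and> nincl X Z \<cdot> s = nmap X g \<cdot> nincl X Y"
  have "\<exists>!s. ?P s"
    using s is_monoD[OF nincl_mono[OF n(1,3)] nincl_hom[OF n(1,3)]] by (intro ex1I[of _ s]) auto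
  moreover have "smap X g = (THE s. ?P s)"
    unfolding cosmash_map_def using g n t by (simp add: hom_iff hom_nil2)
  ultimately have "?P (smap X g)" using theI'[of ?P] by simp
  then show "smap X g \<in> hom C (nsmash X Y) (nsmash X Z)" "nincl X Z \<cdot> smap X g = nmap X g \<cdot> nincl X Y" by auto
qed

lemma smap_eqI:
  assumes n: "two_nilpotent C X" "two_nilpotent C Z"
    and u: "u \<in> hom C W (nsmash X Z)" "v \<in> hom C W (nsmash X Z)" "nincl X Z \<cdot> u = nincl X Z \<cdot> v"
  shows "u = v"
  using is_monoD[OF nincl_mono[OF n] nincl_hom[OF n]] u by blast

lemma smap_comp:
  assumes f: "f \<in> hom C Y Z" and g: "g \<in> hom C Z W"
    and n: "two_nilpotent C X" "two_nilpotent C Y" "two_nilpotent C Z" "two_nilpotent C W"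
  shows "smap X (g \<cdot> f) = smap X g \<cdot> smap X f"
proof -
  have gf: "g \<cdot> f \<in> hom C Y W" using f g by (simp add: hom_iff)
  note s = smap[OF gf n(1,2,4)] smap[OF f n(1,2,3)] smap[OF g n(1,3,4)]
  note m = nmap_hom[OF f n(1,2,3)] nmap_hom[OF g n(1,3,4)]
  show ?thesis
    by (rule smap_eqI[OF n(1,4), of _ "nsmash X Y"])
      (use s m reassoc2[OF s(6), of "smap X f"] nmap_comp[OF f g n] nincl_hom[OF n(1,2)] nincl_hom[OF n(1,3)]
         nincl_hom[OF n(1,4)] in \<open>simp_all add: hom_iff\<close>)
qed

lemma smap_ident:
  assumes n: "two_nilpotent C X" "two_nilpotent C Y"
  shows "smap X (\<one> Y) = \<one> (nsmash X Y)"
proof -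
  have h: "\<one> Y \<in> hom C Y Y" using n by (simp add: hom_iff)
  show ?thesis
    by (rule smap_eqI[OF n, of _ "nsmash X Y"])
      (use smap[OF h n(1,2,2)] nmap_ident[OF n] nincl_hom[OF n] n in \<open>simp_all add: hom_iff\<close>)
qed

text \<open>The induced arrow of sums factors through the retraction \<open>nret1\<close>, which
  kills the cosmash product.\<close>

lemma smap_zero:
  assumes n: "two_nilpotent C X" "two_nilpotent C Y" "two_nilpotent C Z"
  shows "smap X (\<zero> Y Z) = \<zero> (nsmash X Y) (nsmash X Z)"
proof -
  have h: "\<zero> Y Z \<in> hom C Y Z" using n by (simp add: hom_iff)
  note t = nsmash_two_nilpotent[OF n(1,2)] nsmash_two_nilpotent[OF n(1,3)]
  have "nmap X (\<zero> Y Z) = nin1 X Z \<cdot> nret1 X Y" unfolding nmap_eq[OF h n(1,3)]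
    by (rule nsum_eqI[of _ X Y "nsum X Z"]) (use n in \<open>simp_all add: hom_iff\<close>)
  then have "nmap X (\<zero> Y Z) \<cdot> nincl X Y = \<zero> (nsmash X Y) (nsum X Z)"
    using n nret1_nincl[OF n(1,2)] nincl_hom[OF n(1,2)] t by (simp add: hom_iff)
  then have eq: "nincl X Z \<cdot> smap X (\<zero> Y Z) = \<zero> (nsmash X Y) (nsum X Z)" using smap[OF h n] by simp
  show ?thesis
    by (rule smap_eqI[OF n(1,3), of _ "nsmash X Y"])
      (use eq smap_hom[OF h n] nincl_hom[OF n(1,3)] t in \<open>simp_all add: hom_iff\<close>)
qed

text \<open>
  The ternary cosmash product computed among two-nilpotent objects vanishes, being a regular quotient of
  a subobject of \<open>X + Y + Z\<close> that is killed by every arrow to a two-nilpotent object.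
\<close>

lemma nsum_cross_effect_zero:
  assumes n: "two_nilpotent C X" "two_nilpotent C Y" "two_nilpotent C Z"
    and g: "g \<in> hom C V (nsum X (nsum Y Z))"
    and z: "nret2 X (nsum Y Z) \<cdot> g = \<zero> V (nsum Y Z)"
      "nmap X (nret1 Y Z) \<cdot> g = \<zero> V (nsum X Y)" "nmap X (nret2 Y Z) \<cdot> g = \<zero> V (nsum X Z)"
  shows "g = \<zero> V (nsum X (nsum Y Z))"
proof -
  let ?W = "nsum Y Z"
  let ?S = "nsum X ?W"
  have o: "X \<in> Obj C" "Y \<in> Obj C" "Z \<in> Obj C" "V \<in> Obj C" using n g by (simp_all add: hom_iff)
  note nW = nsum_two_nilpotent[OF n(2,3)]
  note nS = nsum_two_nilpotent[OF n(1) nW]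
  let ?i = "nin1 X ?W" and ?j = "nin2 X ?W \<cdot> nin1 Y Z" and ?k = "nin2 X ?W \<cdot> nin2 Y Z"
  let ?e = "copairing C (copairing C ?i ?j) ?k"
  have ijk: "?i \<in> hom C X ?S" "?j \<in> hom C Y ?S" "?k \<in> hom C Z ?S" using n by (simp_all add: hom_iff)
  have e: "?e \<in> hom C (sum3 X Y Z) ?S" using ijk o by (simp add: hom_iff)
  \<comment> \<open>A subobject containing the three summands meets \<open>Y \<oplus> Z\<close> in a
    subobject containing \<open>Y\<close> and \<open>Z\<close>; hence it contains
    \<open>Y \<oplus> Z\<close>, and then everything.\<close>
  have er: "is_regular_epi C ?e"
  proof (rule regular_epi_if_extremal[OF e])
    fix D m h assume m: "m \<in> hom C D ?S" "is_mono C m" and h: "h \<in> hom C (sum3 X Y Z) D" "m \<cdot> h = ?e"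
    let ?in1 = "inj1 C (coprod_obj C X Y) Z \<cdot> inj1 C X Y" and ?in2 = "inj1 C (coprod_obj C X Y) Z \<cdot> inj2 C X Y"
      and ?in3 = "inj2 C (coprod_obj C X Y) Z"
    have mi: "m \<cdot> (h \<cdot> ?in1) = ?i" "m \<cdot> (h \<cdot> ?in2) = ?j" "m \<cdot> (h \<cdot> ?in3) = ?k"
      using reassoc[OF h(2), of ?in1] reassoc[OF h(2), of ?in2] reassoc[OF h(2), of ?in3] h(1) m(1) ijk o
      by (simp_all add: hom_iff)
    have nj: "nin2 X ?W \<in> hom C ?W ?S" using n by (simp add: hom_iff)
    obtain P p q where P: "p \<in> hom C P D" "q \<in> hom C P ?W" "m \<cdot> p = nin2 X ?W \<cdot> q" "is_pullback C m (nin2 X ?W) p q"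
      "\<And>W' u v. \<lbrakk>u \<in> hom C W' D; v \<in> hom C W' ?W; m \<cdot> u = nin2 X ?W \<cdot> v\<rbrakk> \<Longrightarrow> \<exists>h \<in> hom C W' P. p \<cdot> h = u \<and> q \<cdot> h = v"
      by (rule pullbackE[OF m(1) nj]) blast
    have qm: "is_mono C q" by (rule mono_pullback_stable[OF m(2) P(4) m(1) nj P(1,2)])
    have "\<exists>a \<in> hom C Y P. p \<cdot> a = h \<cdot> ?in2 \<and> q \<cdot> a = nin1 Y Z"
      by (rule P(5)) (use h(1) o n mi in \<open>simp_all add: hom_iff\<close>)
    then obtain a where a: "a \<in> hom C Y P" "q \<cdot> a = nin1 Y Z" by blast
    have "\<exists>a \<in> hom C Z P. p \<cdot> a = h \<cdot> ?in3 \<and> q \<cdot> a = nin2 Y Z"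
      by (rule P(5)) (use h(1) o n mi in \<open>simp_all add: hom_iff\<close>)
    then obtain b where b: "b \<in> hom C Z P" "q \<cdot> b = nin2 Y Z" by blast
    obtain d where d: "d \<in> hom C ?W P" "q \<cdot> d = \<one> ?W"
      using nsum_generation[OF n(2,3) P(2) qm a b] by blast
    have "m \<cdot> (p \<cdot> d) = nin2 X ?W"
      using reassoc2[OF P(3), of d] d m(1) P(1,2) n by (simp add: hom_iff)
    moreover have "p \<cdot> d \<in> hom C ?W D" "h \<cdot> ?in1 \<in> hom C X D" using P d h o by (simp_all add: hom_iff)
    ultimately show "\<exists>n \<in> hom C ?S D. m \<cdot> n = \<one> ?S"
      using nsum_generation[OF n(1) nW m _ mi(1)] by blast
  qed
  \<comment> \<open>Counterparts on \<open>X \<oplus> (Y \<oplus> Z)\<close> of the idempotents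
    killing \<open>X\<close>, \<open>Y\<close> and \<open>Z\<close> respectively.\<close>
  let ?k1 = "nin2 X ?W \<cdot> nret2 X ?W"
  let ?k2 = "nmap X (nin2 Y Z \<cdot> nret2 Y Z)" and ?k3 = "nmap X (nin1 Y Z \<cdot> nret1 Y Z)"
  have r: "nin1 Y Z \<in> hom C Y ?W" "nin2 Y Z \<in> hom C Z ?W" "nret1 Y Z \<in> hom C ?W Y" "nret2 Y Z \<in> hom C ?W Z"
    "nin1 Y Z \<cdot> nret1 Y Z \<in> hom C ?W ?W" "nin2 Y Z \<cdot> nret2 Y Z \<in> hom C ?W ?W"
    using n by (simp_all add: hom_iff)
  have k: "?k1 \<in> hom C ?S ?S" "?k2 \<in> hom C ?S ?S" "?k3 \<in> hom C ?S ?S"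
    using n nmap_hom[OF r(6) n(1) nW nW] nmap_hom[OF r(5) n(1) nW nW] by (simp_all add: hom_iff)
  note kk = kill_hom[OF o(1-3)]
  have nat: "?e \<cdot> kill1 X Y Z = ?k1 \<cdot> ?e" "?e \<cdot> kill2 X Y Z = ?k2 \<cdot> ?e" "?e \<cdot> kill3 X Y Z = ?k3 \<cdot> ?e"
  proof -
    \<comment> \<open>An opaque name keeps the simplifier from unfolding the nested copairings; only
      the values on the three summands matter.\<close>
    define e where "e = ?e"
    let ?in1 = "inj1 C (coprod_obj C X Y) Z \<cdot> inj1 C X Y" and ?in2 = "inj1 C (coprod_obj C X Y) Z \<cdot> inj2 C X Y"
      and ?in3 = "inj2 C (coprod_obj C X Y) Z"
    have eh: "e \<in> hom C (sum3 X Y Z) ?S" using e unfolding e_def .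
    have ein: "e \<cdot> ?in1 = ?i" "e \<cdot> ?in2 = ?j" "e \<cdot> ?in3 = ?k"
      unfolding e_def using ijk o by (simp_all add: hom_iff)
    have k1: "?k1 \<cdot> ?i = \<zero> X ?S" "?k1 \<cdot> ?j = ?j" "?k1 \<cdot> ?k = ?k" using n by simp_all
    have k2: "?k2 \<cdot> ?i = ?i" "?k2 \<cdot> ?j = \<zero> Y ?S" "?k2 \<cdot> ?k = ?k"
      unfolding nmap_eq[OF r(6) n(1) nW] using n by simp_all
    have k3: "?k3 \<cdot> ?i = ?i" "?k3 \<cdot> ?j = ?j" "?k3 \<cdot> ?k = \<zero> Z ?S"
      unfolding nmap_eq[OF r(5) n(1) nW] using n by simp_all
    have nat: "e \<cdot> x = y \<cdot> e"
      if x: "x \<in> hom C (sum3 X Y Z) (sum3 X Y Z)" and y: "y \<in> hom C ?S ?S"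
        and "e \<cdot> (x \<cdot> ?in1) = y \<cdot> ?i" "e \<cdot> (x \<cdot> ?in2) = y \<cdot> ?j" "e \<cdot> (x \<cdot> ?in3) = y \<cdot> ?k" for x y
    proof (rule sum3_eqI[OF comp_in_hom[OF x eh] comp_in_hom[OF eh y] o(1-3)])
      have t: "x \<in> Arr C" "Dom C x = sum3 X Y Z" "Cod C x = sum3 X Y Z" "y \<in> Arr C" "Dom C y = ?S"
        "e \<in> Arr C" "Dom C e = sum3 X Y Z" "Cod C e = ?S"
        using x y eh by (simp_all only: hom_iff)
      show "(e \<cdot> x) \<cdot> ?in1 = (y \<cdot> e) \<cdot> ?in1" using that(3) ein(1) t o by simp
      show "(e \<cdot> x) \<cdot> ?in2 = (y \<cdot> e) \<cdot> ?in2" using that(4) ein(2) t o by simp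
      show "(e \<cdot> x) \<cdot> ?in3 = (y \<cdot> e) \<cdot> ?in3" using that(5) ein(3) t o by simp
    qed
    have z: "e \<cdot> \<zero> U (sum3 X Y Z) = \<zero> U ?S" if "U \<in> Obj C" for U
      using eh that by (simp add: hom_iff)
    show "?e \<cdot> kill1 X Y Z = ?k1 \<cdot> ?e" "?e \<cdot> kill2 X Y Z = ?k2 \<cdot> ?e" "?e \<cdot> kill3 X Y Z = ?k3 \<cdot> ?e"
      unfolding e_def[symmetric]
      by (rule nat[OF kk(1) k(1)]; simp only: kill_in[OF o(1-3)] k1 ein z o)
        (rule nat[OF kk(2) k(2)] nat[OF kk(3) k(3)]; simp only: kill_in[OF o(1-3)] k2 k3 ein z o)+
  qed
  have o1: "\<one> ?S \<in> hom C ?S ?S" using n by (simp add: hom_iff)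
  \<comment> \<open>Vanishing is applied to the identity: as
    \<open>X \<oplus> (Y \<oplus> Z)\<close> is two-nilpotent, the copairing of the three inclusions
    kills the ternary cosmash product.\<close>
  have "\<one> ?S \<cdot> g = \<zero> V ?S"
  proof (rule cross_effect_vanish[OF o(1-3) er e k nat o1 _ g])
    fix V' g' assume "cross_effect X Y Z V' g'"
    then show "\<one> ?S \<cdot> (?e \<cdot> g') = \<zero> V' ?S"
      using two_nilpotent_cross_effect[OF nS ijk] e n by (simp add: cross_effect_def hom_iff)
  next
    show "?k1 \<cdot> g = \<zero> V ?S" using z(1) g n o by (simp add: hom_iff)
    note m = nmap_hom[OF r(3) n(1) nW n(2)] nmap_hom[OF r(4) n(1) nW n(3)]
      nmap_hom[OF r(1) n(1) n(2) nW] nmap_hom[OF r(2) n(1) n(3) nW]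
    show "?k2 \<cdot> g = \<zero> V ?S" "?k3 \<cdot> g = \<zero> V ?S"
      using z m g n o nmap_comp[OF r(4,2) n(1) nW n(3) nW] nmap_comp[OF r(3,1) n(1) nW n(2) nW]
      by (simp_all add: hom_iff)
  qed
  then show ?thesis using g by (simp add: hom_iff)
qed

text \<open>An element of \<open>X \<otimes> (Y \<oplus> Z)\<close> killed by both retractions
  satisfies all three conditions of a cross-effect, hence is zero. This is the half of additivity
  that rests on two-nilpotency; surjectivity comes from the generation of a product by its two
  axes.\<close>

lemma smap_ret_jointly_monic:
  assumes n: "two_nilpotent C X" "two_nilpotent C Y" "two_nilpotent C Z"
  shows "is_mono C (pairing C (smap X (nret1 Y Z)) (smap X (nret2 Y Z)))"
proof -
  let ?W = "nsum Y Z" let ?p = "smap X (nret1 Y Z)" and ?q = "smap X (nret2 Y Z)"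
  note nW = nsum_two_nilpotent[OF n(2,3)]
  have r: "nret1 Y Z \<in> hom C ?W Y" "nret2 Y Z \<in> hom C ?W Z" using n by (simp_all add: hom_iff)
  note s = smap[OF r(1) n(1) nW n(2)] smap[OF r(2) n(1) nW n(3)]
  note m = nmap_hom[OF r(1) n(1) nW n(2)] nmap_hom[OF r(2) n(1) nW n(3)]
  note t = nsmash_two_nilpotent[OF n(1,2)] nsmash_two_nilpotent[OF n(1,3)] nsmash_two_nilpotent[OF n(1) nW]
  note i = nincl_hom[OF n(1,2)] nincl_hom[OF n(1,3)] nincl_hom[OF n(1) nW]
  have pq: "pairing C ?p ?q \<in> hom C (nsmash X ?W) (prod_obj C (nsmash X Y) (nsmash X Z))"
    using s t by (simp add: hom_iff)
  show ?thesis
  proof (rule mono_if_trivial_kernel[OF pq])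
    fix V h assume h: "h \<in> hom C V (nsmash X ?W)" "pairing C ?p ?q \<cdot> h = \<zero> V (prod_obj C (nsmash X Y) (nsmash X Z))"
    have V: "V \<in> Obj C" using h by (simp add: hom_iff)
    have "proj1 C (nsmash X Y) (nsmash X Z) \<cdot> (pairing C ?p ?q \<cdot> h) = \<zero> V (nsmash X Y)"
      "proj2 C (nsmash X Y) (nsmash X Z) \<cdot> (pairing C ?p ?q \<cdot> h) = \<zero> V (nsmash X Z)"
      unfolding h(2) using t V by simp_all
    then have ph: "?p \<cdot> h = \<zero> V (nsmash X Y)" "?q \<cdot> h = \<zero> V (nsmash X Z)"
      using s t h(1) by (simp_all add: hom_iff)
    let ?g = "nincl X ?W \<cdot> h"
    have g: "?g \<in> hom C V (nsum X ?W)" using i h by (simp add: hom_iff)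
    have gz: "?g = \<zero> V (nsum X ?W)"
    proof (rule nsum_cross_effect_zero[OF n g])
      show "nret2 X ?W \<cdot> ?g = \<zero> V ?W"
        using reassoc[OF nret2_nincl[OF n(1) nW], of h] i h(1) n t V by (simp add: hom_iff)
      show "nmap X (nret1 Y Z) \<cdot> ?g = \<zero> V (nsum X Y)"
        using reassoc2[OF s(2), of h] ph h(1) s(1) i m V n by (simp add: hom_iff)
      show "nmap X (nret2 Y Z) \<cdot> ?g = \<zero> V (nsum X Z)"
        using reassoc2[OF s(4), of h] ph h(1) s(3) i m V n by (simp add: hom_iff)
    qed
    show "h = \<zero> V (nsmash X ?W)"
      by (rule smap_eqI[OF n(1) nW, of _ V]) (use gz h(1) i V t n in \<open>simp_all add: hom_iff\<close>)
  qed
qed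

section \<open>Abelian objects\<close>

lemma prod_kernel_factor:
  assumes o: "X \<in> Obj C" "Y \<in> Obj C" and g: "g \<in> hom C W (prod_obj C X Y)" "proj1 C X Y \<cdot> g = \<zero> W X"
  shows "g = pairing C (\<zero> Y X) (\<one> Y) \<cdot> (proj2 C X Y \<cdot> g)"
  by (rule prod_eqI[of X Y _ W]) (use o g in \<open>simp_all add: hom_iff\<close>)

text \<open>The first projection with section \<open>(1, 0)\<close> is a point whose kernel is the
  second axis.\<close>

lemma prod_generation:
  assumes o: "X \<in> Obj C" "Y \<in> Obj C"
    and m: "m \<in> hom C D (prod_obj C X Y)" "is_mono C m"
    and a: "a \<in> hom C X D" "m \<cdot> a = pairing C (\<one> X) (\<zero> X Y)"
    and b: "b \<in> hom C Y D" "m \<cdot> b = pairing C (\<zero> Y X) (\<one> Y)"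
  shows "\<exists>n \<in> hom C (prod_obj C X Y) D. m \<cdot> n = \<one> (prod_obj C X Y)"
proof (rule point_generation[OF _ _ _ m a])
  show "proj1 C X Y \<in> hom C (prod_obj C X Y) X" "pairing C (\<one> X) (\<zero> X Y) \<in> hom C X (prod_obj C X Y)"
    "proj1 C X Y \<cdot> pairing C (\<one> X) (\<zero> X Y) = \<one> X"
    using o by (simp_all add: hom_iff)
  fix W g assume g: "g \<in> hom C W (prod_obj C X Y)" "proj1 C X Y \<cdot> g = \<zero> W X"
  have "m \<cdot> (b \<cdot> (proj2 C X Y \<cdot> g)) = pairing C (\<zero> Y X) (\<one> Y) \<cdot> (proj2 C X Y \<cdot> g)"
    by (rule reassoc[OF b(2)]) (use b m g o in \<open>simp_all add: hom_iff\<close>)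
  also have "\<dots> = g" using prod_kernel_factor[OF o g] by simp
  finally have "m \<cdot> (b \<cdot> (proj2 C X Y \<cdot> g)) = g" .
  moreover have "b \<cdot> (proj2 C X Y \<cdot> g) \<in> hom C W D" using b g o by (simp add: hom_iff)
  ultimately show "\<exists>h \<in> hom C W D. m \<cdot> h = g" by blast
qed

text \<open>Uses the same point as generation by the axes. It lets laws of a unital multiplication
  be checked on the axes.\<close>

lemma prod_jointly_epic:
  assumes o: "X \<in> Obj C" "Y \<in> Obj C"
    and u: "u \<in> hom C (prod_obj C X Y) W" "v \<in> hom C (prod_obj C X Y) W"
    and "u \<cdot> pairing C (\<one> X) (\<zero> X Y) = v \<cdot> pairing C (\<one> X) (\<zero> X Y)"
    and eq: "u \<cdot> pairing C (\<zero> Y X) (\<one> Y) = v \<cdot> pairing C (\<zero> Y X) (\<one> Y)"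
  shows "u = v"
proof (rule point_jointly_epic[OF _ _ _ u assms(5)])
  show "proj1 C X Y \<in> hom C (prod_obj C X Y) X" "pairing C (\<one> X) (\<zero> X Y) \<in> hom C X (prod_obj C X Y)"
    "proj1 C X Y \<cdot> pairing C (\<one> X) (\<zero> X Y) = \<one> X"
    using o by (simp_all add: hom_iff)
  fix V g assume g: "g \<in> hom C V (prod_obj C X Y)" "proj1 C X Y \<cdot> g = \<zero> V X"
  have "u \<cdot> (pairing C (\<zero> Y X) (\<one> Y) \<cdot> (proj2 C X Y \<cdot> g)) = v \<cdot> (pairing C (\<zero> Y X) (\<one> Y) \<cdot> (proj2 C X Y \<cdot> g))"
    by (rule reassoc2[OF eq]) (use u g o in \<open>simp_all add: hom_iff\<close>)
  then show "u \<cdot> g = v \<cdot> g" unfolding prod_kernel_factor[OF o g, symmetric] .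
qed

text \<open>Commutativity and associativity hold because both sides agree on the axes; inverses
  exist because the shear \<open>(x, y) \<mapsto> (x, x + y)\<close> is invertible.\<close>

lemma abelian_if_unital_magma:
  assumes T: "T \<in> Obj C" and m: "m \<in> hom C (prod_obj C T T) T"
    and ml: "m \<cdot> pairing C (\<one> T) (\<zero> T T) = \<one> T" and mr: "m \<cdot> pairing C (\<zero> T T) (\<one> T) = \<one> T"
  shows "is_abelian_obj C T"
proof -
  let ?P = "prod_obj C T T" and ?p = "proj1 C T T" and ?q = "proj2 C T T"
  have t: "m \<in> Arr C" "Dom C m = ?P" "Cod C m = T" using m by (simp_all add: hom_iff)
  have ml': "m \<cdot> pairing C f (\<zero> W T) = f" and mr': "m \<cdot> pairing C (\<zero> W T) f = f" if f: "f \<in> hom C W T" for f W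
  proof -
    have h: "\<one> T \<in> hom C T T" "\<zero> T T \<in> hom C T T" using T by (simp_all add: hom_iff)
    have "pairing C f (\<zero> W T) = pairing C (\<one> T) (\<zero> T T) \<cdot> f" "pairing C (\<zero> W T) f = pairing C (\<zero> T T) (\<one> T) \<cdot> f"
      using pairing_comp[OF h f] pairing_comp[OF h(2,1) f] f T by (simp_all add: hom_iff)
    then show "m \<cdot> pairing C f (\<zero> W T) = f" "m \<cdot> pairing C (\<zero> W T) f = f"
      using reassoc[OF ml, of f] reassoc[OF mr, of f] f t T by (simp_all add: hom_iff)
  qed
  have comm: "m \<cdot> pairing C ?q ?p = m"
  proof (rule prod_jointly_epic[OF T T])
    have h: "?q \<in> hom C ?P T" "?p \<in> hom C ?P T" "pairing C (\<one> T) (\<zero> T T) \<in> hom C T ?P"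
      "pairing C (\<zero> T T) (\<one> T) \<in> hom C T ?P" using T by (simp_all add: hom_iff)
    show "m \<cdot> pairing C ?q ?p \<in> hom C ?P T" "m \<in> hom C ?P T" using t T by (simp_all add: hom_iff)
    show "(m \<cdot> pairing C ?q ?p) \<cdot> pairing C (\<one> T) (\<zero> T T) = m \<cdot> pairing C (\<one> T) (\<zero> T T)"
      "(m \<cdot> pairing C ?q ?p) \<cdot> pairing C (\<zero> T T) (\<one> T) = m \<cdot> pairing C (\<zero> T T) (\<one> T)"
      using t T pairing_comp[OF h(1-3)] pairing_comp[OF h(1,2,4)] ml mr by simp_all
  qed
  let ?h = "pairing C ?p m"
  have h: "?h \<in> hom C ?P ?P" using t T by (simp add: hom_iff)
  have hmono: "is_mono C ?h"
  proof (rule mono_if_trivial_kernel[OF h])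
    fix W g assume g: "g \<in> hom C W ?P" "?h \<cdot> g = \<zero> W ?P"
    have W: "W \<in> Obj C" using g by (simp add: hom_iff)
    have "?p \<cdot> (?h \<cdot> g) = \<zero> W T" "?q \<cdot> (?h \<cdot> g) = \<zero> W T" unfolding g(2) using T W by simp_all
    then have z: "?p \<cdot> g = \<zero> W T" "m \<cdot> g = \<zero> W T" using g(1) t T by (simp_all add: hom_iff)
    have g': "g = pairing C (\<zero> T T) (\<one> T) \<cdot> (?q \<cdot> g)" by (rule prod_kernel_factor[OF T T g(1) z(1)])
    have "m \<cdot> (pairing C (\<zero> T T) (\<one> T) \<cdot> (?q \<cdot> g)) = \<one> T \<cdot> (?q \<cdot> g)"
      by (rule reassoc[OF mr]) (use g(1) t T in \<open>simp_all add: hom_iff\<close>)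
    then have "?q \<cdot> g = \<zero> W T" using g(1) z(2) T unfolding g'[symmetric] by (simp add: hom_iff)
    then show "g = \<zero> W ?P" by (intro prod_eqI[OF T T, of g W]) (use g(1) z(1) T W in \<open>simp_all add: hom_iff\<close>)
  qed
  have d: "pairing C (\<one> T) (\<one> T) \<in> hom C T ?P" "?p \<cdot> pairing C (\<one> T) (\<one> T) = \<one> T"
    "pairing C (\<one> T) (\<zero> T T) \<in> hom C T ?P" "?p \<in> hom C ?P T"
    using T by (simp_all add: hom_iff)
  have hd: "?h \<cdot> pairing C (\<one> T) (\<zero> T T) = pairing C (\<one> T) (\<one> T)"
    using pairing_comp[OF d(4) m d(3)] ml T by simp
  \<comment> \<open>The point used here is the first projection with the diagonal as section: the
    shear sends \<open>(x, 0)\<close> to \<open>(x, x)\<close> and fixes the kernel elements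
    \<open>(0, y)\<close>.\<close>
  have "\<exists>n \<in> hom C ?P ?P. ?h \<cdot> n = \<one> ?P"
  proof (rule point_generation[OF d(4,1,2) h hmono d(3) hd])
    fix W g assume g: "g \<in> hom C W ?P" "?p \<cdot> g = \<zero> W T"
    have g': "g = pairing C (\<zero> T T) (\<one> T) \<cdot> (?q \<cdot> g)" by (rule prod_kernel_factor[OF T T g])
    have "m \<cdot> (pairing C (\<zero> T T) (\<one> T) \<cdot> (?q \<cdot> g)) = \<one> T \<cdot> (?q \<cdot> g)"
      by (rule reassoc[OF mr]) (use g(1) t T in \<open>simp_all add: hom_iff\<close>)
    then have mg: "m \<cdot> g = ?q \<cdot> g" using g(1) T unfolding g'[symmetric] by (simp add: hom_iff)
    have "?h \<cdot> g = g"
      by (rule prod_eqI[OF T T, of _ W]) (use g(1) mg t T in \<open>simp_all add: hom_iff\<close>)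
    then show "\<exists>h' \<in> hom C W ?P. ?h \<cdot> h' = g" using g(1) by blast
  qed
  then obtain n where n: "n \<in> hom C ?P ?P" "?h \<cdot> n = \<one> ?P" by blast
  \<comment> \<open>The preimage of \<open>(x, 0)\<close> under the shear is \<open>(x, -x)\<close>;
    its second component is the inverse.\<close>
  define c where "c = n \<cdot> pairing C (\<one> T) (\<zero> T T)"
  define i where "i = ?q \<cdot> c"
  have c: "c \<in> hom C T ?P" unfolding c_def using n d(3) by (simp add: hom_iff)
  have i: "i \<in> hom C T T" unfolding i_def using c T by (simp add: hom_iff)
  have "?h \<cdot> c = pairing C (\<one> T) (\<zero> T T)"
    unfolding c_def using comp_assoc[OF d(3) n(1) h] comp_ident_left[OF d(3)] by (simp only: n(2))
  then have "?p \<cdot> (?h \<cdot> c) = \<one> T" "?q \<cdot> (?h \<cdot> c) = \<zero> T T" using T by simp_all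
  then have c': "?p \<cdot> c = \<one> T" "m \<cdot> c = \<zero> T T" using c t T by (simp_all add: hom_iff)
  have qc: "?q \<cdot> c = i" by (simp add: i_def)
  have ci: "c = pairing C (\<one> T) i"
    by (rule prod_eqI[OF T T c]) (use c' qc i T in \<open>simp_all add: hom_iff\<close>)
  have inv1: "m \<cdot> pairing C (\<one> T) i = \<zero> T T" using c'(2) unfolding ci .
  have "pairing C ?q ?p \<cdot> c = pairing C i (\<one> T)"
    by (rule prod_eqI[OF T T, of _ T]) (use c c' qc i T in \<open>simp_all add: hom_iff\<close>)
  then have inv2: "m \<cdot> pairing C i (\<one> T) = \<zero> T T"
    using reassoc[OF comm, of c] c c' t T by (simp add: hom_iff)
  obtain Z where "is_zero_obj C Z" using has_zero_obj by blast
  then have Z: "Z \<in> Obj C" "is_terminal C Z" by (auto simp: is_zero_obj_def is_terminal_def)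
  let ?e = "\<zero> Z T"
  have et: "?e \<cdot> s = \<zero> T T" if "s \<in> hom C T Z" for s using that T by (simp add: hom_iff)
  let ?r = "proj1 C ?P T" and ?z = "proj2 C ?P T"
  let ?x = "?p \<cdot> ?r" and ?y = "?q \<cdot> ?r"
  \<comment> \<open>On the axis \<open>z = 0\<close> both sides reduce to \<open>x + y\<close>; on
    the axis \<open>x = y = 0\<close> both reduce to \<open>z\<close>.\<close>
  have assoc: "m \<cdot> pairing C (m \<cdot> pairing C ?x ?y) ?z = m \<cdot> pairing C ?x (m \<cdot> pairing C ?y ?z)"
  proof (rule prod_jointly_epic[of ?P T])
    let ?PT = "prod_obj C ?P T"
    let ?L = "pairing C (\<one> ?P) (\<zero> ?P T)" and ?R = "pairing C (\<zero> T ?P) (\<one> T)"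
    have x: "?x \<in> hom C ?PT T" "?y \<in> hom C ?PT T" "?z \<in> hom C ?PT T" using T by (simp_all add: hom_iff)
    then have xy: "pairing C ?x ?y \<in> hom C ?PT ?P" "pairing C ?y ?z \<in> hom C ?PT ?P" by (simp_all add: hom_iff)
    then have mxy: "m \<cdot> pairing C ?x ?y \<in> hom C ?PT T" "m \<cdot> pairing C ?y ?z \<in> hom C ?PT T"
      using t T by (simp_all add: hom_iff)
    then have u: "pairing C (m \<cdot> pairing C ?x ?y) ?z \<in> hom C ?PT ?P" "pairing C ?x (m \<cdot> pairing C ?y ?z) \<in> hom C ?PT ?P"
      using x by (simp_all add: hom_iff)
    show "m \<cdot> pairing C (m \<cdot> pairing C ?x ?y) ?z \<in> hom C ?PT T" "m \<cdot> pairing C ?x (m \<cdot> pairing C ?y ?z) \<in> hom C ?PT T"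
      using u m by (auto intro: comp_in_hom)
    show "?P \<in> Obj C" "T \<in> Obj C" using T by simp_all
    have push: "(m \<cdot> pairing C (m \<cdot> pairing C ?x ?y) ?z) \<cdot> w = m \<cdot> pairing C (m \<cdot> pairing C (?x \<cdot> w) (?y \<cdot> w)) (?z \<cdot> w)"
      "(m \<cdot> pairing C ?x (m \<cdot> pairing C ?y ?z)) \<cdot> w = m \<cdot> pairing C (?x \<cdot> w) (m \<cdot> pairing C (?y \<cdot> w) (?z \<cdot> w))"
      if w: "w \<in> hom C V ?PT" for w V
    proof -
      have "(m \<cdot> pairing C ?x ?y) \<cdot> w = m \<cdot> pairing C (?x \<cdot> w) (?y \<cdot> w)"
        "(m \<cdot> pairing C ?y ?z) \<cdot> w = m \<cdot> pairing C (?y \<cdot> w) (?z \<cdot> w)"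
        using comp_assoc[OF w xy(1) m] comp_assoc[OF w xy(2) m] pairing_comp[OF x(1,2) w] pairing_comp[OF x(2,3) w]
        by simp_all
      then show "(m \<cdot> pairing C (m \<cdot> pairing C ?x ?y) ?z) \<cdot> w = m \<cdot> pairing C (m \<cdot> pairing C (?x \<cdot> w) (?y \<cdot> w)) (?z \<cdot> w)"
        "(m \<cdot> pairing C ?x (m \<cdot> pairing C ?y ?z)) \<cdot> w = m \<cdot> pairing C (?x \<cdot> w) (m \<cdot> pairing C (?y \<cdot> w) (?z \<cdot> w))"
        using comp_assoc[OF w u(1) m] comp_assoc[OF w u(2) m] pairing_comp[OF mxy(1) x(3) w] pairing_comp[OF x(1) mxy(2) w]
        by (simp_all only:)
    qed
    have L: "?L \<in> hom C ?P ?PT" "?R \<in> hom C T ?PT" using T by (simp_all add: hom_iff)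
    have xL: "?x \<cdot> ?L = ?p" "?y \<cdot> ?L = ?q" "?z \<cdot> ?L = \<zero> ?P T" "?x \<cdot> ?R = \<zero> T T" "?y \<cdot> ?R = \<zero> T T" "?z \<cdot> ?R = \<one> T"
      using T by simp_all
    have pq: "pairing C ?p ?q = \<one> ?P"
      by (rule prod_eqI[OF T T, of _ ?P]) (use T in \<open>simp_all add: hom_iff\<close>)
    have hs: "m \<in> hom C ?P T" "?q \<in> hom C ?P T" "\<one> T \<in> hom C T T" "\<zero> T T \<in> hom C T T"
      using m T by (simp_all add: hom_iff)
    have "m \<cdot> \<one> ?P = m" using t by simp
    then show "(m \<cdot> pairing C (m \<cdot> pairing C ?x ?y) ?z) \<cdot> ?L = (m \<cdot> pairing C ?x (m \<cdot> pairing C ?y ?z)) \<cdot> ?L"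
      "(m \<cdot> pairing C (m \<cdot> pairing C ?x ?y) ?z) \<cdot> ?R = (m \<cdot> pairing C ?x (m \<cdot> pairing C ?y ?z)) \<cdot> ?R"
      unfolding push[OF L(1)] push[OF L(2)] xL pq
      using ml'[OF hs(1)] ml'[OF hs(2)] mr'[OF hs(3)] mr'[OF hs(4)] by (simp_all only: pq)
  qed
  have "is_internal_abelian_group C T m ?e i"
    unfolding is_internal_abelian_group_def Let_def
    using T m Z i assoc comm inv1 inv2 ml mr et by (simp add: hom_iff)
  then show ?thesis unfolding is_abelian_obj_def by blast
qed

text \<open>Unitality of the multiplication holds because the codiagonal restricts to the identity
  on each copy of \<open>Y\<close>.\<close>

lemma nsmash_abelian:
  assumes n: "two_nilpotent C X" "two_nilpotent C Y"
  shows "is_abelian_obj C (nsmash X Y)"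
proof -
  let ?W = "nsum Y Y" and ?T = "nsmash X Y" and ?U = "nsmash X (nsum Y Y)"
  note nW = nsum_two_nilpotent[OF n(2,2)]
  have T: "?T \<in> Obj C" using nsmash_two_nilpotent[OF n] by simp
  have Y: "\<one> Y \<in> hom C Y Y" using n by (simp add: hom_iff)
  have r: "nret1 Y Y \<in> hom C ?W Y" "nret2 Y Y \<in> hom C ?W Y" "ncop (\<one> Y) (\<one> Y) \<in> hom C ?W Y"
    "nin1 Y Y \<in> hom C Y ?W" "nin2 Y Y \<in> hom C Y ?W" using n by (simp_all add: hom_iff)
  let ?p = "smap X (nret1 Y Y)" and ?q = "smap X (nret2 Y Y)" and ?f = "smap X (ncop (\<one> Y) (\<one> Y))"
    and ?a = "smap X (nin1 Y Y)" and ?b = "smap X (nin2 Y Y)"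
  have s: "?p \<in> hom C ?U ?T" "?q \<in> hom C ?U ?T" "?f \<in> hom C ?U ?T" "?a \<in> hom C ?T ?U" "?b \<in> hom C ?T ?U"
    using smap_hom[OF _ n(1)] r n nW by blast+
  have eq: "?p \<cdot> ?a = \<one> ?T" "?q \<cdot> ?a = \<zero> ?T ?T" "?p \<cdot> ?b = \<zero> ?T ?T" "?q \<cdot> ?b = \<one> ?T" "?f \<cdot> ?a = \<one> ?T" "?f \<cdot> ?b = \<one> ?T"
    using smap_comp[OF r(4,1) n nW n(2)] smap_comp[OF r(4,2) n nW n(2)] smap_comp[OF r(5,1) n nW n(2)]
      smap_comp[OF r(5,2) n nW n(2)] smap_comp[OF r(4,3) n nW n(2)] smap_comp[OF r(5,3) n nW n(2)]
      smap_ident[OF n] smap_zero[OF n n(2)] n by simp_all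
  let ?c = "pairing C ?p ?q"
  have c: "?c \<in> hom C ?U (prod_obj C ?T ?T)" using s by (simp add: hom_iff)
  note mono = smap_ret_jointly_monic[OF n n(2)]
  have ca: "?c \<cdot> ?a = pairing C (\<one> ?T) (\<zero> ?T ?T)" "?c \<cdot> ?b = pairing C (\<zero> ?T ?T) (\<one> ?T)"
    using pairing_comp[OF s(1,2,4)] pairing_comp[OF s(1,2,5)] eq by simp_all
  \<comment> \<open>The comparison is monic by additivity and its image contains both axes, so it is
    invertible.\<close>
  obtain d where d: "d \<in> hom C (prod_obj C ?T ?T) ?U" "?c \<cdot> d = \<one> (prod_obj C ?T ?T)"
    using prod_generation[OF T T c mono s(4) ca(1) s(5) ca(2)] by blast
  have dc: "d \<cdot> ?c = \<one> ?U" by (rule iso_if_split_mono[OF mono c d])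
  have "?f \<cdot> (d \<cdot> (?c \<cdot> ?a)) = \<one> ?T" "?f \<cdot> (d \<cdot> (?c \<cdot> ?b)) = \<one> ?T"
    using reassoc[OF dc, of ?a] reassoc[OF dc, of ?b] s c d(1) eq(5,6) by (simp_all add: hom_iff)
  then have "(?f \<cdot> d) \<cdot> pairing C (\<one> ?T) (\<zero> ?T ?T) = \<one> ?T" "(?f \<cdot> d) \<cdot> pairing C (\<zero> ?T ?T) (\<one> ?T) = \<one> ?T"
    unfolding ca using s(3) d(1) T by (simp_all add: hom_iff)
  moreover have "?f \<cdot> d \<in> hom C (prod_obj C ?T ?T) ?T" using s d by (simp add: hom_iff)
  ultimately show ?thesis by (intro abelian_if_unital_magma[OF T])
qed

section \<open>Right exactness\<close>

text \<open>For sums this is extremality on the two summands. For cosmash products,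
  \<open>X \<otimes> A\<close> is the joint kernel of two commuting idempotents of
  \<open>X \<oplus> A\<close>, compatible with those of \<open>X \<oplus> B\<close>; so the
  inclusion \<open>nincl X A\<close>, treated as an element, lifts on a cover to an element of
  \<open>X \<otimes> B\<close>.\<close>

lemma
  assumes f: "is_regular_epi C f" "f \<in> hom C B A"
    and n: "two_nilpotent C X" "two_nilpotent C B" "two_nilpotent C A"
  shows nmap_regular_epi: "is_regular_epi C (nmap X f)"
    and smap_regular_epi: "is_regular_epi C (smap X f)"
proof -
  note h = nmap_hom[OF f(2) n] and s = smap[OF f(2) n]
  note i = nincl_hom[OF n(1,2)] nincl_hom[OF n(1,3)]
  show e: "is_regular_epi C (nmap X f)"
  proof (rule regular_epi_if_extremal[OF h])
    fix D m g assume m: "m \<in> hom C D (nsum X A)" "is_mono C m" and g: "g \<in> hom C (nsum X B) D" "m \<cdot> g = nmap X f"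
    have ng: "m \<cdot> (g \<cdot> nin1 X B) = nin1 X A" "m \<cdot> (g \<cdot> nin2 X B) = nin2 X A \<cdot> f"
      using reassoc[OF g(2), of "nin1 X B"] reassoc[OF g(2), of "nin2 X B"] g(1) m(1) n f(2)
      by (simp_all add: hom_iff nmap_eq[OF f(2) n(1,3)])
    have gi: "g \<cdot> nin1 X B \<in> hom C X D" "g \<cdot> nin2 X B \<in> hom C B D" "nin2 X A \<in> hom C A (nsum X A)"
      using g n by (simp_all add: hom_iff)
    obtain b where "b \<in> hom C A D" "m \<cdot> b = nin2 X A"
      using regular_epi_strong[OF f m(2,1) gi(2,3) ng(2)] by blast
    then show "\<exists>n \<in> hom C (nsum X A) D. m \<cdot> n = \<one> (nsum X A)"
      using nsum_generation[OF n(1,3) m gi(1) ng(1)] by blast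
  qed
  let ?a = "nin1 X B \<cdot> nret1 X B" and ?b = "nin2 X B \<cdot> nret2 X B"
  let ?a' = "nin1 X A \<cdot> nret1 X A" and ?b' = "nin2 X A \<cdot> nret2 X A"
  let ?L = "[(?a, ?a'), (?b, ?b')]"
  have ab: "?a \<in> hom C (nsum X B) (nsum X B)" "?b \<in> hom C (nsum X B) (nsum X B)"
    "?a' \<in> hom C (nsum X A) (nsum X A)" "?b' \<in> hom C (nsum X A) (nsum X A)"
    using n by (simp_all add: hom_iff)
  have idem: "?a \<cdot> ?a = ?a" "?b \<cdot> ?b = ?b" using n by simp_all
  have com: "?a \<cdot> ?b = ?b \<cdot> ?a" using n by simp
  have nat: "nmap X f \<cdot> ?a = ?a' \<cdot> nmap X f" "nmap X f \<cdot> ?b = ?b' \<cdot> nmap X f"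
    unfolding nmap_eq[OF f(2) n(1,3)]
     apply (rule nsum_eqI[of _ X B "nsum X A"]; use n f(2) in \<open>simp add: hom_iff\<close>)
    apply (rule nsum_eqI[of _ X B "nsum X A"]; use n f(2) in \<open>simp add: hom_iff\<close>)
    done
  let ?T = "nsmash X A"
  have T: "?T \<in> Obj C" using nsmash_two_nilpotent[OF n(1,3)] by simp
  have z: "?a' \<cdot> nincl X A = \<zero> ?T (nsum X A)" "?b' \<cdot> nincl X A = \<zero> ?T (nsum X A)"
    using nret1_nincl[OF n(1,3)] nret2_nincl[OF n(1,3)] i n T by (simp_all add: hom_iff)
  have "\<exists>V' v g'. is_regular_epi C v \<and> v \<in> hom C V' ?T \<and> g' \<in> hom C V' (nsum X B) \<and> nmap X f \<cdot> g' = nincl X A \<cdot> v \<and>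
    (\<forall>(i, i') \<in> set ?L. i \<cdot> g' = \<zero> V' (nsum X B))"
  proof (rule lift_to_joint_kernel[OF e h i(2)])
    fix x x' assume "(x, x') \<in> set ?L"
    then show "x \<in> hom C (nsum X B) (nsum X B) \<and> x' \<in> hom C (nsum X A) (nsum X A) \<and> x \<cdot> x = x \<and>
      nmap X f \<cdot> x = x' \<cdot> nmap X f \<and> x' \<cdot> nincl X A = \<zero> ?T (nsum X A)"
      using ab idem nat z by (auto simp del: assoc)
  next
    fix x x' y y' assume "(x, x') \<in> set ?L" "(y, y') \<in> set ?L"
    then show "x \<cdot> y = y \<cdot> x" using com by (auto simp del: assoc)
  qed
  then obtain V' v g' where v: "is_regular_epi C v" "v \<in> hom C V' ?T" "g' \<in> hom C V' (nsum X B)"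
    "nmap X f \<cdot> g' = nincl X A \<cdot> v" "?a \<cdot> g' = \<zero> V' (nsum X B)" "?b \<cdot> g' = \<zero> V' (nsum X B)"
    by auto
  have r: "nret1 X B \<in> hom C (nsum X B) X" "nret2 X B \<in> hom C (nsum X B) B"
    "nin1 X B \<in> hom C X (nsum X B)" "nin2 X B \<in> hom C B (nsum X B)" using n by (simp_all add: hom_iff)
  have "nret1 X B \<cdot> g' = \<zero> V' X"
    by (rule killed_iff[OF r(1,3) ab(1) refl _ v(3), THEN iffD2, OF _ v(5)]) (use n in simp)
  moreover have "nret2 X B \<cdot> g' = \<zero> V' B"
    by (rule killed_iff[OF r(2,4) ab(2) refl _ v(3), THEN iffD2, OF _ v(6)]) (use n in simp)
  ultimately obtain w where w: "w \<in> hom C V' (nsmash X B)" "nincl X B \<cdot> w = g'"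
    using nincl_lift[OF n(1,2) v(3)] by blast
  have "smap X f \<cdot> w = v"
    by (rule smap_eqI[OF n(1,3), of _ V'])
      (use reassoc2[OF s(2), of w] w s(1) v(2,4) i h in \<open>simp_all add: hom_iff\<close>)
  then show "is_regular_epi C (smap X f)" using regular_epi_if_comp[OF s(1) w(1)] v(1) by simp
qed

text \<open>
  With \<open>P = B \<oplus> K\<close> the arrow \<open>f\<close> is the coequaliser of the reflexive pair \<open>d = [1, 0]\<close>,
  \<open>c = [1, k]\<close> among two-nilpotent objects, and so is \<open>X \<oplus> f\<close> for \<open>X \<oplus> d\<close>, \<open>X \<oplus> c\<close>. Hence the kernel of \<open>X \<otimes> f\<close> is covered by that of \<open>X \<otimes> d\<close>, which is
  \<open>X \<otimes> K\<close> by bilinearity.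
\<close>

lemma smap_kernel_lift:
  assumes k: "k \<in> hom C K B" and f: "f \<in> hom C B A" and fk: "f \<cdot> k = \<zero> K A"
    and coker: "\<And>W g. \<lbrakk>two_nilpotent C W; g \<in> hom C B W; g \<cdot> k = \<zero> K W\<rbrakk> \<Longrightarrow> \<exists>h \<in> hom C A W. h \<cdot> f = g"
    and n: "two_nilpotent C X" "two_nilpotent C K" "two_nilpotent C B" "two_nilpotent C A"
    and g: "g \<in> hom C V (nsmash X B)" "smap X f \<cdot> g = \<zero> V (nsmash X A)"
  shows "\<exists>V' v h. is_regular_epi C v \<and> v \<in> hom C V' V \<and> h \<in> hom C V' (nsmash X K) \<and> smap X k \<cdot> h = g \<cdot> v"
proof -
  let ?P = "nsum B K" and ?S = "nsum X B" and ?Q = "nsum X (nsum B K)"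
  let ?d = "nret1 B K" and ?c = "ncop (\<one> B) k" and ?s = "nin1 B K" and ?b = "nin2 B K" and ?r = "nret2 B K"
  note nP = nsum_two_nilpotent[OF n(3,2)] and nS = nsum_two_nilpotent[OF n(1,3)]
  note nQ = nsum_two_nilpotent[OF n(1) nP] and nSA = nsum_two_nilpotent[OF n(1,4)]
  have o: "X \<in> Obj C" "K \<in> Obj C" "B \<in> Obj C" "A \<in> Obj C" "?P \<in> Obj C" "?S \<in> Obj C" "?Q \<in> Obj C" "V \<in> Obj C"
    using n nP nS nQ g by (simp_all add: hom_iff)
  have h: "?d \<in> hom C ?P B" "?c \<in> hom C ?P B" "?s \<in> hom C B ?P" "?b \<in> hom C K ?P" "?r \<in> hom C ?P K"
    using n k by (simp_all add: hom_iff)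
  note m = nmap_hom[OF h(1) n(1) nP n(3)] nmap_hom[OF h(2) n(1) nP n(3)] nmap_hom[OF h(3) n(1,3) nP]
  note mf = nmap_hom[OF f n(1,3,4)]
  have ds: "?d \<cdot> ?s = \<one> B" "?c \<cdot> ?s = \<one> B" "?c \<cdot> ?b = k" "?d \<cdot> ?b = \<zero> K B" using n k by (simp_all add: hom_iff)
  have ms: "nmap X ?d \<cdot> nmap X ?s = \<one> ?S" "nmap X ?c \<cdot> nmap X ?s = \<one> ?S"
    using nmap_comp[OF h(3,1) n(1,3) nP n(3)] nmap_comp[OF h(3,2) n(1,3) nP n(3)] nmap_ident[OF n(1,3)] ds
    by simp_all
  \<comment> \<open>This coequaliser is taken in the ambient category. It is compared with
    \<open>nmap X f\<close> only to the extent that both kill the same elements.\<close>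
  obtain Q q where q: "q \<in> hom C ?S Q" "is_regular_epi C q" "q \<cdot> nmap X ?d = q \<cdot> nmap X ?c"
    "\<And>V g. \<lbrakk>g \<in> hom C V ?S; q \<cdot> g = \<zero> V Q\<rbrakk> \<Longrightarrow>
      \<exists>V' v g'. is_regular_epi C v \<and> v \<in> hom C V' V \<and> g' \<in> hom C V' ?Q \<and> nmap X ?d \<cdot> g' = \<zero> V' ?S \<and>
        nmap X ?c \<cdot> g' = g \<cdot> v"
    "\<And>W g. \<lbrakk>g \<in> hom C ?S W; g \<cdot> nmap X ?d = g \<cdot> nmap X ?c\<rbrakk> \<Longrightarrow> \<exists>u \<in> hom C Q W. u \<cdot> q = g"
    by (rule reflexive_coequaliser[OF m(2,1,3) ms]) blast
  \<comment> \<open>Two-nilpotency of \<open>Q\<close> allows the factorisation property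
    \<open>coker\<close> of \<open>f\<close> to be applied to arrows into \<open>Q\<close>.\<close>
  have nQq: "two_nilpotent C Q" by (rule two_nilpotent_regular_quotient[OF q(2,1) nS])
  have qkill: "q \<cdot> w = \<zero> W Q" if w: "w \<in> hom C W ?S" "nmap X f \<cdot> w = \<zero> W (nsum X A)" for w W
  proof -
    have W: "W \<in> Obj C" using w by (simp add: hom_iff)
    let ?j = "nin2 X B"
    have "(q \<cdot> nmap X ?d) \<cdot> (nin2 X ?P \<cdot> ?b) = (q \<cdot> nmap X ?c) \<cdot> (nin2 X ?P \<cdot> ?b)" by (simp only: q(3))
    then have "(q \<cdot> ?j) \<cdot> k = \<zero> K Q"
      unfolding nmap_eq[OF h(1) n(1,3)] nmap_eq[OF h(2) n(1,3)]
      using q(1) n k nP by (simp add: hom_iff)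
    moreover have qj: "q \<cdot> ?j \<in> hom C B Q" using q n by (simp add: hom_iff)
    ultimately obtain y where y: "y \<in> hom C A Q" "y \<cdot> f = q \<cdot> ?j" using coker[OF nQq] by blast
    let ?u = "ncop (q \<cdot> nin1 X B) y"
    have u: "?u \<in> hom C (nsum X A) Q" using y q n nQq by (simp add: hom_iff)
    have uq: "?u \<cdot> nmap X f = q"
      by (rule nsum_eqI[OF _ q(1) n(1,3) nQq])
        (use y u q(1) n nQq f mf in \<open>simp_all add: hom_iff nmap_eq[OF f n(1,4)]\<close>)
    show ?thesis using reassoc[OF uq, of w] w u mf W by (simp add: hom_iff)
  qed
  \<comment> \<open>The leg \<open>X \<oplus> c\<close> maps the kernel \<open>L\<close> of
    \<open>X \<oplus> d\<close> onto the kernel \<open>M\<close> of \<open>q\<close>; this is the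
    regular epimorphism \<open>e\<close>.\<close>
  obtain L l where l: "l \<in> hom C L ?Q" "is_mono C l" "nmap X ?d \<cdot> l = \<zero> L ?S"
    "\<And>W g. \<lbrakk>g \<in> hom C W ?Q; nmap X ?d \<cdot> g = \<zero> W ?S\<rbrakk> \<Longrightarrow> \<exists>h \<in> hom C W L. l \<cdot> h = g"
    by (rule kernelE[OF m(1)]) blast
  obtain M j where j: "j \<in> hom C M ?S" "is_mono C j" "q \<cdot> j = \<zero> M Q"
    "\<And>W g. \<lbrakk>g \<in> hom C W ?S; q \<cdot> g = \<zero> W Q\<rbrakk> \<Longrightarrow> \<exists>h \<in> hom C W M. j \<cdot> h = g"
    by (rule kernelE[OF q(1)]) blast
  have LM: "L \<in> Obj C" "M \<in> Obj C" using l j by (simp_all add: hom_iff)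
  have "q \<cdot> (nmap X ?c \<cdot> l) = \<zero> L Q"
    using reassoc2[OF q(3), of l] l m q(1) by (simp add: hom_iff)
  moreover have "nmap X ?c \<cdot> l \<in> hom C L ?S" using l m by (simp add: hom_iff)
  ultimately obtain e where e: "e \<in> hom C L M" "j \<cdot> e = nmap X ?c \<cdot> l" using j(4) by blast
  have er: "is_regular_epi C e"
  proof -
    obtain V' v g' where v: "is_regular_epi C v" "v \<in> hom C V' M" "g' \<in> hom C V' ?Q" "nmap X ?d \<cdot> g' = \<zero> V' ?S"
      "nmap X ?c \<cdot> g' = j \<cdot> v" using q(4)[OF j(1,3)] by blast
    obtain x where x: "x \<in> hom C V' L" "l \<cdot> x = g'" using l(4)[OF v(3,4)] by blast
    have "j \<cdot> (e \<cdot> x) = j \<cdot> v"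
      using reassoc2[OF e(2), of x] x e(1) j(1) l(1) m v(5) by (simp add: hom_iff)
    then have "e \<cdot> x = v"
      by (rule is_monoD[OF j(2,1), of _ V', rotated 2]) (use e x v in \<open>simp_all add: hom_iff\<close>)
    then show ?thesis using regular_epi_if_comp[OF e(1) x(1)] v(1) by simp
  qed
  \<comment> \<open>Killing the summand \<open>X\<close> is a first step from sums to cosmash
    products. For lifting along \<open>e\<close> these idempotents are restricted to
    \<open>L\<close> and \<open>M\<close>; in the case of \<open>M\<close> this uses that
    \<open>nmap X f\<close> and \<open>q\<close> kill the same elements.\<close>
  let ?i = "nin2 X ?P \<cdot> nret2 X ?P" and ?i' = "nin2 X B \<cdot> nret2 X B"
  have ih: "?i \<in> hom C ?Q ?Q" "?i' \<in> hom C ?S ?S" "?i \<cdot> ?i = ?i" using n nP by (simp_all add: hom_iff)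
  have inat: "nmap X x \<cdot> (nin2 X Y \<cdot> nret2 X Y) = (nin2 X Z \<cdot> nret2 X Z) \<cdot> nmap X x"
    if x: "x \<in> hom C Y Z" "two_nilpotent C Y" "two_nilpotent C Z" for x Y Z
    unfolding nmap_eq[OF x(1) n(1) x(3)]
    by (rule nsum_eqI[of _ X Y "nsum X Z"]) (use n x in \<open>simp_all add: hom_iff\<close>)
  note inatd = inat[OF h(1) nP n(3)] and inatc = inat[OF h(2) nP n(3)] and inatf = inat[OF f n(3,4)]
  have "nmap X ?d \<cdot> (?i \<cdot> l) = \<zero> L ?S"
    using comp_assoc[OF l(1) ih(1) m(1)] comp_assoc[OF l(1) m(1) ih(2)] inatd l(3) ih(2) LM by (simp add: hom_iff)
  moreover have "?i \<cdot> l \<in> hom C L ?Q" using l(1) ih(1) by (rule comp_in_hom)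
  ultimately obtain t where t: "t \<in> hom C L L" "l \<cdot> t = ?i \<cdot> l" using l(4) by blast
  have fj: "nmap X f \<cdot> j = \<zero> M (nsum X A)"
  proof -
    have "nmap X f \<cdot> nmap X ?d = nmap X f \<cdot> nmap X ?c"
    proof -
      have "f \<cdot> ?d = f \<cdot> ?c"
        by (rule nsum_eqI[of _ B K A]) (use n f k fk h(1,2) in \<open>simp_all add: hom_iff\<close>)
      then show ?thesis using nmap_comp[OF h(1) f n(1) nP n(3,4)] nmap_comp[OF h(2) f n(1) nP n(3,4)] by simp
    qed
    then obtain u where u: "u \<in> hom C Q (nsum X A)" "u \<cdot> q = nmap X f" using q(5)[OF mf] by blast
    show ?thesis using reassoc[OF u(2), of j] u(1) q(1) j(1,3) LM by (simp add: hom_iff)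
  qed
  have "nmap X f \<cdot> (?i' \<cdot> j) = \<zero> M (nsum X A)"
  proof -
    have hA: "nin2 X A \<cdot> nret2 X A \<in> hom C (nsum X A) (nsum X A)" using n by (simp add: hom_iff)
    show ?thesis
      using comp_assoc[OF j(1) ih(2) mf] comp_assoc[OF j(1) mf hA] inatf fj hA LM by (simp add: hom_iff)
  qed
  moreover have i'j: "?i' \<cdot> j \<in> hom C M ?S" using j(1) ih(2) by (rule comp_in_hom)
  ultimately obtain t' where t': "t' \<in> hom C M M" "j \<cdot> t' = ?i' \<cdot> j" using qkill j(4) by blast
  have tt: "t \<cdot> t = t"
  proof -
    have "l \<cdot> (t \<cdot> t) = (l \<cdot> t) \<cdot> t" using l(1) t(1) by (simp add: hom_iff)
    also have "\<dots> = ?i \<cdot> (l \<cdot> t)" unfolding t(2) using comp_assoc[OF t(1) l(1) ih(1)] t(2) by simp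
    also have "\<dots> = (?i \<cdot> ?i) \<cdot> l" unfolding t(2) using comp_assoc[OF l(1) ih(1,1)] by simp
    finally have "l \<cdot> (t \<cdot> t) = l \<cdot> t" unfolding ih(3) t(2) .
    then show ?thesis by (rule is_monoD[OF l(2,1) comp_in_hom[OF t(1,1)] t(1)])
  qed
  have et: "e \<cdot> t = t' \<cdot> e"
  proof -
    have "j \<cdot> (e \<cdot> t) = (j \<cdot> e) \<cdot> t" using comp_assoc[OF t(1) e(1) j(1)] by simp
    also have "\<dots> = nmap X ?c \<cdot> (l \<cdot> t)" unfolding e(2) using comp_assoc[OF t(1) l(1) m(2)] by simp
    also have "\<dots> = (nmap X ?c \<cdot> ?i) \<cdot> l" unfolding t(2) using comp_assoc[OF l(1) ih(1) m(2)] by simp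
    also have "\<dots> = ?i' \<cdot> (nmap X ?c \<cdot> l)" unfolding inatc using comp_assoc[OF l(1) m(2) ih(2)] by simp
    also have "\<dots> = (?i' \<cdot> j) \<cdot> e" unfolding e(2)[symmetric] using comp_assoc[OF e(1) j(1) ih(2)] by simp
    also have "\<dots> = j \<cdot> (t' \<cdot> e)" unfolding t'(2)[symmetric] using comp_assoc[OF e(1) t'(1) j(1)] by simp
    finally show ?thesis
      by (rule is_monoD[OF j(2,1) comp_in_hom[OF t(1) e(1)] comp_in_hom[OF e(1) t'(1)]])
  qed
  note iB = nincl_hom[OF n(1,3)] and iP = nincl_hom[OF n(1) nP]
  note sB = smap[OF f n(1,3,4)]
  let ?g = "nincl X B \<cdot> g"
  have gh: "?g \<in> hom C V ?S" using iB g by (simp add: hom_iff)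
  have "nmap X f \<cdot> ?g = \<zero> V (nsum X A)"
    using reassoc2[OF sB(2), of g] g sB(1) mf iB nincl_hom[OF n(1,4)] o by (simp add: hom_iff)
  then obtain y where y: "y \<in> hom C V M" "j \<cdot> y = ?g" using j(4)[OF gh qkill[OF gh]] by blast
  have r2g: "nret2 X B \<cdot> ?g = \<zero> V B"
    using reassoc[OF nret2_nincl[OF n(1,3)], of g] g(1) iB n o by (simp add: hom_iff)
  have ty: "t' \<cdot> y = \<zero> V M"
  proof -
    have "j \<cdot> (t' \<cdot> y) = ?i' \<cdot> ?g"
      using comp_assoc[OF y(1) t'(1) j(1)] comp_assoc[OF y(1) j(1) ih(2)] t'(2) y(2) by simp
    also have "\<dots> = j \<cdot> \<zero> V M" using r2g gh j(1) n o by (simp add: hom_iff)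
    finally show ?thesis
      by (rule is_monoD[OF j(2,1) comp_in_hom[OF y(1) t'(1)], rotated]) (use LM o in \<open>simp add: hom_iff\<close>)
  qed
  \<comment> \<open>The element \<open>y\<close> is killed by \<open>t'\<close> because it comes
    from \<open>X \<otimes> B\<close>, so its lift can be chosen to be killed by \<open>t\<close>.
    An arbitrary lift along \<open>e\<close> would only lie in the sum of \<open>X\<close> and
    \<open>?P\<close>, not in their cosmash product.\<close>
  obtain V' v x where v: "is_regular_epi C v" "v \<in> hom C V' V" "x \<in> hom C V' L" "t \<cdot> x = \<zero> V' L" "e \<cdot> x = y \<cdot> v"
    by (rule lift_to_kernel[OF er e(1) t(1) tt t'(1) et y(1) ty])
  have V': "V' \<in> Obj C" using v by (simp add: hom_iff)
  let ?x = "l \<cdot> x"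
  have xh: "?x \<in> hom C V' ?Q" using v l by (simp add: hom_iff)
  have dx: "nmap X ?d \<cdot> ?x = \<zero> V' ?S" using reassoc[OF l(3), of x] l(1) v(3) m o by (simp add: hom_iff)
  have cx: "nmap X ?c \<cdot> ?x = ?g \<cdot> v"
  proof -
    have "nmap X ?c \<cdot> ?x = j \<cdot> (e \<cdot> x)"
      using comp_assoc[OF v(3) l(1) m(2)] comp_assoc[OF v(3) e(1) j(1)] e(2) by simp
    then show ?thesis unfolding v(5) using comp_assoc[OF v(2) y(1) j(1)] y(2) by simp
  qed
  have "?i \<cdot> ?x = \<zero> V' ?Q"
    using comp_assoc[OF v(3) l(1) ih(1)] comp_assoc[OF v(3) t(1) l(1)] t(2) v(4) l(1) V' by (simp add: hom_iff)
  moreover have rP: "nret2 X ?P \<in> hom C ?Q ?P" "nin2 X ?P \<in> hom C ?P ?Q" "nret2 X ?P \<cdot> ?i = nret2 X ?P"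
    using n nP by (simp_all add: hom_iff)
  ultimately have r2x: "nret2 X ?P \<cdot> ?x = \<zero> V' ?P" using killed_iff[OF rP(1,2) ih(1) refl rP(3) xh] by simp
  \<comment> \<open>This retraction requires no special choice of the lift: it factors through
    \<open>X \<oplus> d\<close>, which kills \<open>?x\<close>.\<close>
  have r1x: "nret1 X ?P \<cdot> ?x = \<zero> V' X"
  proof -
    have r: "nret1 X B \<in> hom C ?S X" using n by (simp add: hom_iff)
    have "nret1 X ?P \<cdot> ?x = nret1 X B \<cdot> (nmap X ?d \<cdot> ?x)"
      using comp_assoc[OF xh m(1) r] nret_nmap(1)[OF h(1) n(1) nP n(3)] by simp
    then show ?thesis using dx r V' by (simp add: hom_iff)
  qed
  obtain a where a: "a \<in> hom C V' (nsmash X ?P)" "nincl X ?P \<cdot> a = ?x"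
    using nincl_lift[OF n(1) nP xh r1x r2x] by blast
  note sd = smap[OF h(1) n(1) nP n(3)] and sc = smap[OF h(2) n(1) nP n(3)] and sr = smap[OF h(5) n(1) nP n(2)]
    and sb = smap[OF h(4) n(1,2) nP]
  note tT = nsmash_two_nilpotent[OF n(1,3)] nsmash_two_nilpotent[OF n(1,2)] nsmash_two_nilpotent[OF n(1) nP]
  have da: "smap X ?d \<cdot> a = \<zero> V' (nsmash X B)"
  proof (rule smap_eqI[OF n(1,3), of _ V'])
    show "nincl X B \<cdot> (smap X ?d \<cdot> a) = nincl X B \<cdot> \<zero> V' (nsmash X B)"
      using comp_assoc[OF a(1) sd(1) iB] comp_assoc[OF a(1) iP m(1)] sd(2) a(2) dx iB V' by (simp add: hom_iff)
  qed (use a sd V' tT in \<open>simp_all add: hom_iff\<close>)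
  have ca: "smap X ?c \<cdot> a = g \<cdot> v"
  proof (rule smap_eqI[OF n(1,3), of _ V'])
    show "nincl X B \<cdot> (smap X ?c \<cdot> a) = nincl X B \<cdot> (g \<cdot> v)"
      using comp_assoc[OF a(1) sc(1) iB] comp_assoc[OF a(1) iP m(2)] sc(2) a(2) cx comp_assoc[OF v(2) g(1) iB]
      by simp
  qed (use a sc v g in \<open>simp_all add: hom_iff\<close>)
  let ?w = "smap X ?r \<cdot> a"
  have w: "?w \<in> hom C V' (nsmash X K)" using sr a by (simp add: hom_iff)
  \<comment> \<open>Both sides have zero component in \<open>X \<otimes> B\<close> and the same
    component in \<open>X \<otimes> K\<close>; by additivity they coincide.\<close>
  have ba: "smap X ?b \<cdot> ?w = a"
  proof (rule is_monoD[OF smap_ret_jointly_monic[OF n(1,3,2)]])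
    let ?pr = "pairing C (smap X ?d) (smap X ?r)"
    show pr: "?pr \<in> hom C (nsmash X ?P) (prod_obj C (nsmash X B) (nsmash X K))"
      using sd sr by (simp add: hom_iff)
    show bw: "smap X ?b \<cdot> ?w \<in> hom C V' (nsmash X ?P)" "a \<in> hom C V' (nsmash X ?P)"
      using sb w a by (simp_all add: hom_iff)
    have "smap X ?d \<cdot> smap X ?b = \<zero> (nsmash X K) (nsmash X B)"
      using smap_comp[OF h(4,1) n(1,2) nP n(3)] smap_zero[OF n(1,2,3)] ds(4) by simp
    then have "smap X ?d \<cdot> (smap X ?b \<cdot> ?w) = \<zero> (nsmash X K) (nsmash X B) \<cdot> ?w"
      using comp_assoc[OF w sb(1) sd(1)] by simp
    also have "\<dots> = \<zero> V' (nsmash X B)" using w tT by (simp add: hom_iff)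
    finally have "smap X ?d \<cdot> (smap X ?b \<cdot> ?w) = \<zero> V' (nsmash X B)" .
    moreover have "smap X ?r \<cdot> (smap X ?b \<cdot> ?w) = ?w"
    proof -
      have "?r \<cdot> ?b = \<one> K" using n by simp
      then show ?thesis
        using comp_assoc[OF w sb(1) sr(1)] smap_comp[OF h(4,5) n(1,2) nP n(2)] smap_ident[OF n(1,2)]
          comp_ident_left[OF w] by simp
    qed
    ultimately show "?pr \<cdot> (smap X ?b \<cdot> ?w) = ?pr \<cdot> a"
      using pairing_comp[OF sd(1) sr(1) bw(1)] pairing_comp[OF sd(1) sr(1) a(1)] da by simp
  qed
  have "smap X k \<cdot> ?w = smap X ?c \<cdot> (smap X ?b \<cdot> ?w)"
    using comp_assoc[OF w sb(1) sc(1)] smap_comp[OF h(4,2) n(1,2) nP n(3)] ds(3) by simp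
  then have "smap X k \<cdot> ?w = g \<cdot> v" unfolding ba ca .
  then show ?thesis using v w by blast
qed

text \<open>Both claims come from covering the kernel of \<open>smap X f\<close> by elements of
  \<open>X \<otimes> K\<close>: an arrow that kills \<open>smap X k\<close> kills this kernel, and
  the image of \<open>smap X k\<close> contains it. The assumption \<open>coker\<close> is
  restricted to two-nilpotent targets because this is the form in which a cokernel passes through
  the reflector.\<close>

lemma smap_right_exact:
  assumes k: "k \<in> hom C K B" and f: "f \<in> hom C B A" and fr: "is_regular_epi C f" and fk: "f \<cdot> k = \<zero> K A"
    and coker: "\<And>W g. \<lbrakk>two_nilpotent C W; g \<in> hom C B W; g \<cdot> k = \<zero> K W\<rbrakk> \<Longrightarrow> \<exists>h \<in> hom C A W. h \<cdot> f = g"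
    and n: "two_nilpotent C X" "two_nilpotent C K" "two_nilpotent C B" "two_nilpotent C A"
  shows "right_exact C (smap X k) (smap X f)"
proof -
  note sk = smap_hom[OF k n(1,2,3)] and sf = smap_hom[OF f n(1,3,4)]
  note sr = smap_regular_epi[OF fr f n(1,3,4)]
  note lift = smap_kernel_lift[OF k f fk coker n]
  have z: "smap X f \<cdot> smap X k = \<zero> (nsmash X K) (nsmash X A)"
    using smap_comp[OF k f n] smap_zero[OF n(1,2,4)] fk by simp
  have "is_cokernel C (smap X f) (smap X k)" unfolding cokernel_iff[OF sk sf]
  proof (intro conjI allI ballI impI z)
    fix W g assume g: "g \<in> hom C (nsmash X B) W" "g \<cdot> smap X k = \<zero> (nsmash X K) W"
    have W: "W \<in> Obj C" using g by (simp add: hom_iff)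
    have "\<exists>u \<in> hom C (nsmash X A) W. u \<cdot> smap X f = g"
    proof (rule regular_epi_factor[OF sr sf g(1)])
      fix V h assume h: "h \<in> hom C V (nsmash X B)" "smap X f \<cdot> h = \<zero> V (nsmash X A)"
      obtain V' v x where v: "is_regular_epi C v" "v \<in> hom C V' V" "x \<in> hom C V' (nsmash X K)" "smap X k \<cdot> x = h \<cdot> v"
        using lift[OF _ _ _ h] by blast
      have "(g \<cdot> h) \<cdot> v = \<zero> V W \<cdot> v"
        using comp_assoc[OF v(2) h(1) g(1)] comp_assoc[OF v(3) sk g(1)] v(2-4) g(2) h(1) W by (simp add: hom_iff)
      then show "g \<cdot> h = \<zero> V W"
        by (rule regular_epi_cancel[OF v(1,2), of _ W, rotated 2]) (use g h in \<open>simp_all add: hom_iff\<close>)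
    qed
    then obtain u where "u \<in> hom C (nsmash X A) W" "u \<cdot> smap X f = g" by blast
    then show "\<exists>!u. u \<in> hom C (nsmash X A) W \<and> u \<cdot> smap X f = g"
      using regular_epi_cancel[OF sr sf] by (intro ex1I[of _ u]) auto
  qed
  moreover have "is_kernel C (image C (smap X k)) (smap X f)"
  proof -
    obtain I e where i: "image C (smap X k) \<in> hom C I (nsmash X B)" "is_mono C (image C (smap X k))"
      "e \<in> hom C (nsmash X K) I" "is_regular_epi C e" "image C (smap X k) \<cdot> e = smap X k"
      by (rule imageE[OF sk])
    let ?m = "image C (smap X k)"
    have "(smap X f \<cdot> ?m) \<cdot> e = \<zero> I (nsmash X A) \<cdot> e"
      using comp_assoc[OF i(3,1) sf] i(1,3,5) z sf by (simp add: hom_iff)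
    then have "smap X f \<cdot> ?m = \<zero> I (nsmash X A)"
      by (rule regular_epi_cancel[OF i(4,3), of _ "nsmash X A", rotated 2]) (use i(1) sf in \<open>simp_all add: hom_iff\<close>)
    moreover have "\<exists>d \<in> hom C V I. ?m \<cdot> d = h"
      if h: "h \<in> hom C V (nsmash X B)" "smap X f \<cdot> h = \<zero> V (nsmash X A)" for V h
    proof -
      obtain V' v x where v: "is_regular_epi C v" "v \<in> hom C V' V" "x \<in> hom C V' (nsmash X K)" "smap X k \<cdot> x = h \<cdot> v"
        using lift[OF _ _ _ h] by blast
      \<comment> \<open>The lift exists on the cover \<open>v\<close> only; since \<open>v\<close>
        is strong and \<open>?m\<close> is monic, it descends to \<open>V\<close>.\<close>
      have "?m \<cdot> (e \<cdot> x) = h \<cdot> v" using comp_assoc[OF v(3) i(3,1)] i(5) v(4) by simp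
      then show ?thesis
        using regular_epi_strong[OF v(1,2) i(2,1) comp_in_hom[OF v(3) i(3)] h(1)] by blast
    qed
    ultimately show ?thesis unfolding kernel_iff[OF sf i(1)] using i(2) by blast
  qed
  ultimately show ?thesis
    unfolding right_exact_def is_proper_def is_normal_mono_def using sk by (auto simp: hom_iff)
qed

section \<open>Passage from arbitrary objects to two-nilpotent ones\<close>

lemma nil2_map:
  assumes f: "f \<in> hom C X Y"
  shows nil2_map_hom: "nil2_map C f \<in> hom C (nil2_obj C X) (nil2_obj C Y)"
    and nil2_map_unit: "nil2_map C f \<cdot> nil2_unit C X = nil2_unit C Y \<cdot> f"
proof -
  have o: "X \<in> Obj C" "Y \<in> Obj C" using f by (simp_all add: hom_iff)
  note u = nil2_unit_hom[OF o(1)] nil2_unit_hom[OF o(2)]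
  let ?P = "\<lambda>g. g \<in> hom C (nil2_obj C X) (nil2_obj C Y) \<and> g \<cdot> nil2_unit C X = nil2_unit C Y \<cdot> f"
  have "nil2_unit C Y \<cdot> f \<in> hom C X (nil2_obj C Y)" using u f by (simp add: hom_iff)
  then obtain g where "?P g" using nil2_unit_factor[OF o(1)] nil2_obj_two_nilpotent[OF o(2)] by blast
  then have "\<exists>!g. ?P g"
    using regular_epi_cancel[OF nil2_unit_regular_epi[OF o(1)] u(1)] by (intro ex1I[of _ g]) auto
  moreover have "nil2_map C f = (THE g. ?P g)" using f by (simp add: nil2_map_def hom_iff)
  ultimately have "?P (nil2_map C f)" using theI'[of ?P] by simp
  then show "nil2_map C f \<in> hom C (nil2_obj C X) (nil2_obj C Y)"
    "nil2_map C f \<cdot> nil2_unit C X = nil2_unit C Y \<cdot> f" by auto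
qed

lemma nil2_map_ident:
  assumes X: "X \<in> Obj C"
  shows "nil2_map C (\<one> X) = \<one> (nil2_obj C X)"
proof -
  have h: "\<one> X \<in> hom C X X" using X by (simp add: hom_iff)
  note u = nil2_unit_hom[OF X]
  show ?thesis
    by (rule regular_epi_cancel[OF nil2_unit_regular_epi[OF X] u nil2_map_hom[OF h]])
      (use nil2_map_unit[OF h] u in \<open>simp_all add: hom_iff\<close>)
qed

lemma bilinear_prod_right_exact:
  assumes X: "X \<in> Obj C" and k: "k \<in> hom C K B" and f: "f \<in> hom C B A" and "is_cokernel C f k"
  shows "is_abelian_obj C (bilinear_prod C X K) \<and>
         is_abelian_obj C (bilinear_prod C X B) \<and>
         is_abelian_obj C (bilinear_prod C X A) \<and>
         bilinear_map C (Ident C X) k \<in> hom C (bilinear_prod C X K) (bilinear_prod C X B) \<and>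
         bilinear_map C (Ident C X) f \<in> hom C (bilinear_prod C X B) (bilinear_prod C X A) \<and>
         right_exact C (bilinear_map C (Ident C X) k) (bilinear_map C (Ident C X) f)"
proof -
  note c = assms(4)[unfolded cokernel_iff[OF k f]]
  have o: "K \<in> Obj C" "B \<in> Obj C" "A \<in> Obj C" using k f by (simp_all add: hom_iff)
  note n = nil2_obj_two_nilpotent[OF X] nil2_obj_two_nilpotent[OF o(1)] nil2_obj_two_nilpotent[OF o(2)]
    nil2_obj_two_nilpotent[OF o(3)]
  note u = nil2_unit_hom[OF o(1)] nil2_unit_hom[OF o(2)] nil2_unit_hom[OF o(3)]
  note e = nil2_unit_regular_epi[OF o(1)] nil2_unit_regular_epi[OF o(2)] nil2_unit_regular_epi[OF o(3)]
  let ?k = "nil2_map C k" and ?f = "nil2_map C f"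
  note k' = nil2_map[OF k] and f' = nil2_map[OF f]
  \<comment> \<open>Preceded by the unit of \<open>B\<close>, the reflected arrow is
    \<open>f\<close> followed by the unit of \<open>A\<close>, a composite of regular
    epimorphisms.\<close>
  have fr: "is_regular_epi C ?f"
  proof (rule regular_epi_if_comp[OF f'(1) u(2)])
    show "is_regular_epi C (?f \<cdot> nil2_unit C B)"
      unfolding f'(2) using cokernel_regular_epi[OF k f assms(4)] f u(3) e(3) by (intro regular_epi_comp)
  qed
  have fk: "?f \<cdot> ?k = \<zero> (nil2_obj C K) (nil2_obj C A)"
  proof (rule regular_epi_cancel[OF e(1) u(1) comp_in_hom[OF k'(1) f'(1)]])
    show "\<zero> (nil2_obj C K) (nil2_obj C A) \<in> hom C (nil2_obj C K) (nil2_obj C A)" using n by (simp add: hom_iff)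
    have "(?f \<cdot> ?k) \<cdot> nil2_unit C K = ?f \<cdot> (nil2_unit C B \<cdot> k)"
      using comp_assoc[OF u(1) k'(1) f'(1)] k'(2) by simp
    also have "\<dots> = nil2_unit C A \<cdot> (f \<cdot> k)"
      using comp_assoc[OF k u(2) f'(1)] comp_assoc[OF k f u(3)] f'(2) by simp
    finally show "(?f \<cdot> ?k) \<cdot> nil2_unit C K = \<zero> (nil2_obj C K) (nil2_obj C A) \<cdot> nil2_unit C K"
      using c u o n by (simp add: hom_iff)
  qed
  \<comment> \<open>A left adjoint preserves cokernels: \<open>g\<close> is precomposed with the
    unit of \<open>B\<close>, factored through \<open>f\<close>, and the factor descends along the
    unit of \<open>A\<close>.\<close>
  have coker: "\<exists>h \<in> hom C (nil2_obj C A) W. h \<cdot> ?f = g"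
    if W: "two_nilpotent C W" and g: "g \<in> hom C (nil2_obj C B) W" "g \<cdot> ?k = \<zero> (nil2_obj C K) W" for W g
  proof -
    have gu: "g \<cdot> nil2_unit C B \<in> hom C B W" using u(2) g(1) by (rule comp_in_hom)
    have "(g \<cdot> nil2_unit C B) \<cdot> k = (g \<cdot> ?k) \<cdot> nil2_unit C K"
      using comp_assoc[OF k u(2) g(1)] comp_assoc[OF u(1) k'(1) g(1)] k'(2) by simp
    then have "(g \<cdot> nil2_unit C B) \<cdot> k = \<zero> K W" unfolding g(2) using u(1) W by (simp add: hom_iff)
    then obtain h where h: "h \<in> hom C A W" "h \<cdot> f = g \<cdot> nil2_unit C B" using c gu by blast
    obtain y where y: "y \<in> hom C (nil2_obj C A) W" "y \<cdot> nil2_unit C A = h"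
      using nil2_unit_factor[OF o(3) h(1) W] by blast
    have "(y \<cdot> ?f) \<cdot> nil2_unit C B = g \<cdot> nil2_unit C B"
      using comp_assoc[OF u(2) f'(1) y(1)] comp_assoc[OF f u(3) y(1)] f'(2) y(2) h(2) by simp
    then have "y \<cdot> ?f = g"
      by (rule regular_epi_cancel[OF e(2) u(2) comp_in_hom[OF f'(1) y(1)] g(1)])
    then show ?thesis using y by blast
  qed
  show ?thesis
    unfolding bilinear_prod_def bilinear_map_def nil2_map_ident[OF X]
    using nsmash_abelian[OF n(1)] n smap_hom[OF k'(1) n(1-3)] smap_hom[OF f'(1) n(1,3,4)]
      smap_right_exact[OF k'(1) f'(1) fr fk coker n] by blast
qed

end

theorem proposition4p12:
  fixes C :: "('o, 'm) precategory" and X K B A :: 'o and k f :: 'm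
  assumes "semi_abelian_category C"
    and "X \<in> Obj C"
    and "k \<in> hom C K B" and "f \<in> hom C B A"
    and "is_cokernel C f k"
  shows "is_abelian_obj C (bilinear_prod C X K) \<and>
         is_abelian_obj C (bilinear_prod C X B) \<and>
         is_abelian_obj C (bilinear_prod C X A) \<and>
         bilinear_map C (Ident C X) k \<in> hom C (bilinear_prod C X K) (bilinear_prod C X B) \<and>
         bilinear_map C (Ident C X) f \<in> hom C (bilinear_prod C X B) (bilinear_prod C X A) \<and>
         right_exact C (bilinear_map C (Ident C X) k) (bilinear_map C (Ident C X) f)"
  using assms by (rule semi_abelian_category.bilinear_prod_right_exact)

end
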